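(* Let $\mathcal{E}$ be a Dirichlet form in $L^2=L^2(X,m)$ and let $Y\subset X$ be measurable. Then the following assertions are equivalent: (1) $Y$ is invariant with respect to $\mathcal{E}^{(t)}$ for every $t>0$. (2) $Y$ is invariant with respect to $\mathcal{E}^{(\beta)}$ for every $\beta>0$. (3) $Y$ is invariant with respect to $\mathcal{E}$. Here $\mathcal{E}^{(t)}$ and $\mathcal{E}^{(\beta)}$ are the time-dependent and the Deny–Yosida approximations of $\mathcal{E}$, respectively.
   Context: $X$ is a Hausdorff topological space and $m$ is a positive $\sigma$-finite Radon measure on a $\sigma$-algebra $\mathcal{A}$ of subsets of $X$, with full support $X$. All equalities and inequalities of functions are understood $m$-a.e. $(\cdot,\cdot)$ is the scalar product of $L^2$. A Dirichlet form $\mathcal{E}$ with domain $\mathcal{D}\subset L^2$ is a (symmetric, nonnegative) densely defined closed quadratic form such that $u\in\mathcal{D}$ implies $u_{0,1}:=\min(\max(u,0),1)\in\mathcal{D}$ and $\mathcal{E}[u_{0,1}]\le\mathcal{E}[u]$. With $L$ the nonnegative selfadjoint operator of $\mathcal{E}$, its semigroup is $T_t=e^{-tL}$ ($t>0$) and its resolvent is $K_\beta=(L+\beta)^{-1}$ ($\beta>0$). Time-dependent approximation: for $t>0$, $\mathrm{dom}(\mathcal{E}^{(t)})=L^2$, $\mathcal{E}^{(t)}[u]=\frac1t(u-T_tu,u)$. Deny–Yosida approximation: for $\beta>0$, $\mathrm{dom}(\mathcal{E}^{(\beta)})=L^2$, $\mathcal{E}^{(\beta)}[u]=\beta(u-\beta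 K_\beta u,u)$. These are bounded Dirichlet forms in $L^2$; the superscript letter ($t$ or $\beta$) distinguishes the two families. A measurable set $Y$ is invariant with respect to a Dirichlet form if the semigroup $(P_s)_{s>0}$ of that form satisfies $P_s(1_Yu)=1_YP_su$ for all $u\in L^2$ and some (equivalently every) $s>0$. *)

theory Defs
  imports "HOL-Analysis.Analysis"
begin

text \<open>
  A Radon measure on a Hausdorff space: its \<open>\<sigma>\<close>-algebra contains the Borel sets
  (hence \<open>space M = UNIV\<close>), it is locally finite and inner regular with respect to compact sets.
\<close>

definition radon_measure :: "'a::t2_space measure \<Rightarrow> bool" where
  "radon_measure M \<longleftrightarrow>
     sets borel \<subseteq> sets M \<and>
     (\<forall>x. \<exists>U. open U \<and> x \<in> U \<and> emeasure M U < \<infinity>) \<and>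
     (\<forall>A \<in> sets M. emeasure M A = (SUP K \<in> {K. compact K \<and> K \<subseteq> A}. emeasure M K))"

definition measure_support :: "'a::topological_space measure \<Rightarrow> 'a set" where
  "measure_support M = {x. \<forall>U. open U \<longrightarrow> x \<in> U \<longrightarrow> emeasure M U > 0}"

text \<open>
  Elements of the real Hilbert space \<open>L\<^sup>2(X,m)\<close> are represented by square integrable functions;
  equality in \<open>L\<^sup>2\<close> is equality almost everywhere.
\<close>

definition L2 :: "'a measure \<Rightarrow> ('a \<Rightarrow> real) set" where
  "L2 M = {u \<in> borel_measurable M. integrable M (\<lambda>x. (u x)\<^sup>2)}"

definition L2_inner :: "'a measure \<Rightarrow> ('a \<Rightarrow> real) \<Rightarrow> ('a \<Rightarrow> real) \<Rightarrow> real" where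
  "L2_inner M u v = (\<integral>x. u x * v x \<partial>M)"

definition L2_norm :: "'a measure \<Rightarrow> ('a \<Rightarrow> real) \<Rightarrow> real" where
  "L2_norm M u = sqrt (L2_inner M u u)"

text \<open>A form consists of its domain and the functional \<open>u \<mapsto> \<E>[u]\<close>, relevant only on the domain.\<close>

record 'a qform =
  qdom :: "('a \<Rightarrow> real) set"
  qval :: "('a \<Rightarrow> real) \<Rightarrow> real"

definition polar :: "'a qform \<Rightarrow> ('a \<Rightarrow> real) \<Rightarrow> ('a \<Rightarrow> real) \<Rightarrow> real" where
  "polar E u v = (qval E (\<lambda>x. u x + v x) - qval E (\<lambda>x. u x - v x)) / 4"

text \<open>
  A nonnegative quadratic form in \<open>L\<^sup>2\<close>. The second condition says that domain and values depend only
  on the almost-everywhere classes. Symmetry of \<^const>\<open>polar\<close> and \<open>polar E u u = qval E u\<close> follow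
  from homogeneity, so linearity in one argument is enough.
\<close>

definition nonneg_quadratic_form :: "'a measure \<Rightarrow> 'a qform \<Rightarrow> bool" where
  "nonneg_quadratic_form M E \<longleftrightarrow>
     qdom E \<subseteq> L2 M \<and>
     (\<forall>u \<in> qdom E. \<forall>v \<in> L2 M. (AE x in M. u x = v x) \<longrightarrow> v \<in> qdom E \<and> qval E v = qval E u) \<and>
     (\<lambda>x. 0) \<in> qdom E \<and>
     (\<forall>u \<in> qdom E. \<forall>v \<in> qdom E. (\<lambda>x. u x + v x) \<in> qdom E) \<and>
     (\<forall>u \<in> qdom E. \<forall>c. (\<lambda>x. c * u x) \<in> qdom E \<and> qval E (\<lambda>x. c * u x) = c\<^sup>2 * qval E u) \<and>
     (\<forall>u \<in> qdom E. \<forall>v \<in> qdom E. \<forall>w \<in> qdom E.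
        polar E (\<lambda>x. u x + v x) w = polar E u w + polar E v w) \<and>
     (\<forall>u \<in> qdom E. \<forall>w \<in> qdom E. \<forall>c. polar E (\<lambda>x. c * u x) w = c * polar E u w) \<and>
     (\<forall>u \<in> qdom E. 0 \<le> qval E u)"

definition densely_defined :: "'a measure \<Rightarrow> 'a qform \<Rightarrow> bool" where
  "densely_defined M E \<longleftrightarrow>
     (\<forall>u \<in> L2 M. \<forall>e > 0. \<exists>v \<in> qdom E. L2_norm M (\<lambda>x. u x - v x) < e)"

definition closed_form :: "'a measure \<Rightarrow> 'a qform \<Rightarrow> bool" where
  "closed_form M E \<longleftrightarrow>
     (\<forall>f u. (\<forall>n::nat. f n \<in> qdom E) \<longrightarrow> u \<in> L2 M \<longrightarrow>
        (\<lambda>n. L2_norm M (\<lambda>x. f n x - u x)) \<longlonglongrightarrow> 0 \<longrightarrow>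
        (\<forall>e > 0. \<exists>N. \<forall>m \<ge> N. \<forall>n \<ge> N. qval E (\<lambda>x. f m x - f n x) < e) \<longrightarrow>
        u \<in> qdom E \<and> (\<lambda>n. qval E (\<lambda>x. f n x - u x)) \<longlonglongrightarrow> 0)"

definition dirichlet_form :: "'a measure \<Rightarrow> 'a qform \<Rightarrow> bool" where
  "dirichlet_form M E \<longleftrightarrow>
     nonneg_quadratic_form M E \<and> densely_defined M E \<and> closed_form M E \<and>
     (\<forall>u \<in> qdom E. (\<lambda>x. min (max (u x) 0) 1) \<in> qdom E \<and>
        qval E (\<lambda>x. min (max (u x) 0) 1) \<le> qval E u)"

text \<open>
  The graph of the nonnegative selfadjoint operator \<open>L\<close> of a form: \<open>u \<in> dom L\<close> and \<open>L u = f\<close>.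
\<close>

definition form_operator :: "'a measure \<Rightarrow> 'a qform \<Rightarrow> ('a \<Rightarrow> real) \<Rightarrow> ('a \<Rightarrow> real) \<Rightarrow> bool" where
  "form_operator M E u f \<longleftrightarrow>
     u \<in> qdom E \<and> f \<in> L2 M \<and> (\<forall>v \<in> qdom E. polar E u v = L2_inner M f v)"

text \<open>
  \<open>K\<^sub>\<beta> f = (L + \<beta>)\<^sup>-\<^sup>1 f\<close>. The choice operator only picks a representative: for \<open>f \<in> L\<^sup>2\<close> and
  \<open>\<beta> > 0\<close> the solution of \<open>(L + \<beta>) u = f\<close> exists and is unique almost everywhere.
\<close>

definition form_resolvent :: "'a measure \<Rightarrow> 'a qform \<Rightarrow> real \<Rightarrow> ('a \<Rightarrow> real) \<Rightarrow> ('a \<Rightarrow> real)" where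
  "form_resolvent M E \<beta> f =
     (SOME u. \<exists>g. form_operator M E u g \<and> (AE x in M. g x + \<beta> * u x = f x))"

text \<open>Strongly continuous semigroups of bounded linear operators in \<open>L\<^sup>2\<close>; only times \<open>t \<ge> 0\<close> matter.\<close>

definition C0_semigroup :: "'a measure \<Rightarrow> (real \<Rightarrow> ('a \<Rightarrow> real) \<Rightarrow> ('a \<Rightarrow> real)) \<Rightarrow> bool" where
  "C0_semigroup M T \<longleftrightarrow>
     (\<forall>t \<ge> 0. \<forall>u \<in> L2 M. T t u \<in> L2 M) \<and>
     (\<forall>t \<ge> 0. \<forall>u \<in> L2 M. \<forall>v \<in> L2 M. AE x in M. T t (\<lambda>y. u y + v y) x = T t u x + T t v x) \<and>
     (\<forall>t \<ge> 0. \<forall>u \<in> L2 M. \<forall>c. AE x in M. T t (\<lambda>y. c * u y) x = c * T t u x) \<and>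
     (\<forall>t \<ge> 0. \<exists>C. \<forall>u \<in> L2 M. L2_norm M (T t u) \<le> C * L2_norm M u) \<and>
     (\<forall>u \<in> L2 M. AE x in M. T 0 u x = u x) \<and>
     (\<forall>s \<ge> 0. \<forall>t \<ge> 0. \<forall>u \<in> L2 M. AE x in M. T (s + t) u x = T s (T t u) x) \<and>
     (\<forall>u \<in> L2 M. ((\<lambda>t. L2_norm M (\<lambda>x. T t u x - u x)) \<longlongrightarrow> 0) (at_right 0))"

text \<open>The graph of the generator of \<open>T\<close>.\<close>

definition generator ::
  "'a measure \<Rightarrow> (real \<Rightarrow> ('a \<Rightarrow> real) \<Rightarrow> ('a \<Rightarrow> real)) \<Rightarrow> ('a \<Rightarrow> real) \<Rightarrow> ('a \<Rightarrow> real) \<Rightarrow> bool" where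
  "generator M T u f \<longleftrightarrow>
     u \<in> L2 M \<and> f \<in> L2 M \<and>
     ((\<lambda>t. L2_norm M (\<lambda>x. (T t u x - u x) / t - f x)) \<longlongrightarrow> 0) (at_right 0)"

text \<open>
  \<open>T\<^sub>t = e\<^sup>-\<^sup>t\<^sup>L\<close>, the strongly continuous semigroup with generator \<open>-L\<close>. For densely defined closed
  nonnegative forms it exists, and each \<open>T\<^sub>t u\<close> is unique almost everywhere.
\<close>

definition form_semigroup :: "'a measure \<Rightarrow> 'a qform \<Rightarrow> real \<Rightarrow> ('a \<Rightarrow> real) \<Rightarrow> ('a \<Rightarrow> real)" where
  "form_semigroup M E =
     (SOME T. C0_semigroup M T \<and>
        (\<forall>u f. generator M T u (\<lambda>x. - f x) \<longleftrightarrow> form_operator M E u f))"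

definition time_approx :: "'a measure \<Rightarrow> 'a qform \<Rightarrow> real \<Rightarrow> 'a qform" where
  "time_approx M E t =
     \<lparr> qdom = L2 M,
       qval = (\<lambda>u. 1 / t * L2_inner M (\<lambda>x. u x - form_semigroup M E t u x) u) \<rparr>"

definition deny_yosida_approx :: "'a measure \<Rightarrow> 'a qform \<Rightarrow> real \<Rightarrow> 'a qform" where
  "deny_yosida_approx M E \<beta> =
     \<lparr> qdom = L2 M,
       qval = (\<lambda>u. \<beta> * L2_inner M (\<lambda>x. u x - \<beta> * form_resolvent M E \<beta> u x) u) \<rparr>"

definition form_invariant :: "'a measure \<Rightarrow> 'a qform \<Rightarrow> 'a set \<Rightarrow> bool" where
  "form_invariant M E Y \<longleftrightarrow>
     (\<exists>s > 0. \<forall>u \<in> L2 M. AE x in M.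
        form_semigroup M E s (\<lambda>y. indicator Y y * u y) x = indicator Y x * form_semigroup M E s u x)"

end

theory Submission
  imports Defs "HOL-Library.Function_Algebras"
begin

text \<open>
  Let \<open>L\<close> be the nonnegative selfadjoint operator of the form and \<open>P\<close> the orthogonal projection
  \<open>u \<mapsto> 1\<^sub>Y u\<close>. All three assertions say that \<open>P\<close> reduces \<open>L\<close>, that is, \<open>L u = f\<close> implies
  \<open>L (P u) = P f\<close>. The core is the following statement about any densely defined closed
  nonnegative form (\<open>form_invariant_iff_op\<close>): a single operator \<open>T\<^sub>s\<close> of its semigroup commutes
  with \<open>P\<close> if and only if \<open>P\<close> reduces \<open>L\<close>, and then every \<open>T\<^sub>s\<close> commutes with \<open>P\<close>. The
  approximating forms are bounded forms of the same kind; their operators are \<open>(1 - T\<^sub>t) / t\<close> and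
  \<open>\<beta> (1 - \<beta> K\<^sub>\<beta>)\<close>. A projection reduces an everywhere defined bounded operator exactly when it
  commutes with it, so that applying the core statement to the approximating forms turns their
  invariance into commutation of \<open>P\<close> with \<open>T\<^sub>t\<close> or with \<open>K\<^sub>\<beta>\<close> (\<open>defect_form_invariant\<close>). Applied
  to the form itself it shows that commutation with one \<open>T\<^sub>t\<close> is invariance with respect to the form,
  and for \<open>K\<^sub>\<beta> = (L + \<beta>)\<^sup>-\<^sup>1\<close> the same equivalence is immediate.

  The core statement rests on three facts.

  \<^item> Existence. The semigroup is obtained as the limit of the implicit Euler iterates
    \<open>(1 + h L)\<^sup>-\<^sup>k\<close> with \<open>h = 2\<^sup>-\<^sup>n\<close> and \<open>k h \<approx> t\<close>. Halving the step changes an iterate by a multiple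
    of the step, on the dense domain of \<open>L\<^sup>2\<close>, so the iterates converge; the bounds pass to the limit
    and identify the generator as \<open>-L\<close> (\<open>gen_S\<close>). Bounded operators that commute with
    the resolvents then commute with the semigroup.
  \<^item> Uniqueness. The semigroup of a form is specified by its generator only, without any bound
    on its norms. The uniform boundedness principle makes such a semigroup locally bounded. It
    commutes with the resolvents of its generator, hence with the Euler limit, and a telescoping
    estimate identifies the two (\<open>C0_unique\<close>). Thus it is selfadjoint and contractive.
  \<^item> Square roots. If \<open>P\<close> commutes with \<open>T\<^sub>s\<close>, it commutes with the positive square root
    \<open>T\<^bsub>s/2\<^esub>\<close> (\<open>commute_sqrt\<close>), hence with \<open>T\<^sub>t\<close> for all dyadic multiples \<open>t\<close> of \<open>s\<close>, by continuity
    for all \<open>t\<close>, and so with the generator.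

  Equality almost everywhere is turned into equality by choosing representatives linearly, through a
  projection of the space of all functions whose kernel consists of the square integrable functions
  that vanish almost everywhere (\<open>rep\<close>). On the image of the square integrable functions the \<open>L\<^sup>2\<close>
  inner product is definite and complete. The Hilbert space theory is therefore developed for a
  subspace of a real vector space.
\<close>

section \<open>Complete inner product spaces\<close>

text \<open>
  A Hilbert space carried by a linear subspace of a vector space; the inner product matters only there.
  The carrier is a set and not a type because the space of square integrable functions depends on the measure.
\<close>

locale hilbert_subspace =
  fixes W :: "'h::real_vector set" and ip :: "'h \<Rightarrow> 'h \<Rightarrow> real"
  assumes subspace_W: "subspace W"
    and ip_add_left: "\<lbrakk>x \<in> W; y \<in> W; z \<in> W\<rbrakk> \<Longrightarrow> ip (x + y) z = ip x z + ip y z"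
    and ip_scale_left: "\<lbrakk>x \<in> W; z \<in> W\<rbrakk> \<Longrightarrow> ip (c *\<^sub>R x) z = c * ip x z"
    and ip_commute: "\<lbrakk>x \<in> W; y \<in> W\<rbrakk> \<Longrightarrow> ip x y = ip y x"
    and ip_nonneg: "x \<in> W \<Longrightarrow> 0 \<le> ip x x"
    and ip_definite: "\<lbrakk>x \<in> W; ip x x = 0\<rbrakk> \<Longrightarrow> x = 0"
    and complete: "\<lbrakk>\<And>n::nat. a n \<in> W;
        \<And>e. 0 < e \<Longrightarrow> \<exists>N. \<forall>m\<ge>N. \<forall>n\<ge>N. sqrt (ip (a m - a n) (a m - a n)) < e\<rbrakk>
      \<Longrightarrow> \<exists>w\<in>W. (\<lambda>n. sqrt (ip (a n - w) (a n - w))) \<longlonglongrightarrow> 0"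
begin

lemma W_add [simp, intro]: "x \<in> W \<Longrightarrow> y \<in> W \<Longrightarrow> x + y \<in> W"
  and W_diff [simp, intro]: "x \<in> W \<Longrightarrow> y \<in> W \<Longrightarrow> x - y \<in> W"
  and W_scale [simp, intro]: "x \<in> W \<Longrightarrow> c *\<^sub>R x \<in> W"
  and W_zero [simp, intro]: "0 \<in> W"
  and W_minus [simp, intro]: "x \<in> W \<Longrightarrow> - x \<in> W"
  using subspace_W by (auto simp: subspace_add subspace_diff subspace_scale subspace_0 subspace_neg)

definition nrm :: "'h \<Rightarrow> real" where "nrm x = sqrt (ip x x)"

lemma ip_add_right: "\<lbrakk>x \<in> W; y \<in> W; z \<in> W\<rbrakk> \<Longrightarrow> ip z (x + y) = ip z x + ip z y"
  by (metis W_add ip_add_left ip_commute)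

lemma ip_scale_right: "\<lbrakk>x \<in> W; z \<in> W\<rbrakk> \<Longrightarrow> ip z (c *\<^sub>R x) = c * ip z x"
  by (metis W_scale ip_scale_left ip_commute)

lemma ip_minus_left: "\<lbrakk>x \<in> W; z \<in> W\<rbrakk> \<Longrightarrow> ip (- x) z = - ip x z"
  using ip_scale_left[of x z "-1"] by simp

lemma ip_minus_right: "\<lbrakk>x \<in> W; z \<in> W\<rbrakk> \<Longrightarrow> ip z (- x) = - ip z x"
  using ip_scale_right[of x z "-1"] by simp

lemma ip_diff_left: "\<lbrakk>x \<in> W; y \<in> W; z \<in> W\<rbrakk> \<Longrightarrow> ip (x - y) z = ip x z - ip y z"
  using ip_add_left[of x "-y" z] by (simp add: ip_minus_left)

lemma ip_diff_right: "\<lbrakk>x \<in> W; y \<in> W; z \<in> W\<rbrakk> \<Longrightarrow> ip z (x - y) = ip z x - ip z y"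
  using ip_add_right[of x "-y" z] by (simp add: ip_minus_right)

lemma ip_zero_left [simp]: "z \<in> W \<Longrightarrow> ip 0 z = 0"
  using ip_scale_left[of 0 z 0] by simp

lemma ip_zero_right [simp]: "z \<in> W \<Longrightarrow> ip z 0 = 0"
  using ip_scale_right[of 0 z 0] by simp

lemmas ip_linear = ip_add_left ip_add_right ip_diff_left ip_diff_right ip_scale_left ip_scale_right
  ip_minus_left ip_minus_right

lemma nrm_nonneg [simp]: "x \<in> W \<Longrightarrow> 0 \<le> nrm x"
  by (simp add: nrm_def ip_nonneg)

lemma nrm_sq: "x \<in> W \<Longrightarrow> (nrm x)\<^sup>2 = ip x x"
  by (simp add: nrm_def ip_nonneg)

lemma nrm_zero [simp]: "nrm 0 = 0"
  by (simp add: nrm_def)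

lemma nrm_eq_0: "x \<in> W \<Longrightarrow> nrm x = 0 \<longleftrightarrow> x = 0"
  using ip_definite by (auto simp: nrm_def)

lemma nrm_scale: "x \<in> W \<Longrightarrow> nrm (c *\<^sub>R x) = \<bar>c\<bar> * nrm x"
proof -
  assume "x \<in> W"
  then have "ip (c *\<^sub>R x) (c *\<^sub>R x) = c\<^sup>2 * ip x x"
    by (simp add: ip_linear power2_eq_square)
  then show ?thesis
    by (simp add: nrm_def real_sqrt_mult)
qed

lemma nrm_minus: "x \<in> W \<Longrightarrow> nrm (- x) = nrm x"
  using nrm_scale[of x "-1"] by simp

lemma nrm_diff_commute: "x \<in> W \<Longrightarrow> y \<in> W \<Longrightarrow> nrm (x - y) = nrm (y - x)"
  using nrm_minus[of "x - y"] by simp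

lemma Cauchy_Schwarz:
  assumes "x \<in> W" "y \<in> W" shows "\<bar>ip x y\<bar> \<le> nrm x * nrm y"
proof (cases "y = 0")
  case False
  then have pos: "0 < ip y y"
    using assms ip_nonneg[of y] ip_definite[of y] by fastforce
  let ?c = "ip x y / ip y y"
  have "0 \<le> ip (x - ?c *\<^sub>R y) (x - ?c *\<^sub>R y)"
    using assms by (intro ip_nonneg) auto
  also have "\<dots> = ip x x - (ip x y)\<^sup>2 / ip y y"
    using assms pos ip_commute[of x y]
    by (simp add: ip_linear field_simps power2_eq_square)
  finally have "(ip x y)\<^sup>2 \<le> ip x x * ip y y"
    using pos by (simp add: field_simps)
  then have "sqrt ((ip x y)\<^sup>2) \<le> sqrt (ip x x * ip y y)"
    by (rule real_sqrt_le_mono)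
  then show ?thesis
    by (simp add: nrm_def real_sqrt_mult)
qed (use assms in simp)

lemma nrm_triangle:
  assumes "x \<in> W" "y \<in> W" shows "nrm (x + y) \<le> nrm x + nrm y"
proof -
  have "(nrm (x + y))\<^sup>2 = (nrm x)\<^sup>2 + 2 * ip x y + (nrm y)\<^sup>2"
    using assms ip_commute[of x y] by (simp add: nrm_sq ip_linear)
  also have "\<dots> \<le> (nrm x + nrm y)\<^sup>2"
    using Cauchy_Schwarz[OF assms] by (simp add: power2_sum)
  finally show ?thesis
    using assms by (meson add_nonneg_nonneg nrm_nonneg power2_le_imp_le)
qed

lemma nrm_diff_triangle:
  assumes "x \<in> W" "y \<in> W" "z \<in> W" shows "nrm (x - z) \<le> nrm (x - y) + nrm (y - z)"
  using nrm_triangle[of "x - y" "y - z"] assms by simp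

lemma nrm_diff_le:
  assumes "x \<in> W" "y \<in> W" shows "nrm (x - y) \<le> nrm x + nrm y"
  using nrm_triangle[of x "- y"] assms by (simp add: nrm_minus)

lemma nrm_reverse_triangle:
  assumes "x \<in> W" "y \<in> W" shows "\<bar>nrm x - nrm y\<bar> \<le> nrm (x - y)"
  using nrm_triangle[of "x - y" y] nrm_triangle[of "y - x" x] assms nrm_diff_commute[of x y]
  by simp

lemma eq_if_close:
  assumes "x \<in> W" "y \<in> W" "\<And>e. 0 < e \<Longrightarrow> nrm (x - y) \<le> e" shows "x = y"
proof -
  have "nrm (x - y) \<le> 0"
    using assms(3) by (rule field_le_epsilon[of _ 0, simplified])
  then have "nrm (x - y) = 0"
    using assms nrm_nonneg[of "x - y"] by (intro antisym) auto
  then show ?thesis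
    using assms nrm_eq_0[of "x - y"] by auto
qed

definition conv :: "(nat \<Rightarrow> 'h) \<Rightarrow> 'h \<Rightarrow> bool" where
  "conv a w \<longleftrightarrow> (\<lambda>n. nrm (a n - w)) \<longlonglongrightarrow> 0"

lemma conv_squeeze:
  assumes "b \<longlonglongrightarrow> 0" "\<And>n. a n \<in> W" "w \<in> W" "\<And>n. nrm (a n - w) \<le> b n"
  shows "conv a w"
  unfolding conv_def
  by (rule tendsto_sandwich[OF _ _ tendsto_const assms(1)]) (use assms in auto)

lemma conv_nrm:
  assumes "conv a w" "\<And>n. a n \<in> W" "w \<in> W"
  shows "(\<lambda>n. nrm (a n)) \<longlonglongrightarrow> nrm w"
proof -
  have "(\<lambda>n. nrm (a n) - nrm w) \<longlonglongrightarrow> 0"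
    by (rule tendsto_rabs_zero_cancel,
        rule tendsto_sandwich[OF _ _ tendsto_const assms(1)[unfolded conv_def]])
       (use assms nrm_reverse_triangle in auto)
  then show ?thesis
    by (simp add: LIM_zero_iff)
qed

lemma conv_diff:
  assumes "conv a v" "conv b w" "\<And>n. a n \<in> W" "\<And>n. b n \<in> W" "v \<in> W" "w \<in> W"
  shows "conv (\<lambda>n. a n - b n) (v - w)"
proof (rule conv_squeeze)
  show "(\<lambda>n. nrm (a n - v) + nrm (b n - w)) \<longlonglongrightarrow> 0"
    using tendsto_add[OF assms(1,2)[unfolded conv_def]] by simp
  show "nrm (a n - b n - (v - w)) \<le> nrm (a n - v) + nrm (b n - w)" for n
    using nrm_diff_le[of "a n - v" "b n - w"] assms by (simp add: algebra_simps)
qed (use assms in auto)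

lemma conv_scale:
  assumes "conv a v" "\<And>n. a n \<in> W" "v \<in> W"
  shows "conv (\<lambda>n. c *\<^sub>R a n) (c *\<^sub>R v)"
proof (rule conv_squeeze)
  show "(\<lambda>n. \<bar>c\<bar> * nrm (a n - v)) \<longlonglongrightarrow> 0"
    using tendsto_mult_left[OF assms(1)[unfolded conv_def], of "\<bar>c\<bar>"] by simp
  show "nrm (c *\<^sub>R a n - c *\<^sub>R v) \<le> \<bar>c\<bar> * nrm (a n - v)" for n
    using assms nrm_scale[of "a n - v" c] by (simp add: scaleR_right_diff_distrib)
qed (use assms in auto)

lemma conv_add:
  assumes "conv a v" "conv b w" "\<And>n. a n \<in> W" "\<And>n. b n \<in> W" "v \<in> W" "w \<in> W"
  shows "conv (\<lambda>n. a n + b n) (v + w)"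
  using conv_diff[OF assms(1) conv_scale[OF assms(2), of "-1"]] assms by simp

lemma conv_unique:
  assumes "conv a v" "conv a w" "\<And>n. a n \<in> W" "v \<in> W" "w \<in> W"
  shows "v = w"
proof -
  have "(\<lambda>n. nrm (a n - a n)) \<longlonglongrightarrow> nrm (v - w)"
    by (rule conv_nrm[OF conv_diff[OF assms(1,2)]]) (use assms in auto)
  then have "nrm (v - w) = 0"
    by (simp add: LIMSEQ_const_iff)
  then show ?thesis
    using nrm_eq_0[of "v - w"] assms by simp
qed

lemma conv_ip:
  assumes "conv a w" "\<And>n. a n \<in> W" "w \<in> W" "v \<in> W"
  shows "(\<lambda>n. ip (a n) v) \<longlonglongrightarrow> ip w v"
proof -
  have lim: "(\<lambda>n. nrm (a n - w) * nrm v) \<longlonglongrightarrow> 0"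
    using tendsto_mult_right[OF assms(1)[unfolded conv_def], of "nrm v"] by simp
  have "(\<lambda>n. ip (a n) v - ip w v) \<longlonglongrightarrow> 0"
  proof (rule tendsto_rabs_zero_cancel, rule tendsto_sandwich[OF _ _ tendsto_const lim])
    show "\<forall>\<^sub>F n in sequentially. \<bar>ip (a n) v - ip w v\<bar> \<le> nrm (a n - w) * nrm v"
      using assms Cauchy_Schwarz[of "a _ - w" v] by (simp add: ip_diff_left)
  qed simp
  then show ?thesis
    by (simp add: LIM_zero_iff)
qed

lemma Cauchy_conv:
  assumes "\<And>n. a n \<in> W" "\<And>e. 0 < e \<Longrightarrow> \<exists>N. \<forall>m\<ge>N. \<forall>n\<ge>N. nrm (a m - a n) < e"
  obtains w where "w \<in> W" "conv a w"
  using complete[of a] assms unfolding conv_def nrm_def by blast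

text \<open>
  The representing vector minimises \<open>ip u u - 2 * \<phi> u\<close>; a minimising sequence is Cauchy by the
  parallelogram law.
\<close>

theorem Riesz_representation:
  assumes add: "\<And>u v. \<lbrakk>u \<in> W; v \<in> W\<rbrakk> \<Longrightarrow> \<phi> (u + v) = \<phi> u + \<phi> v"
    and scale: "\<And>u c. u \<in> W \<Longrightarrow> \<phi> (c *\<^sub>R u) = c * \<phi> u"
    and bdd: "\<And>u. u \<in> W \<Longrightarrow> \<bar>\<phi> u\<bar> \<le> C * nrm u"
  obtains w where "w \<in> W" "\<And>v. v \<in> W \<Longrightarrow> ip w v = \<phi> v"
proof -
  define F where "F u = ip u u - 2 * \<phi> u" for u
  have lower: "- (C\<^sup>2) \<le> F u" if "u \<in> W" for u
  proof -
    have "0 \<le> (nrm u - C)\<^sup>2" by simp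
    also have "\<dots> = (nrm u)\<^sup>2 - 2 * (C * nrm u) + C\<^sup>2"
      by (simp add: power2_diff)
    also have "\<dots> \<le> F u + C\<^sup>2"
      using bdd[OF that] that by (simp add: F_def nrm_sq)
    finally show ?thesis by simp
  qed
  define I where "I = Inf (F ` W)"
  have bb: "bdd_below (F ` W)"
    using lower by (auto simp: bdd_below_def)
  have I_le: "I \<le> F u" if "u \<in> W" for u
    unfolding I_def using bb that by (intro cInf_lower) auto
  have "\<exists>u\<in>W. F u < I + 1 / real (Suc n)" for n
  proof -
    have "I < I + 1 / real (Suc n)" by simp
    then show ?thesis
      unfolding I_def using cInf_less_iff[OF _ bb] W_zero by blast
  qed
  then obtain u where uW: "\<And>n. u n \<in> W" and uF: "\<And>n. F (u n) < I + 1 / real (Suc n)"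
    by metis
  have F_diff: "F (x + y) = F x + 2 * (ip x y - \<phi> y) + ip y y" if "x \<in> W" "y \<in> W" for x y
    using that ip_commute[of x y] by (simp add: F_def ip_linear add)
  have para: "ip (x - y) (x - y) = 2 * F x + 2 * F y - 4 * F ((1/2) *\<^sub>R (x + y))"
    if "x \<in> W" "y \<in> W" for x y
    using that ip_commute[of x y] by (simp add: F_def ip_linear add scale algebra_simps)
  have close: "ip (u m - u n) (u m - u n) \<le> 2 / real (Suc m) + 2 / real (Suc n)" for m n
    using para[OF uW uW, of m n] I_le[of "(1/2) *\<^sub>R (u m + u n)"] uF[of m] uF[of n] uW
    by simp
  obtain w where w: "w \<in> W" "conv u w"
  proof (rule Cauchy_conv[of u])
    fix e :: real assume "0 < e"
    then obtain N where N: "4 / e\<^sup>2 < real N"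
      using reals_Archimedean2 by blast
    have "nrm (u m - u n) < e" if "N \<le> m" "N \<le> n" for m n
    proof -
      have N0: "0 < real N"
        using N \<open>0 < e\<close> by (intro le_less_trans[OF _ N]) simp
      have "2 / real (Suc k) < 2 / real N" if "N \<le> k" for k
        using that N0 by (intro divide_strict_left_mono) auto
      from this[OF that(1)] this[OF that(2)] have "ip (u m - u n) (u m - u n) < 4 / real N"
        using close[of m n] by simp
      also have "\<dots> < e\<^sup>2"
        using N N0 \<open>0 < e\<close> by (simp add: field_simps)
      finally show ?thesis
        unfolding nrm_def using \<open>0 < e\<close> real_sqrt_less_mono by fastforce
    qed
    then show "\<exists>N. \<forall>m\<ge>N. \<forall>n\<ge>N. nrm (u m - u n) < e" by blast
  qed (use uW in auto)
  have main: "ip w v = \<phi> v" if v: "v \<in> W" for v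
  proof (rule ccontr)
    define d where "d = ip w v - \<phi> v"
    \<comment> \<open>The derivative at the minimiser in direction \<open>v\<close> is \<open>2 * d\<close>.\<close>
    have ineq: "0 \<le> 2 * t * d + t\<^sup>2 * ip v v" for t
    proof -
      have "- 1 / real (Suc n) \<le> 2 * (t * (ip (u n) v - \<phi> v)) + t\<^sup>2 * ip v v" for n
        using I_le[of "u n + t *\<^sub>R v"] uF[of n] F_diff[of "u n" "t *\<^sub>R v"] uW[of n] v
        by (simp add: ip_linear scale algebra_simps power2_eq_square)
      moreover have "(\<lambda>n. - 1 / real (Suc n)) \<longlonglongrightarrow> 0"
        using tendsto_minus[OF LIMSEQ_inverse_real_of_nat] by (simp add: inverse_eq_divide)
      moreover have "(\<lambda>n. 2 * (t * (ip (u n) v - \<phi> v)) + t\<^sup>2 * ip v v)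
          \<longlonglongrightarrow> 2 * (t * (ip w v - \<phi> v)) + t\<^sup>2 * ip v v"
        by (intro tendsto_intros conv_ip w uW v)
      ultimately have "0 \<le> 2 * (t * (ip w v - \<phi> v)) + t\<^sup>2 * ip v v"
        by (intro LIMSEQ_le) auto
      then show ?thesis by (simp add: d_def algebra_simps)
    qed
    assume "ip w v \<noteq> \<phi> v"
    then have "d \<noteq> 0" by (simp add: d_def)
    have "0 < 1 + ip v v" using ip_nonneg[OF v] by simp
    define s where "s = 1 + ip v v"
    have s: "0 < s" "ip v v = s - 1"
      using \<open>0 < 1 + ip v v\<close> by (simp_all add: s_def)
    have "0 \<le> 2 * (- d / s) * d + (- d / s)\<^sup>2 * (s - 1)"
      using ineq[of "- d / s"] s by simp
    also have "\<dots> = - (d\<^sup>2 / s) - (d / s)\<^sup>2"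
      using s(1) by (simp add: field_simps power2_eq_square)
    also have "\<dots> < 0"
      using s(1) \<open>d \<noteq> 0\<close> add_pos_pos[of "d\<^sup>2 / s" "(d / s)\<^sup>2"] by simp
    finally show False by simp
  qed

  show thesis
    using that w main by blast
qed

text \<open>
  Cauchy's criterion for sequences whose steps are bounded by the decrements of a null sequence, which then
  also bounds the distance to the limit.
\<close>

lemma telescoping_conv:
  assumes d: "d \<longlonglongrightarrow> 0" and a: "\<And>n. a n \<in> W"
    and step: "\<And>n. nrm (a n - a (Suc n)) \<le> d n - d (Suc n)"
  obtains w where "w \<in> W" "conv a w" "\<And>n. nrm (a n - w) \<le> d n"
proof -
  have tail: "nrm (a m - a n) \<le> d m - d n" if "m \<le> n" for m n
    using that
  proof (induction n rule: dec_induct)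
    case (step n)
    then show ?case
      using nrm_diff_triangle[of "a m" "a n" "a (Suc n)"] a assms(3)[of n] by simp
  qed simp
  obtain w where w: "w \<in> W" "conv a w"
  proof (rule Cauchy_conv[OF a])
    fix e :: real assume "0 < e"
    then obtain N where N: "\<And>n. N \<le> n \<Longrightarrow> \<bar>d n\<bar> < e / 2"
      using d unfolding LIMSEQ_def by (metis diff_zero dist_real_def half_gt_zero)
    have "nrm (a m - a n) < e" if "N \<le> m" "N \<le> n" for m n
      using tail[of m n] tail[of n m] N[OF that(1)] N[OF that(2)] nrm_diff_commute[OF a a, of m n]
      by (cases "m \<le> n") auto
    then show "\<exists>N. \<forall>m\<ge>N. \<forall>n\<ge>N. nrm (a m - a n) < e" by blast
  qed
  have "nrm (a m - w) \<le> d m" for m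
  proof -
    have lim: "(\<lambda>n. nrm (a n - w) + (d m - d n)) \<longlonglongrightarrow> 0 + (d m - 0)"
      using w(2) d unfolding conv_def by (intro tendsto_intros)
    have "nrm (a m - w) \<le> nrm (a n - w) + (d m - d n)" if "m \<le> n" for n
      using nrm_diff_triangle[of "a m" "a n" w] tail[OF that] a w(1) by simp
    then have "nrm (a m - w) \<le> 0 + (d m - 0)"
      by (intro LIMSEQ_le_const[OF lim]) blast
    then show ?thesis by simp
  qed
  then show thesis using that w by blast
qed

section \<open>Bounded operators\<close>

definition lin :: "('h \<Rightarrow> 'h) \<Rightarrow> bool" where
  "lin B \<longleftrightarrow> (\<forall>x\<in>W. B x \<in> W) \<and> (\<forall>x\<in>W. \<forall>y\<in>W. B (x + y) = B x + B y) \<and>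
     (\<forall>x\<in>W. \<forall>c. B (c *\<^sub>R x) = c *\<^sub>R B x)"

definition bounded_by :: "real \<Rightarrow> ('h \<Rightarrow> 'h) \<Rightarrow> bool" where
  "bounded_by C B \<longleftrightarrow> (\<forall>x\<in>W. nrm (B x) \<le> C * nrm x)"

definition commute :: "('h \<Rightarrow> 'h) \<Rightarrow> ('h \<Rightarrow> 'h) \<Rightarrow> bool" where
  "commute A B \<longleftrightarrow> (\<forall>x\<in>W. A (B x) = B (A x))"

definition symm :: "('h \<Rightarrow> 'h) \<Rightarrow> bool" where
  "symm B \<longleftrightarrow> (\<forall>x\<in>W. \<forall>y\<in>W. ip (B x) y = ip x (B y))"

lemma lin_W [simp, intro]: "lin B \<Longrightarrow> x \<in> W \<Longrightarrow> B x \<in> W"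
  and lin_add: "lin B \<Longrightarrow> x \<in> W \<Longrightarrow> y \<in> W \<Longrightarrow> B (x + y) = B x + B y"
  and lin_scale: "lin B \<Longrightarrow> x \<in> W \<Longrightarrow> B (c *\<^sub>R x) = c *\<^sub>R B x"
  unfolding lin_def by blast+

lemma lin_minus: "lin B \<Longrightarrow> x \<in> W \<Longrightarrow> B (- x) = - B x"
  using lin_scale[of B x "-1"] by simp

lemma lin_diff: "lin B \<Longrightarrow> x \<in> W \<Longrightarrow> y \<in> W \<Longrightarrow> B (x - y) = B x - B y"
  using lin_add[of B x "-y"] by (simp add: lin_minus)

lemma lin_zero: "lin B \<Longrightarrow> B 0 = 0"
  using lin_scale[of B 0 0] by simp

lemma lin_funpow: "lin B \<Longrightarrow> lin (B ^^ k)"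
  by (induction k) (auto simp: lin_def)

lemma lin_comp: "lin A \<Longrightarrow> lin B \<Longrightarrow> lin (\<lambda>x. A (B x))"
  by (auto simp: lin_def)

lemma bounded_byD: "bounded_by C B \<Longrightarrow> x \<in> W \<Longrightarrow> nrm (B x) \<le> C * nrm x"
  by (simp add: bounded_by_def)

lemma contractionD: "bounded_by 1 B \<Longrightarrow> x \<in> W \<Longrightarrow> nrm (B x) \<le> nrm x"
  by (simp add: bounded_by_def)

lemma bounded_funpow:
  assumes "lin B" "bounded_by C B" "0 \<le> C" shows "bounded_by (C ^ k) (B ^^ k)"
proof (induction k)
  case (Suc k)
  show ?case unfolding bounded_by_def
  proof
    fix x assume x: "x \<in> W"
    have "nrm (B ((B ^^ k) x)) \<le> C * nrm ((B ^^ k) x)"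
      using assms x lin_funpow[OF assms(1)] by (intro bounded_byD) auto
    also have "\<dots> \<le> C * (C ^ k * nrm x)"
      using Suc assms x by (intro mult_left_mono bounded_byD) auto
    finally show "nrm ((B ^^ Suc k) x) \<le> C ^ Suc k * nrm x" by (simp add: mult.assoc)
  qed
qed (simp add: bounded_by_def)

lemma contraction_funpow: "lin B \<Longrightarrow> bounded_by 1 B \<Longrightarrow> bounded_by 1 (B ^^ k)"
  using bounded_funpow[of B 1] by simp

lemma conv_lin:
  assumes "lin B" "bounded_by C B" "conv a w" "\<And>n. a n \<in> W" "w \<in> W"
  shows "conv (\<lambda>n. B (a n)) (B w)"
proof (rule conv_squeeze)
  show "(\<lambda>n. C * nrm (a n - w)) \<longlonglongrightarrow> 0"
    using tendsto_mult_left[OF assms(3)[unfolded conv_def], of C] by simp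
  show "nrm (B (a n) - B w) \<le> C * nrm (a n - w)" for n
    using bounded_byD[OF assms(2), of "a n - w"] assms by (simp add: lin_diff)
qed (use assms in auto)

lemma commuteD: "commute A B \<Longrightarrow> x \<in> W \<Longrightarrow> A (B x) = B (A x)"
  by (simp add: commute_def)

lemma commute_sym: "commute A B \<Longrightarrow> commute B A"
  by (simp add: commute_def)

lemma commute_funpow:
  assumes "commute A B" "lin B" shows "commute A (B ^^ k)"
proof (induction k)
  case (Suc k)
  then show ?case
    using assms(1) lin_W[OF lin_funpow[OF assms(2), of k]]
    unfolding commute_def funpow.simps comp_def by (metis)
qed (simp add: commute_def)

lemma symm_funpow:
  assumes "symm B" "lin B" shows "symm (B ^^ k)"
proof (induction k)
  case (Suc k)
  show ?case unfolding symm_def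
  proof (intro ballI)
    fix x y assume xy: "x \<in> W" "y \<in> W"
    have "ip (B ((B ^^ k) x)) y = ip ((B ^^ k) x) (B y)"
      using assms xy lin_funpow[OF assms(2), of k] by (simp add: symm_def)
    also have "\<dots> = ip x ((B ^^ k) (B y))"
      using Suc assms xy by (simp add: symm_def)
    finally show "ip ((B ^^ Suc k) x) y = ip x ((B ^^ Suc k) y)"
      by (simp add: funpow_swap1)
  qed
qed (simp add: symm_def)

text \<open>
  The telescoping sum \<open>A\<^sup>n - B\<^sup>n = \<Sum> A\<^sup>n\<^sup>-\<^sup>1\<^sup>-\<^sup>i (A - B) B\<^sup>i\<close>, with the factors reordered by commutation so that the
  difference acts first and need only be small on the given vector.
\<close>

lemma power_diff_bound:
  assumes A: "lin A" "\<And>j. j < n \<Longrightarrow> bounded_by C (A ^^ j)"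
    and B: "lin B" "bounded_by 1 B" and AB: "commute A B" and C: "0 \<le> C" and u: "u \<in> W"
  shows "nrm ((A ^^ n) u - (B ^^ n) u) \<le> real n * (C * nrm (A u - B u))"
  using A(2)
proof (induction n)
  case (Suc n)
  note An = lin_funpow[OF A(1), of n] and Bn = lin_funpow[OF B(1), of n]
  have IH: "nrm ((A ^^ n) u - (B ^^ n) u) \<le> real n * (C * nrm (A u - B u))"
    using Suc by simp
  have "(A ^^ Suc n) u - (B ^^ Suc n) u = (A ^^ n) (A u - B u) + B ((A ^^ n) u - (B ^^ n) u)"
    using commuteD[OF commute_funpow[OF commute_sym[OF AB] A(1), of n] u] u A(1) B(1) An Bn
    by (simp add: lin_diff funpow_swap1)
  also have "nrm \<dots> \<le> nrm ((A ^^ n) (A u - B u)) + nrm (B ((A ^^ n) u - (B ^^ n) u))"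
    using u A(1) B(1) An Bn by (intro nrm_triangle) auto
  also have "\<dots> \<le> C * nrm (A u - B u) + nrm ((A ^^ n) u - (B ^^ n) u)"
    using u A(1) B An Bn Suc.prems[of n] by (intro add_mono bounded_byD contractionD) auto
  finally show ?case
    using IH by (simp add: algebra_simps)
qed simp

section \<open>The uniform boundedness principle\<close>

text \<open>
  Sokal's proof without Baire's theorem. Among \<open>x + y\<close> and \<open>x - y\<close> one has an image of norm at least
  that of the image of \<open>y\<close>. Adding in this way multiples of size \<open>3\<^sup>-\<^sup>k\<close> of almost norming vectors of operators
  with norms above \<open>4\<^sup>k\<close> gives a convergent sequence; the tail after step \<open>k\<close> has length at most \<open>3\<^sup>-\<^sup>k / 2\<close>,
  less than the share \<open>2/3\<close> secured at step \<open>k\<close>, so the images of the limit are unbounded.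
\<close>

theorem uniform_boundedness:
  assumes lin: "\<And>n::nat. lin (A n)" and bdd: "\<And>n. \<exists>C. bounded_by C (A n)"
    and pointwise: "\<And>u. u \<in> W \<Longrightarrow> \<exists>B. \<forall>n. nrm (A n u) \<le> B"
  shows "\<exists>C\<ge>0. \<forall>n. bounded_by C (A n)"
proof (rule ccontr)
  assume "\<not> (\<exists>C\<ge>0. \<forall>n. bounded_by C (A n))"
  then have unb: "\<exists>n. \<not> bounded_by C (A n)" if "0 \<le> C" for C
    using that by blast
  define N where "N n = Sup ((\<lambda>u. nrm (A n u)) ` {u \<in> W. nrm u \<le> 1})" for n
  have bddN: "bdd_above ((\<lambda>u. nrm (A n u)) ` {u \<in> W. nrm u \<le> 1})" for n
  proof -
    obtain C where C: "bounded_by C (A n)" using bdd by blast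
    have "nrm (A n u) \<le> \<bar>C\<bar>" if "u \<in> W" "nrm u \<le> 1" for u
    proof -
      have "nrm (A n u) \<le> C * nrm u" using bounded_byD[OF C that(1)] .
      also have "\<dots> \<le> \<bar>C\<bar> * 1" using that by (intro mult_mono) auto
      finally show ?thesis by simp
    qed
    then show ?thesis by (auto simp: bdd_above_def)
  qed
  have N_upper: "nrm (A n u) \<le> N n" if "u \<in> W" "nrm u \<le> 1" for n u
    unfolding N_def using that bddN by (intro cSup_upper) auto
  have N_nonneg: "0 \<le> N n" for n
    using N_upper[of 0 n] lin_zero[OF lin[of n]] by simp
  have N_bound: "bounded_by (N n) (A n)" for n
    unfolding bounded_by_def
  proof
    fix x assume x: "x \<in> W"
    show "nrm (A n x) \<le> N n * nrm x"
    proof (cases "x = 0")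
      case False
      then have pos: "0 < nrm x" using nrm_eq_0[OF x] nrm_nonneg[OF x] by linarith
      have "nrm (A n ((1 / nrm x) *\<^sub>R x)) \<le> N n"
        using x pos by (intro N_upper) (auto simp: nrm_scale)
      then show ?thesis
        using pos x lin[of n] by (simp add: lin_scale nrm_scale field_simps)
    qed (simp add: lin_zero[OF lin])
  qed
  have "\<exists>n. 4 ^ k < N n" for k
  proof -
    obtain n where n: "\<not> bounded_by (4 ^ k) (A n)" using unb[of "4 ^ k"] by auto
    have "4 ^ k < N n"
    proof (rule ccontr)
      assume "\<not> 4 ^ k < N n"
      then have "N n * nrm x \<le> 4 ^ k * nrm x" if "x \<in> W" for x
        using that by (intro mult_right_mono) auto
      then have "bounded_by (4 ^ k) (A n)"
        using N_bound[of n] unfolding bounded_by_def by (meson order_trans)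
      with n show False by blast
    qed
    then show ?thesis by blast
  qed
  then obtain n where n: "\<And>k. 4 ^ k < N (n k)" by metis
  have n_pos: "0 < N (n k)" for k using order_less_trans[OF _ n[of k], of 0] by simp
  have "\<exists>u\<in>W. nrm u \<le> 1 \<and> 2/3 * N (n k) < nrm (A (n k) u)" for k
  proof -
    have "2/3 * N (n k) < N (n k)" using n_pos[of k] by simp
    also have "N (n k) = Sup ((\<lambda>u. nrm (A (n k) u)) ` {u \<in> W. nrm u \<le> 1})"
      by (rule N_def)
    finally have less: "2/3 * N (n k) < Sup ((\<lambda>u. nrm (A (n k) u)) ` {u \<in> W. nrm u \<le> 1})" .
    have "0 \<in> {u \<in> W. nrm u \<le> 1}" by simp
    then have "(\<lambda>u. nrm (A (n k) u)) ` {u \<in> W. nrm u \<le> 1} \<noteq> {}"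
      by (metis empty_iff image_is_empty)
    from less_cSupD[OF this less] obtain z
      where z: "z \<in> (\<lambda>u. nrm (A (n k) u)) ` {u \<in> W. nrm u \<le> 1}" "2/3 * N (n k) < z" by metis
    from z(1) obtain u where "u \<in> {u \<in> W. nrm u \<le> 1}" "z = nrm (A (n k) u)" by (rule imageE)
    with z(2) show ?thesis by auto
  qed
  then obtain v where v: "\<And>k. v k \<in> W" "\<And>k. nrm (v k) \<le> 1"
      "\<And>k. 2/3 * N (n k) < nrm (A (n k) (v k))"
    by metis
  define y where "y k = (1/3) ^ k *\<^sub>R v k" for k
  have y: "y k \<in> W" "nrm (y k) \<le> (1/3) ^ k" for k
    using v(1,2)[of k] by (auto simp: y_def nrm_scale mult_left_le)
  have Ay: "(1/3) ^ k * (2/3 * N (n k)) \<le> nrm (A (n k) (y k))" for k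
    using v(3)[of k] v(1)[of k] lin[of "n k"] by (simp add: y_def lin_scale nrm_scale)
  define x where "x = rec_nat 0 (\<lambda>k z. if nrm (A (n k) (y k)) \<le> nrm (A (n k) (z + y k))
      then z + y k else z - y k)"
  have x_Suc: "x (Suc k) = (if nrm (A (n k) (y k)) \<le> nrm (A (n k) (x k + y k))
      then x k + y k else x k - y k)" for k
    by (simp add: x_def)
  have xW: "x k \<in> W" for k
    by (induction k) (use y in \<open>auto simp: x_Suc\<close>, simp add: x_def)
  have x_large: "nrm (A (n k) (y k)) \<le> nrm (A (n k) (x (Suc k)))" for k
  proof (cases "nrm (A (n k) (y k)) \<le> nrm (A (n k) (x k + y k))")
    case False
    let ?p = "A (n k) (x k + y k)" and ?q = "A (n k) (x k - y k)"
    note l = lin[of "n k"]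
    have "2 *\<^sub>R A (n k) (y k) = ?p - ?q"
      using l xW[of k] y(1)[of k] by (simp add: lin_add lin_diff scaleR_2)
    then have "2 * nrm (A (n k) (y k)) = nrm (?p - ?q)"
      using nrm_scale[of "A (n k) (y k)" 2] l y(1) by simp
    also have "\<dots> \<le> nrm ?p + nrm ?q"
      using l xW y(1) by (intro nrm_diff_le) auto
    finally show ?thesis using False by (simp add: x_Suc)
  qed (simp add: x_Suc)
  define d :: "nat \<Rightarrow> real" where "d k = 3/2 * (1/3) ^ k" for k
  have d: "d \<longlonglongrightarrow> 0"
    unfolding d_def by (auto intro!: tendsto_mult_right_zero LIMSEQ_power_zero)
  have step: "nrm (x k - x (Suc k)) \<le> d k - d (Suc k)" for k
    using y[of k] by (auto simp: x_Suc d_def nrm_minus)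
  obtain w where w: "w \<in> W" "\<And>k. nrm (x k - w) \<le> d k"
    using telescoping_conv[OF d xW step] by metis
  have low: "1/6 * (4/3) ^ k \<le> nrm (A (n k) w)" for k
  proof -
    note l = lin[of "n k"]
    have "nrm (A (n k) (x (Suc k)) - A (n k) w) \<le> N (n k) * nrm (x (Suc k) - w)"
      using bounded_byD[OF N_bound[of "n k"] W_diff[OF xW[of "Suc k"] w(1)]] lin_diff[OF l xW w(1)]
      by simp
    also have "\<dots> \<le> N (n k) * ((1/3) ^ k / 2)"
      using w(2)[of "Suc k"] N_nonneg by (intro mult_left_mono) (auto simp: d_def)
    finally have "nrm (A (n k) (x (Suc k)) - A (n k) w) \<le> N (n k) * ((1/3) ^ k / 2)" .
    moreover have "nrm (A (n k) (x (Suc k))) \<le> nrm (A (n k) (x (Suc k)) - A (n k) w) + nrm (A (n k) w)"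
      using nrm_triangle[of "A (n k) (x (Suc k)) - A (n k) w" "A (n k) w"] l xW w(1) by simp
    ultimately have "(1/3) ^ k * (2/3 * N (n k)) - N (n k) * ((1/3) ^ k / 2) \<le> nrm (A (n k) w)"
      using Ay[of k] x_large[of k] by linarith
    moreover have "(1/3) ^ k * 4 ^ k \<le> (1/3) ^ k * N (n k)"
      using n[of k] by (intro mult_left_mono) auto
    moreover have "(1/3 :: real) ^ k * 4 ^ k = (4/3) ^ k" by (simp flip: power_mult_distrib)
    moreover have "(1/3) ^ k * (2/3 * N (n k)) - N (n k) * ((1/3) ^ k / 2) = 1/6 * ((1/3) ^ k * N (n k))"
      by (simp add: algebra_simps)
    ultimately show ?thesis by linarith
  qed
  obtain B where B: "\<And>n. nrm (A n w) \<le> B" using pointwise[OF w(1)] by blast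
  obtain k where "6 * B < (4/3) ^ k"
    using real_arch_pow[of "4/3" "6 * B"] by auto
  then show False using low[of k] B[of "n k"] by simp
qed

end

section \<open>Nonnegative selfadjoint operators and their resolvents\<close>

text \<open>
  The operator is given by its graph. For symmetric nonnegative operators, surjectivity of \<open>1 + h L\<close> is
  equivalent to selfadjointness.
\<close>

locale selfadjoint_operator = hilbert_subspace W ip
  for W :: "'h::real_vector set" and ip :: "'h \<Rightarrow> 'h \<Rightarrow> real" +
  fixes L :: "'h \<Rightarrow> 'h \<Rightarrow> bool"
  assumes L_W: "L u f \<Longrightarrow> u \<in> W \<and> f \<in> W"
    and L_add: "\<lbrakk>L u f; L v g\<rbrakk> \<Longrightarrow> L (u + v) (f + g)"
    and L_scale: "L u f \<Longrightarrow> L (c *\<^sub>R u) (c *\<^sub>R f)"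
    and L_symmetric: "\<lbrakk>L u f; L v g\<rbrakk> \<Longrightarrow> ip f v = ip u g"
    and L_nonneg: "L u f \<Longrightarrow> 0 \<le> ip f u"
    and L_range: "\<lbrakk>0 < h; g \<in> W\<rbrakk> \<Longrightarrow> \<exists>u f. L u f \<and> u + h *\<^sub>R f = g"
    and L_dense: "\<lbrakk>u \<in> W; 0 < e\<rbrakk> \<Longrightarrow> \<exists>v f. L v f \<and> nrm (u - v) < e"
begin

lemma L_in [dest]: assumes "L u f" shows "u \<in> W" "f \<in> W"
  using L_W[OF assms] by auto

lemma L_diff: "\<lbrakk>L u f; L v g\<rbrakk> \<Longrightarrow> L (u - v) (f - g)"
  using L_add[of u f "-1 *\<^sub>R v" "-1 *\<^sub>R g"] L_scale[of v g "-1"] by simp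

lemma range_unique:
  assumes "L u f" "L v g" "0 < h" "u + h *\<^sub>R f = v + h *\<^sub>R g" shows "u = v"
proof -
  let ?w = "u - v" and ?k = "f - g"
  have k: "L ?w ?k" using assms L_diff by simp
  have "?w = - (h *\<^sub>R ?k)"
    using assms(4) by (simp add: scaleR_right_diff_distrib diff_eq_eq eq_diff_eq algebra_simps)
  then have "ip ?w ?w = ip (- (h *\<^sub>R ?k)) ?w" by simp
  also have "\<dots> = - (h * ip ?k ?w)"
    using L_in[OF k] by (simp only: ip_minus_left ip_scale_left W_scale)
  also have "\<dots> \<le> 0" using L_nonneg[OF k] assms(3) by simp
  finally have "ip ?w ?w = 0" using ip_nonneg[of ?w] L_in[OF k] by (intro antisym) auto
  then have "?w = 0" using ip_definite[of ?w] L_in[OF k] by blast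
  then show ?thesis by simp
qed

text \<open>
  The resolvent \<open>(1 + h L)\<^sup>-\<^sup>1\<close>, one implicit Euler step of length \<open>h\<close> for \<open>u' = - L u\<close>. In terms of
  \<open>K\<^sub>\<beta> = (L + \<beta>)\<^sup>-\<^sup>1\<close> it is \<open>\<beta> K\<^sub>\<beta>\<close> with \<open>\<beta> = 1/h\<close>.
\<close>

definition J :: "real \<Rightarrow> 'h \<Rightarrow> 'h" where
  "J h g = (THE u. \<exists>f. L u f \<and> u + h *\<^sub>R f = g)"

lemma J_eq: assumes "0 < h" "L u f" shows "J h (u + h *\<^sub>R f) = u"
  unfolding J_def using assms range_unique by (intro the_equality) blast+

lemma L_J:
  assumes "0 < h" "g \<in> W" shows "L (J h g) ((1/h) *\<^sub>R (g - J h g))"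
proof -
  obtain u f where uf: "L u f" "u + h *\<^sub>R f = g"
    using L_range[OF assms] by blast
  then have "J h g = u" "(1/h) *\<^sub>R (g - u) = f"
    using J_eq[OF assms(1) uf(1)] assms(1) by auto
  then show ?thesis using uf(1) by simp
qed

lemma J_W [simp, intro]: "0 < h \<Longrightarrow> g \<in> W \<Longrightarrow> J h g \<in> W"
  using L_J by blast

lemma J_decomp:
  assumes "0 < h" "g \<in> W" obtains u f where "L u f" "g = u + h *\<^sub>R f" "J h g = u"
  using L_J[OF assms] J_eq assms L_range by metis

lemma J_lin: assumes "0 < h" shows "lin (J h)"
  unfolding lin_def
proof (intro conjI ballI allI)
  fix x y c assume x: "x \<in> W" and y: "y \<in> W"
  obtain u f where u: "L u f" "x = u + h *\<^sub>R f" "J h x = u" using J_decomp[OF assms x] .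
  obtain v g where v: "L v g" "y = v + h *\<^sub>R g" "J h y = v" using J_decomp[OF assms y] .
  show "J h (x + y) = J h x + J h y"
    using J_eq[OF assms L_add[OF u(1) v(1)]] u v by (simp add: algebra_simps)
next
  fix x c assume x: "x \<in> W"
  obtain u f where u: "L u f" "x = u + h *\<^sub>R f" "J h x = u" using J_decomp[OF assms x] .
  show "J h (c *\<^sub>R x) = c *\<^sub>R J h x"
    using J_eq[OF assms L_scale[OF u(1), of c]] u by (simp add: algebra_simps)
qed (use assms in auto)

lemma J_contraction: assumes "0 < h" shows "bounded_by 1 (J h)"
  unfolding bounded_by_def
proof
  fix x assume x: "x \<in> W"
  obtain u f where u: "L u f" "x = u + h *\<^sub>R f" "J h x = u" using J_decomp[OF assms x] .
  have "ip x x = ip u u + 2 * (h * ip f u) + h\<^sup>2 * ip f f"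
    using L_in[OF u(1)] ip_commute[of u f] unfolding u(2)
    by (simp add: ip_linear power2_eq_square algebra_simps)
  moreover have "0 \<le> h * ip f u" "0 \<le> h\<^sup>2 * ip f f"
    using L_nonneg[OF u(1)] assms ip_nonneg[of f] L_in[OF u(1)] by auto
  ultimately have "ip u u \<le> ip x x" by linarith
  then show "nrm (J h x) \<le> 1 * nrm x"
    unfolding u(3) by (simp add: nrm_def)
qed

lemma J_symm: assumes "0 < h" shows "symm (J h)"
  unfolding symm_def
proof (intro ballI)
  fix x y assume x: "x \<in> W" and y: "y \<in> W"
  obtain u f where u: "L u f" "x = u + h *\<^sub>R f" "J h x = u" using J_decomp[OF assms x] .
  obtain v g where v: "L v g" "y = v + h *\<^sub>R g" "J h y = v" using J_decomp[OF assms y] .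
  show "ip (J h x) y = ip x (J h y)"
    unfolding u(3) v(3) unfolding u(2) v(2)
    using L_symmetric[OF u(1) v(1)] L_in[OF u(1)] L_in[OF v(1)] by (simp add: ip_linear)
qed

lemma commute_J:
  assumes "0 < h" "lin B" "\<And>u f. L u f \<Longrightarrow> L (B u) (B f)" shows "commute B (J h)"
  unfolding commute_def
proof
  fix x assume x: "x \<in> W"
  obtain u f where u: "L u f" "x = u + h *\<^sub>R f" "J h x = u" using J_decomp[OF assms(1) x] .
  show "B (J h x) = J h (B x)"
    using J_eq[OF assms(1) assms(3)[OF u(1)]] u L_in[OF u(1)] assms(2) by (simp add: lin_add lin_scale)
qed

lemma diff_J:
  assumes "0 < h" "L u f" shows "u - J h u = h *\<^sub>R J h f"
proof -
  note W = L_in[OF assms(2)]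
  have "u = J h (u + h *\<^sub>R f)" using J_eq[OF assms] by simp
  also have "\<dots> = J h u + h *\<^sub>R J h f"
    using W J_lin[OF assms(1)] by (simp add: lin_add lin_scale)
  finally show ?thesis by (simp add: algebra_simps)
qed

lemma nrm_diff_J:
  assumes "0 < h" "L u f" shows "nrm (u - J h u) \<le> h * nrm f"
  using assms contractionD[OF J_contraction[OF assms(1)], of f] L_in[OF assms(2)]
  by (simp add: diff_J nrm_scale)

lemma L_J_J:
  assumes "0 < h" "L u f" shows "L (J h u) (J h f)"
proof -
  have "(1/h) *\<^sub>R (u - J h u) = J h f"
    using assms by (simp add: diff_J)
  then show ?thesis
    using L_J[OF assms(1) L_in(1)[OF assms(2)]] by simp
qed

lemma J_commute: "0 < h \<Longrightarrow> 0 < k \<Longrightarrow> commute (J h) (J k)"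
  using commute_J[of k "J h"] J_lin[of h] L_J_J by blast

text \<open>
  Since \<open>(1 + h L)\<^sup>2 - (1 + 2 h L) = h\<^sup>2 L\<^sup>2\<close>, the difference of one long and two short steps is
  \<open>h\<^sup>2 (1 + 2 h L)\<^sup>-\<^sup>1 (1 + h L)\<^sup>-\<^sup>2 L\<^sup>2 u\<close>.
\<close>

lemma J_double:
  assumes h: "0 < h" and u: "L u f" "L f g"
  shows "nrm (J (2 * h) u - J h (J h u)) \<le> h\<^sup>2 * nrm g"
proof -
  note W = L_in[OF u(1)] L_in[OF u(2)]
  let ?JJ = "\<lambda>x. J h (J h x)"
  have lin2: "lin ?JJ" using lin_comp[OF J_lin[OF h] J_lin[OF h]] .
  have "?JJ u = J (2 * h) (?JJ u + (2 * h) *\<^sub>R ?JJ f)"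
    using J_eq[OF _ L_J_J[OF h L_J_J[OF h u(1)]], of "2 * h"] h by simp
  also have "\<dots> = J (2 * h) (?JJ (u + (2 * h) *\<^sub>R f))"
    using W lin2 h by (simp add: lin_add[OF lin2] lin_scale[OF lin2])
  finally have 1: "?JJ u = J (2 * h) (?JJ (u + (2 * h) *\<^sub>R f))" .
  have "L (u + h *\<^sub>R f) (f + h *\<^sub>R g)"
    using u L_add L_scale by blast
  from J_eq[OF h this] have "J h ((u + h *\<^sub>R f) + h *\<^sub>R (f + h *\<^sub>R g)) = u + h *\<^sub>R f" .
  then have "u = ?JJ ((u + h *\<^sub>R f) + h *\<^sub>R (f + h *\<^sub>R g))"
    using J_eq[OF h u(1)] by simp
  also have "(u + h *\<^sub>R f) + h *\<^sub>R (f + h *\<^sub>R g) = (u + (2 * h) *\<^sub>R f) + h\<^sup>2 *\<^sub>R g"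
    by (simp add: scaleR_add_right scaleR_2 power2_eq_square flip: scaleR_scaleR)
  finally have "J (2 * h) u = J (2 * h) (?JJ (u + (2 * h) *\<^sub>R f + h\<^sup>2 *\<^sub>R g))" by simp
  also have "\<dots> = J (2 * h) (?JJ (u + (2 * h) *\<^sub>R f)) + h\<^sup>2 *\<^sub>R J (2 * h) (?JJ g)"
    using W h lin_comp[OF J_lin[of "2 * h"] lin2]
    by (simp add: lin_add[of "\<lambda>x. J (2 * h) (?JJ x)"] lin_scale[of "\<lambda>x. J (2 * h) (?JJ x)"])
  finally have "J (2 * h) u - ?JJ u = h\<^sup>2 *\<^sub>R J (2 * h) (?JJ g)"
    using 1 by simp
  moreover have "nrm (J (2 * h) (?JJ g)) \<le> nrm g"
  proof -
    have "nrm (J (2 * h) (?JJ g)) \<le> nrm (?JJ g)"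
      using W h by (intro contractionD[OF J_contraction]) auto
    also have "\<dots> \<le> nrm (J h g)" using W h by (intro contractionD[OF J_contraction]) auto
    also have "\<dots> \<le> nrm g" using W h by (intro contractionD[OF J_contraction]) auto
    finally show ?thesis .
  qed
  ultimately show ?thesis
    using W h by (simp add: nrm_scale mult_left_mono)
qed

text \<open>
  The domain of \<open>L\<^sup>2\<close> is dense: an element \<open>w\<close> of the domain of \<open>L\<close> is the limit of \<open>J h w\<close> for small \<open>h\<close>.
\<close>

lemma dense_dom_square:
  assumes "u \<in> W" "0 < e" obtains v f g where "L v f" "L f g" "nrm (u - v) < e"
proof -
  obtain w k where w: "L w k" "nrm (u - w) < e/2"
    using L_dense[of u "e/2"] assms by auto
  note W = L_in[OF w(1)]
  define h where "h = e / (2 * (nrm k + 1))"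
  have h: "0 < h" "h * nrm k < e/2"
    using assms(2) nrm_nonneg[OF W(2)] by (auto simp: h_def field_simps)
  have "L (J h w) (J h k)" "L (J h k) ((1/h) *\<^sub>R (k - J h k))"
    using L_J_J[OF h(1) w(1)] L_J[OF h(1) W(2)] by auto
  moreover have "nrm (u - J h w) < e"
    using nrm_diff_triangle[of u w "J h w"] nrm_diff_J[OF h(1) w(1)] h w assms W by simp
  ultimately show thesis using that by blast
qed

lemma eq_on_dom:
  assumes A: "lin A" "bounded_by C A" and B: "lin B" "bounded_by C' B"
    and eq: "\<And>u f. L u f \<Longrightarrow> A u = B u" and u: "u \<in> W"
  shows "A u = B u"
proof (rule eq_if_close)
  fix e :: real assume "0 < e"
  define D where "D = \<bar>C\<bar> + \<bar>C'\<bar> + 1"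
  have D: "0 < D" by (simp add: D_def)
  then obtain v f where v: "L v f" "nrm (u - v) < e / D"
    using L_dense[OF u, of "e / D"] \<open>0 < e\<close> by auto
  note W = L_in[OF v(1)]
  have "A u - B u = A (u - v) - B (u - v)"
    using eq[OF v(1)] W u A B by (simp add: lin_diff)
  also have "nrm \<dots> \<le> nrm (A (u - v)) + nrm (B (u - v))"
    using W u A B by (intro nrm_diff_le) auto
  also have "\<dots> \<le> C * nrm (u - v) + C' * nrm (u - v)"
    using W u A B by (intro add_mono bounded_byD) auto
  also have "\<dots> \<le> D * nrm (u - v)"
    using W u nrm_nonneg[of "u - v"] unfolding D_def distrib_right[symmetric]
    by (intro mult_right_mono) auto
  also have "\<dots> \<le> e"
    using v(2) D by (simp add: field_simps)
  finally show "nrm (A u - B u) \<le> e" .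
qed (use u A B in auto)

section \<open>Euler approximations\<close>

definition R :: "nat \<Rightarrow> real \<Rightarrow> 'h \<Rightarrow> 'h" where
  "R n t = J ((1/2) ^ n) ^^ nat \<lfloor>2 ^ n * t\<rfloor>"

lemma R_lin: "lin (R n t)"
  and R_contraction: "bounded_by 1 (R n t)"
  and R_symm: "symm (R n t)"
  unfolding R_def
  using J_lin[of "(1/2)^n"] J_contraction[of "(1/2)^n"] J_symm[of "(1/2)^n"]
  by (auto intro: lin_funpow contraction_funpow symm_funpow)

lemma R_commute:
  assumes "\<And>h. 0 < h \<Longrightarrow> commute B (J h)" shows "commute B (R n t)"
  unfolding R_def using assms J_lin by (intro commute_funpow) auto

lemma R_zero [simp]: "R n 0 u = u" by (simp add: R_def)

lemma funpow_J_L: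
  assumes "0 < h" "L u f" shows "L ((J h ^^ k) u) ((J h ^^ k) f)"
  by (induction k) (use assms L_J_J in auto)

lemma nrm_diff_funpow_J:
  assumes h: "0 < h" and u: "L u f"
  shows "nrm (u - (J h ^^ k) u) \<le> real k * h * nrm f"
proof (induction k)
  case (Suc k)
  note W = L_in[OF u] L_in[OF funpow_J_L[OF h u, of k]]
  have "nrm (u - J h ((J h ^^ k) u)) \<le> nrm (u - J h u) + nrm (J h u - J h ((J h ^^ k) u))"
    using W h by (intro nrm_diff_triangle) auto
  also have "\<dots> \<le> h * nrm f + nrm (u - (J h ^^ k) u)"
    using contractionD[OF J_contraction[OF h], of "u - (J h ^^ k) u"] W h u
    by (intro add_mono nrm_diff_J) (auto simp: lin_diff[OF J_lin])
  finally show ?case using Suc by (simp add: algebra_simps)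
qed simp

lemma floor_bounds:
  assumes "0 \<le> t" shows "real (nat \<lfloor>2 ^ n * t\<rfloor>) * (1/2) ^ n \<le> t"
    and "t - (1/2)^n \<le> real (nat \<lfloor>2 ^ n * t\<rfloor>) * (1/2) ^ n"
proof -
  have "real (nat \<lfloor>2 ^ n * t\<rfloor>) \<le> 2 ^ n * t" "2 ^ n * t < real (nat \<lfloor>2 ^ n * t\<rfloor>) + 1"
    using assms by (auto simp: of_nat_nat)
  then show "real (nat \<lfloor>2 ^ n * t\<rfloor>) * (1/2) ^ n \<le> t"
    and "t - (1/2)^n \<le> real (nat \<lfloor>2 ^ n * t\<rfloor>) * (1/2) ^ n"
  proof -
    assume k: "real (nat \<lfloor>2 ^ n * t\<rfloor>) \<le> 2 ^ n * t" "2 ^ n * t < real (nat \<lfloor>2 ^ n * t\<rfloor>) + 1"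
    have "real (nat \<lfloor>2 ^ n * t\<rfloor>) / 2 ^ n \<le> (2 ^ n * t) / 2 ^ n"
      using k(1) by (intro divide_right_mono) auto
    then show "real (nat \<lfloor>2 ^ n * t\<rfloor>) * (1/2) ^ n \<le> t" by (simp add: power_one_over)
    have "(2 ^ n * t - 1) / 2 ^ n \<le> real (nat \<lfloor>2 ^ n * t\<rfloor>) / 2 ^ n"
      using k(2) by (intro divide_right_mono) auto
    then show "t - (1/2)^n \<le> real (nat \<lfloor>2 ^ n * t\<rfloor>) * (1/2) ^ n"
      by (simp add: power_one_over diff_divide_distrib)
  qed
qed

lemma nrm_diff_R:
  assumes "0 \<le> t" "L u f" shows "nrm (u - R n t u) \<le> t * nrm f"
proof -
  have "nrm (u - R n t u) \<le> real (nat \<lfloor>2 ^ n * t\<rfloor>) * (1/2) ^ n * nrm f"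
    unfolding R_def using assms by (intro nrm_diff_funpow_J) auto
  also have "\<dots> \<le> t * nrm f"
    using floor_bounds[OF assms(1)] L_in[OF assms(2)] by (intro mult_right_mono) auto
  finally show ?thesis .
qed

lemma funpow_close:
  assumes h: "0 < h" and u: "L u f" and "j = k \<or> j = Suc k"
  shows "nrm ((J h ^^ k) u - (J h ^^ j) u) \<le> h * nrm f"
  using assms(3)
proof
  assume "j = Suc k"
  note W = L_in[OF u] L_in[OF funpow_J_L[OF h u, of k]]
  have "nrm ((J h ^^ k) u - J h ((J h ^^ k) u)) \<le> h * nrm ((J h ^^ k) f)"
    using nrm_diff_J[OF h funpow_J_L[OF h u]] .
  also have "\<dots> \<le> h * nrm f"
    using contractionD[OF contraction_funpow[OF J_lin J_contraction]] W h by simp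
  finally show ?thesis using \<open>j = Suc k\<close> by simp
qed (use h L_in[OF u] in simp)

lemma floor_double:
  fixes x :: real assumes "0 \<le> x"
  shows "nat \<lfloor>2 * x\<rfloor> = 2 * nat \<lfloor>x\<rfloor> \<or> nat \<lfloor>2 * x\<rfloor> = Suc (2 * nat \<lfloor>x\<rfloor>)"
  using assms by linarith

lemma floor_sum:
  fixes x :: real assumes "0 \<le> x" "0 \<le> y"
  shows "nat \<lfloor>x + y\<rfloor> = nat \<lfloor>x\<rfloor> + nat \<lfloor>y\<rfloor> \<or> nat \<lfloor>x + y\<rfloor> = Suc (nat \<lfloor>x\<rfloor> + nat \<lfloor>y\<rfloor>)"
  using assms by linarith

text \<open>
  Passing from step \<open>2\<^sup>-\<^sup>n\<close> to half of it replaces each of the at most \<open>2\<^sup>n t\<close> long steps by two short ones, at a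
  cost of order \<open>4\<^sup>-\<^sup>n\<close> each, and adds at most one short step because of the rounding of \<open>t\<close>.
\<close>

lemma R_step:
  assumes t: "0 \<le> t" and u: "L u f" "L f g"
  shows "nrm (R n t u - R (Suc n) t u) \<le> (1/2) ^ n * (t * nrm g + nrm f)"
proof -
  define h :: real where "h = (1/2) ^ Suc n"
  define k where "k = nat \<lfloor>2 ^ n * t\<rfloor>"
  define j where "j = nat \<lfloor>2 ^ Suc n * t\<rfloor>"
  have h: "0 < h" "2 * h = (1/2) ^ n" by (auto simp: h_def)
  note W = L_in[OF u(1)] L_in[OF u(2)]
  have j: "j = 2 * k \<or> j = Suc (2 * k)"
    using floor_double[of "2 ^ n * t"] t by (simp add: j_def k_def mult.assoc)
  have JJ: "J h ^^ (2 * k) = (\<lambda>x. J h (J h x)) ^^ k"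
    using funpow_mult[where f = "J h" and m = 2 and n = k] by (simp add: numeral_2_eq_2 comp_def)
  have lin2: "lin (\<lambda>x. J h (J h x))" using lin_comp[OF J_lin J_lin] h by simp
  have con2: "bounded_by 1 (\<lambda>x. J h (J h x))"
    using contraction_funpow[OF J_lin[OF h(1)] J_contraction[OF h(1)], of 2]
    by (simp add: numeral_2_eq_2 comp_def)
  have "commute (J (2 * h)) (J h ^^ 2)"
    using h by (intro commute_funpow J_commute J_lin) auto
  then have com2: "commute (J (2 * h)) (\<lambda>x. J h (J h x))"
    by (simp add: numeral_2_eq_2 comp_def)
  have "nrm ((J (2 * h) ^^ k) u - ((\<lambda>x. J h (J h x)) ^^ k) u)
      \<le> real k * (1 * nrm (J (2 * h) u - J h (J h u)))"
    using h W lin2 con2 com2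
    by (intro power_diff_bound) (auto intro!: J_lin contraction_funpow J_contraction)
  also have "\<dots> \<le> real k * (h\<^sup>2 * nrm g)"
    using J_double[OF h(1) u] by (simp add: mult_left_mono)
  also have "\<dots> = (real k * (1/2)^n) * (h / 2) * nrm g"
    using h(2) by (simp add: power2_eq_square)
  also have "\<dots> \<le> t * (1/2) ^ n * nrm g"
    using floor_bounds(1)[OF t, of n] h W t unfolding k_def
    by (intro mult_right_mono mult_mono) auto
  finally have 1: "nrm (R n t u - (J h ^^ (2 * k)) u) \<le> t * (1/2) ^ n * nrm g"
    unfolding JJ by (simp add: R_def h(2) k_def)
  have "nrm ((J h ^^ (2 * k)) u - (J h ^^ j) u) \<le> h * nrm f"
    using funpow_close[OF h(1) u(1) j] .
  also have "\<dots> \<le> (1/2) ^ n * nrm f"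
    using h W by (intro mult_right_mono) auto
  finally have 2: "nrm ((J h ^^ (2 * k)) u - R (Suc n) t u) \<le> (1/2) ^ n * nrm f"
    unfolding R_def h_def j_def .
  have "nrm (R n t u - R (Suc n) t u)
      \<le> nrm (R n t u - (J h ^^ (2 * k)) u) + nrm ((J h ^^ (2 * k)) u - R (Suc n) t u)"
    using W lin_funpow[OF J_lin[OF h(1)]] R_lin by (intro nrm_diff_triangle) auto
  then show ?thesis using 1 2 by (simp add: algebra_simps)
qed

lemma R_converges:
  assumes t: "0 \<le> t" and u: "u \<in> W"
  obtains w where "w \<in> W" "conv (\<lambda>n. R n t u) w"
proof (rule Cauchy_conv[of "\<lambda>n. R n t u"])
  show "R n t u \<in> W" for n using R_lin u by auto
  fix e :: real assume e: "0 < e"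
  obtain v f g where v: "L v f" "L f g" "nrm (u - v) < e / 4"
    using dense_dom_square[OF u, of "e/4"] e by auto
  note W = L_in[OF v(1)] L_in[OF v(2)] u
  define C where "C = t * nrm g + nrm f"
  define d :: "nat \<Rightarrow> real" where "d n = 2 * (1/2) ^ n * C" for n
  have d: "d \<longlonglongrightarrow> 0"
    unfolding d_def by (auto intro!: tendsto_mult_left_zero tendsto_mult_right_zero LIMSEQ_power_zero)
  obtain w where w: "w \<in> W" "conv (\<lambda>n. R n t v) w" "\<And>n. nrm (R n t v - w) \<le> d n"
    using telescoping_conv[OF d, of "\<lambda>n. R n t v"] R_step[OF t v(1,2)] R_lin W
    by (auto simp: d_def C_def)
  obtain N where N: "\<And>n. N \<le> n \<Longrightarrow> nrm (R n t v - w) < e / 4"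
    using w(2) e unfolding conv_def LIMSEQ_def
    by (metis R_lin W(1) W_diff abs_of_nonneg diff_zero dist_real_def lin_W nrm_nonneg w(1) zero_less_divide_iff zero_less_numeral)
  have Ruv: "nrm (R n t u - R n t v) < e / 4" for n
    using contractionD[OF R_contraction, of "u - v" n t] v(3) W by (simp add: lin_diff[OF R_lin])
  have "nrm (R m t u - R n t u) < e" if "N \<le> m" "N \<le> n" for m n
  proof -
    have RW [simp]: "R i t u \<in> W" "R i t v \<in> W" for i using R_lin W by auto
    have "nrm (R m t u - R n t u) \<le> nrm (R m t u - R m t v) + nrm (R m t v - w)
        + nrm (w - R n t v) + nrm (R n t v - R n t u)"
      using nrm_diff_triangle[of "R m t u" "R m t v" "R n t u"] w(1)
        nrm_diff_triangle[of "R m t v" w "R n t u"]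
        nrm_diff_triangle[of w "R n t v" "R n t u"] by simp
    then show ?thesis
      using Ruv[of m] Ruv[of n] N[OF that(1)] N[OF that(2)] w(1)
        nrm_diff_commute[of "R n t v" "R n t u"] nrm_diff_commute[of w "R n t v"] by simp
  qed
  then show "\<exists>N. \<forall>m\<ge>N. \<forall>n\<ge>N. nrm (R m t u - R n t u) < e" by blast
qed (use that in auto)

end

section \<open>Strongly continuous semigroups and their generators\<close>

lemma at_right_0_iff:
  fixes g :: "real \<Rightarrow> real" assumes "\<And>t. 0 < t \<Longrightarrow> 0 \<le> g t"
  shows "(g \<longlongrightarrow> 0) (at_right 0) \<longleftrightarrow> (\<forall>e>0. \<exists>d>0. \<forall>t. 0 < t \<and> t < d \<longrightarrow> g t < e)"
  unfolding tendsto_iff eventually_at_right_field dist_real_def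
  using assms by (metis abs_of_nonneg diff_zero)

context hilbert_subspace begin

definition C0 :: "(real \<Rightarrow> 'h \<Rightarrow> 'h) \<Rightarrow> bool" where
  "C0 T \<longleftrightarrow> (\<forall>t\<ge>0. lin (T t) \<and> (\<exists>C. bounded_by C (T t))) \<and> (\<forall>u\<in>W. T 0 u = u) \<and>
     (\<forall>s\<ge>0. \<forall>t\<ge>0. \<forall>u\<in>W. T (s + t) u = T s (T t u)) \<and>
     (\<forall>u\<in>W. ((\<lambda>t. nrm (T t u - u)) \<longlongrightarrow> 0) (at_right 0))"

definition gen :: "(real \<Rightarrow> 'h \<Rightarrow> 'h) \<Rightarrow> 'h \<Rightarrow> 'h \<Rightarrow> bool" where
  "gen T u f \<longleftrightarrow> u \<in> W \<and> f \<in> W \<and>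
     ((\<lambda>t. nrm ((1/t) *\<^sub>R (T t u - u) - f)) \<longlongrightarrow> 0) (at_right 0)"

lemma C0_lin: "C0 T \<Longrightarrow> 0 \<le> t \<Longrightarrow> lin (T t)"
  and C0_bounded: "C0 T \<Longrightarrow> 0 \<le> t \<Longrightarrow> \<exists>C. bounded_by C (T t)"
  and C0_zero: "C0 T \<Longrightarrow> u \<in> W \<Longrightarrow> T 0 u = u"
  and C0_plus: "C0 T \<Longrightarrow> 0 \<le> s \<Longrightarrow> 0 \<le> t \<Longrightarrow> u \<in> W \<Longrightarrow> T (s + t) u = T s (T t u)"
  by (auto simp: C0_def)

lemma C0_small:
  assumes "C0 T" "u \<in> W" "0 < e"
  obtains d where "0 < d" "\<And>t. 0 \<le> t \<Longrightarrow> t < d \<Longrightarrow> nrm (T t u - u) < e"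
proof -
  have "((\<lambda>t. nrm (T t u - u)) \<longlongrightarrow> 0) (at_right 0)"
    using assms by (simp add: C0_def)
  then obtain d where "0 < d" "\<forall>t. 0 < t \<and> t < d \<longrightarrow> nrm (T t u - u) < e"
    using at_right_0_iff[of "\<lambda>t. nrm (T t u - u)"] assms C0_lin[OF assms(1)]
    by (auto simp: less_imp_le)
  moreover have "nrm (T 0 u - u) < e"
    using C0_zero[OF assms(1,2)] assms(3) by simp
  ultimately show thesis
    using that[of d] by (metis le_less)
qed

lemma gen_iff:
  assumes "C0 T"
  shows "gen T u f \<longleftrightarrow> u \<in> W \<and> f \<in> W \<and>
    (\<forall>e>0. \<exists>d>0. \<forall>t. 0 < t \<and> t < d \<longrightarrow> nrm ((1/t) *\<^sub>R (T t u - u) - f) < e)"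
proof (cases "u \<in> W \<and> f \<in> W")
  case True
  then show ?thesis
    unfolding gen_def using C0_lin[OF assms]
    by (subst at_right_0_iff) (auto simp: less_imp_le)
qed (auto simp: gen_def)

lemma genD:
  assumes "C0 T" "gen T u f" "0 < e"
  obtains d where "0 < d" "\<And>t. 0 < t \<Longrightarrow> t < d \<Longrightarrow> nrm ((1/t) *\<^sub>R (T t u - u) - f) < e"
  using assms gen_iff[OF assms(1), of u f] by blast

lemma gen_W: "gen T u f \<Longrightarrow> u \<in> W" "gen T u f \<Longrightarrow> f \<in> W"
  by (auto simp: gen_def)

lemma C0_funpow:
  assumes T: "C0 T" and t: "0 \<le> t" and u: "u \<in> W" shows "T (real k * t) u = (T t ^^ k) u"
proof (induction k)
  case (Suc k)
  have "T (real (Suc k) * t) u = T (t + real k * t) u" by (simp add: algebra_simps)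
  also have "\<dots> = T t (T (real k * t) u)" using C0_plus[OF T t _ u] t by simp
  finally show ?case using Suc by simp
qed (use C0_zero[OF T u] in simp)

text \<open>
  Bounded operators that commute with a semigroup map the graph of its generator into itself.
\<close>

lemma gen_commute:
  assumes T: "C0 T" and B: "lin B" "bounded_by C B" and com: "\<And>t. 0 < t \<Longrightarrow> commute B (T t)"
    and g: "gen T u f"
  shows "gen T (B u) (B f)"
  unfolding gen_iff[OF T]
proof (intro conjI allI impI)
  note W = gen_W[OF g]
  fix e :: real assume e: "0 < e"
  define D where "D = \<bar>C\<bar> + 1"
  have D: "0 < D" "C \<le> D" by (auto simp: D_def)
  obtain d where d: "0 < d" "\<And>t. 0 < t \<Longrightarrow> t < d \<Longrightarrow> nrm ((1/t) *\<^sub>R (T t u - u) - f) < e / D"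
    using genD[OF T g, of "e / D"] e D by auto
  have "nrm ((1/t) *\<^sub>R (T t (B u) - B u) - B f) < e" if t: "0 < t" "t < d" for t
  proof -
    have TW: "T t u \<in> W" using C0_lin[OF T, of t] t W by auto
    have "(1/t) *\<^sub>R (T t (B u) - B u) - B f = B ((1/t) *\<^sub>R (T t u - u) - f)"
      using commuteD[OF com[OF t(1)] W(1)] B(1) W TW by (simp add: lin_diff lin_scale)
    also have "nrm \<dots> \<le> C * nrm ((1/t) *\<^sub>R (T t u - u) - f)"
      using W TW by (intro bounded_byD[OF B(2)]) auto
    also have "\<dots> \<le> D * nrm ((1/t) *\<^sub>R (T t u - u) - f)"
      using W TW D by (intro mult_right_mono) auto
    also have "\<dots> < e"
      using d(2)[OF t] D by (simp add: field_simps)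
    finally show ?thesis .
  qed
  then show "\<exists>d>0. \<forall>t. 0 < t \<and> t < d \<longrightarrow> nrm ((1/t) *\<^sub>R (T t (B u) - B u) - B f) < e"
    using d(1) by blast
qed (use gen_W[OF g] B in auto)

lemma gen_diff:
  assumes T: "C0 T" and g: "gen T u f" "gen T v g"
  shows "gen T (u - v) (f - g)"
  unfolding gen_iff[OF T]
proof (intro conjI allI impI)
  note W = gen_W[OF g(1)] gen_W[OF g(2)]
  fix e :: real assume e: "0 < e"
  obtain d where d: "0 < d" "\<And>t. 0 < t \<Longrightarrow> t < d \<Longrightarrow> nrm ((1/t) *\<^sub>R (T t u - u) - f) < e / 2"
    using genD[OF T g(1), of "e / 2"] e by auto
  obtain d' where d': "0 < d'" "\<And>t. 0 < t \<Longrightarrow> t < d' \<Longrightarrow> nrm ((1/t) *\<^sub>R (T t v - v) - g) < e / 2"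
    using genD[OF T g(2), of "e / 2"] e by auto
  have "nrm ((1/t) *\<^sub>R (T t (u - v) - (u - v)) - (f - g)) < e" if t: "0 < t" "t < min d d'" for t
  proof -
    have l: "lin (T t)" using C0_lin[OF T, of t] t by auto
    have "(1/t) *\<^sub>R (T t (u - v) - (u - v)) - (f - g)
        = ((1/t) *\<^sub>R (T t u - u) - f) - ((1/t) *\<^sub>R (T t v - v) - g)"
      using W by (simp add: lin_diff[OF l] algebra_simps)
    also have "nrm \<dots> \<le> nrm ((1/t) *\<^sub>R (T t u - u) - f) + nrm ((1/t) *\<^sub>R (T t v - v) - g)"
      using W l by (intro nrm_diff_le) auto
    finally show ?thesis using d(2)[of t] d'(2)[of t] t by simp
  qed
  then show "\<exists>d>0. \<forall>t. 0 < t \<and> t < d \<longrightarrow> nrm ((1/t) *\<^sub>R (T t (u - v) - (u - v)) - (f - g)) < e"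
    using d(1) d'(1) by (intro exI[of _ "min d d'"]) auto
qed (use gen_W[OF g(1)] gen_W[OF g(2)] in auto)

lemma gen_dissipative:
  assumes T: "C0 T" and con: "\<And>t. 0 \<le> t \<Longrightarrow> bounded_by 1 (T t)" and g: "gen T u f"
  shows "ip f u \<le> 0"
proof (rule field_le_epsilon[of _ 0, simplified])
  note W = gen_W[OF g]
  fix e :: real assume e: "0 < e"
  obtain d where d: "0 < d" "\<And>t. 0 < t \<Longrightarrow> t < d \<Longrightarrow> nrm ((1/t) *\<^sub>R (T t u - u) - f) < e / (nrm u + 1)"
    using genD[OF T g, of "e / (nrm u + 1)"] e nrm_nonneg[OF W(1)] by auto
  define t where "t = d / 2"
  have t: "0 < t" "t < d" using d by (auto simp: t_def)
  have TW: "T t u \<in> W" using C0_lin[OF T, of t] t W by auto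
  define q where "q = (1/t) *\<^sub>R (T t u - u)"
  have q: "q \<in> W" using W TW by (auto simp: q_def)
  have "ip (T t u) u \<le> nrm (T t u) * nrm u" using Cauchy_Schwarz[OF TW W(1)] by simp
  also have "\<dots> \<le> nrm u * nrm u"
    using contractionD[OF con W(1), of t] t W by (intro mult_right_mono) auto
  also have "\<dots> = ip u u" using nrm_sq[OF W(1)] by (simp add: power2_eq_square)
  finally have "ip q u \<le> 0"
    using t W TW by (simp add: q_def ip_linear divide_le_0_iff)
  moreover have "ip f u - ip q u = - ip (q - f) u" using W q by (simp add: ip_linear)
  moreover have "- ip (q - f) u \<le> nrm (q - f) * nrm u"
    using Cauchy_Schwarz[of "q - f" u] W q by auto
  moreover have "nrm (q - f) * nrm u \<le> e / (nrm u + 1) * nrm u"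
    using d(2)[OF t] W by (intro mult_right_mono) (auto simp: q_def)
  moreover have "e / (nrm u + 1) * nrm u \<le> e"
    using e nrm_nonneg[OF W(1)] by (simp add: field_simps)
  ultimately show "ip f u \<le> e" by linarith
qed

text \<open>
  Otherwise there are times tending to \<open>0\<close> with operators of unbounded norm, although strong continuity
  bounds them on each vector.
\<close>

lemma C0_locally_bounded:
  assumes T: "C0 T"
  obtains \<delta> C where "0 < \<delta>" "0 \<le> C" "\<And>t. 0 \<le> t \<Longrightarrow> t \<le> \<delta> \<Longrightarrow> bounded_by C (T t)"
proof -
  have "\<exists>\<delta>>0. \<exists>C\<ge>0. \<forall>t. 0 \<le> t \<and> t \<le> \<delta> \<longrightarrow> bounded_by C (T t)"
  proof (rule ccontr)
    assume neg: "\<not> ?thesis"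
    have "\<exists>t\<ge>0. t \<le> 1 / real (Suc n) \<and> \<not> bounded_by (real n) (T t)" for n
    proof (rule ccontr)
      assume "\<not> ?thesis"
      then have "\<forall>t. 0 \<le> t \<and> t \<le> 1 / real (Suc n) \<longrightarrow> bounded_by (real n) (T t)" by blast
      moreover have "0 < 1 / real (Suc n)" "0 \<le> real n" by auto
      ultimately show False using neg by blast
    qed
    then obtain s where s: "\<And>n. 0 \<le> s n" "\<And>n. s n \<le> 1 / real (Suc n)"
        "\<And>n. \<not> bounded_by (real n) (T (s n))"
      by metis
    have "\<exists>B. \<forall>n. nrm (T (s n) u) \<le> B" if u: "u \<in> W" for u
    proof -
      have TW: "T (s n) u \<in> W" for n using C0_lin[OF T s(1)] u by auto
      obtain d where d: "0 < d" "\<And>t. 0 \<le> t \<Longrightarrow> t < d \<Longrightarrow> nrm (T t u - u) < 1"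
        using C0_small[OF T u, of 1] by auto
      obtain N where N: "inverse (real (Suc N)) < d" using reals_Archimedean[OF d(1)] by blast
      have large: "nrm (T (s n) u) \<le> nrm u + 1" if "N \<le> n" for n
      proof -
        have "s n < d"
          using s(2)[of n] N that by (smt (verit) inverse_eq_divide frac_le of_nat_le_iff of_nat_0_less_iff Suc_le_mono zero_less_Suc)
        then have "nrm (T (s n) u - u) < 1" using d(2) s(1) by blast
        then show ?thesis
          using nrm_triangle[of "T (s n) u - u" u] TW u by simp
      qed
      define B where "B = (\<Sum>n<N. nrm (T (s n) u)) + nrm u + 1"
      have "nrm (T (s n) u) \<le> B" for n
      proof (cases "N \<le> n")
        case True
        then show ?thesis
          using large[OF True] sum_nonneg[of "{..<N}" "\<lambda>n. nrm (T (s n) u)"] TW by (simp add: B_def)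
      next
        case False
        then have "nrm (T (s n) u) \<le> (\<Sum>n<N. nrm (T (s n) u))"
          using TW by (intro member_le_sum) auto
        then show ?thesis using nrm_nonneg[OF u] by (simp add: B_def)
      qed
      then show ?thesis by blast
    qed
    then obtain C where C: "0 \<le> C" "\<And>n. bounded_by C (T (s n))"
      using uniform_boundedness[of "\<lambda>n. T (s n)"] C0_lin[OF T s(1)] C0_bounded[OF T s(1)] by blast
    obtain n where n: "C \<le> real n" using real_arch_simple by blast
    have "bounded_by (real n) (T (s n))"
      unfolding bounded_by_def
      by (meson C(2) bounded_by_def mult_right_mono n nrm_nonneg order_trans)
    then show False using s(3) by blast
  qed
  then show thesis using that by blast
qed

section \<open>Commutation with a positive square root\<close>

text \<open>
  For \<open>0 \<le> B \<le> 1\<close> the recursion \<open>A\<^sub>0 = B\<close>, \<open>A\<^bsub>n+1\<^esub> = A\<^sub>n - A\<^sub>n\<^sup>2\<close> writes \<open>B\<close> as the strongly convergent sum of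
  the squares \<open>A\<^sub>n\<^sup>2\<close> of symmetric operators that commute with everything that commutes with \<open>B\<close>. This replaces the
  square root of \<open>B\<close> in the usual argument for positivity of products.
\<close>

primrec sq_defect :: "('h \<Rightarrow> 'h) \<Rightarrow> nat \<Rightarrow> 'h \<Rightarrow> 'h" where
  "sq_defect B 0 = B"
| "sq_defect B (Suc n) = (\<lambda>x. sq_defect B n x - sq_defect B n (sq_defect B n x))"

context
  fixes B :: "'h \<Rightarrow> 'h"
  assumes B: "lin B" "symm B" "\<And>x. x \<in> W \<Longrightarrow> 0 \<le> ip (B x) x" "\<And>x. x \<in> W \<Longrightarrow> ip (B x) x \<le> ip x x"
begin

lemma sq_defect_lin: "lin (sq_defect B n)"
proof (induction n)
  case (Suc n)
  then show ?case
    unfolding lin_def[of "sq_defect B (Suc n)"]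
    by (simp add: lin_add lin_scale algebra_simps)
qed (simp add: B)

lemma sq_defect_symm: "symm (sq_defect B n)"
proof (induction n)
  case (Suc n)
  then show ?case
    using lin_W[OF sq_defect_lin[of n]] unfolding symm_def by (simp add: ip_linear)
qed (simp add: B)

text \<open>
  Nonnegativity of \<open>A - A\<^sup>2\<close> for \<open>0 \<le> A \<le> 1\<close> follows from
  \<open>A - A\<^sup>2 = (1 - A) A (1 - A) + A (1 - A) A\<close>.
\<close>

lemma sq_defect_bounds:
  "x \<in> W \<Longrightarrow> 0 \<le> ip (sq_defect B n x) x \<and> ip (sq_defect B n x) x \<le> ip x x"
proof (induction n arbitrary: x)
  case (Suc n)
  let ?A = "sq_defect B n"
  note l = sq_defect_lin[of n] and x = Suc.prems
  have W: "?A x \<in> W" "?A (?A x) \<in> W" using l x by auto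
  have sym: "ip (?A (?A x)) y = ip (?A x) (?A y)" if "y \<in> W" for y
    using sq_defect_symm[of n] W that by (simp add: symm_def)
  have 1: "0 \<le> ip (?A (x - ?A x)) (x - ?A x)" "ip (?A (?A x)) (?A x) \<le> ip (?A x) (?A x)"
    using Suc.IH W x by auto
  have "ip (?A (x - ?A x)) (x - ?A x) = ip (?A x) x - 2 * ip (?A x) (?A x) + ip (?A (?A x)) (?A x)"
    using sym[OF x] W x by (simp add: lin_diff[OF l] ip_linear)
  then have "0 \<le> ip (?A x) x - ip (?A x) (?A x)" using 1 by linarith
  moreover have "0 \<le> ip (?A x) (?A x)" using ip_nonneg W by blast
  ultimately show ?case
    using Suc.IH[OF x] W x sym[OF x] by (simp add: ip_linear)
qed (use B in auto)

lemma sq_defect_ip_sum: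
  assumes x: "x \<in> W"
  shows "ip (B x) x = (\<Sum>k<n. (nrm (sq_defect B k x))\<^sup>2) + ip (sq_defect B n x) x"
proof (induction n)
  case (Suc n)
  have W: "sq_defect B n x \<in> W" using sq_defect_lin x by auto
  then show ?case
    using Suc sq_defect_symm[of n] x sq_defect_lin[of n] by (simp add: ip_linear symm_def nrm_sq)
qed simp

lemma sq_defect_tendsto_0:
  assumes x: "x \<in> W" shows "(\<lambda>n. nrm (sq_defect B n x)) \<longlonglongrightarrow> 0"
proof -
  have "(\<Sum>k<n. (nrm (sq_defect B k x))\<^sup>2) \<le> ip (B x) x" for n
    using sq_defect_ip_sum[OF x, of n] sq_defect_bounds[OF x, of n] by simp
  then have "summable (\<lambda>n. (nrm (sq_defect B n x))\<^sup>2)"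
    by (intro summableI_nonneg_bounded[of _ "ip (B x) x"]) auto
  then have "(\<lambda>n. (nrm (sq_defect B n x))\<^sup>2) \<longlonglongrightarrow> 0" by (rule summable_LIMSEQ_zero)
  then show ?thesis by simp
qed

lemma nrm_sq_le_ip:
  assumes x: "x \<in> W" shows "(nrm (B x))\<^sup>2 \<le> ip (B x) x"
  using sq_defect_ip_sum[OF x, of 1] sq_defect_bounds[OF x, of 1] by simp

lemma sq_defect_commute:
  assumes Q: "lin Q" "commute Q B" shows "commute Q (sq_defect B n)"
proof (induction n)
  case (Suc n)
  show ?case unfolding commute_def
  proof
    fix x assume x: "x \<in> W"
    then have W: "sq_defect B n x \<in> W" "sq_defect B n (sq_defect B n x) \<in> W"
      using sq_defect_lin[of n] by auto
    show "Q (sq_defect B (Suc n) x) = sq_defect B (Suc n) (Q x)"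
      using commuteD[OF Suc x] commuteD[OF Suc W(1)] W Q by (simp add: lin_diff)
  qed
qed (use Q in simp)

text \<open>
  The product of commuting nonnegative operators is nonnegative, because \<open>Q B\<close> is the limit of sums of \<open>A\<^sub>k Q A\<^sub>k\<close>.
\<close>

lemma product_nonneg:
  assumes Q: "lin Q" "bounded_by C Q" "commute Q B" "\<And>x. x \<in> W \<Longrightarrow> 0 \<le> ip (Q x) x" and x: "x \<in> W"
  shows "0 \<le> ip (Q (B x)) x"
proof -
  let ?A = "sq_defect B"
  have W: "?A n x \<in> W" "?A n (?A n x) \<in> W" for n using sq_defect_lin[of n] x by auto
  have split: "ip (Q (B x)) x = (\<Sum>k<n. ip (Q (?A k x)) (?A k x)) + ip (Q (?A n x)) x" for n
  proof (induction n)
    case (Suc n)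
    have "ip (Q (?A n (?A n x))) x = ip (Q (?A n x)) (?A n x)"
      using commuteD[OF sq_defect_commute[OF Q(1,3)] W(1), of n n] sq_defect_symm[of n] W[of n] Q(1) x
      by (simp add: symm_def)
    then show ?case using Suc W Q(1) x by (simp add: lin_diff ip_linear)
  qed simp
  have lower: "- (C * nrm (?A n x) * nrm x) \<le> ip (Q (B x)) x" for n
  proof -
    have "\<bar>ip (Q (?A n x)) x\<bar> \<le> nrm (Q (?A n x)) * nrm x"
      using W Q(1) x by (intro Cauchy_Schwarz) auto
    also have "\<dots> \<le> C * nrm (?A n x) * nrm x"
      using W x by (intro mult_right_mono bounded_byD[OF Q(2)]) auto
    finally have "\<bar>ip (Q (?A n x)) x\<bar> \<le> C * nrm (?A n x) * nrm x" .
    moreover have "0 \<le> (\<Sum>k<n. ip (Q (?A k x)) (?A k x))"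
      using Q(4) W by (intro sum_nonneg) auto
    ultimately show ?thesis using split[of n] by linarith
  qed
  have "(\<lambda>n. - (C * nrm (?A n x) * nrm x)) \<longlonglongrightarrow> - (C * 0 * nrm x)"
    by (intro tendsto_intros sq_defect_tendsto_0 x)
  then have "- (C * 0 * nrm x) \<le> ip (Q (B x)) x"
    by (rule LIMSEQ_le_const2) (use lower in blast)
  then show ?thesis by simp
qed

text \<open>
  The commutator \<open>D = P B - B P\<close> is antisymmetric and anticommutes with \<open>B\<close> because \<open>P\<close> commutes with \<open>B\<^sup>2\<close>.
  Hence \<open>-D\<^sup>2\<close> is nonnegative and commutes with \<open>B\<close>, so the form of \<open>-D\<^sup>2 B\<close> is nonnegative. That form is
  also equal to minus the form of \<open>B\<close> at \<open>D x\<close>, so \<open>B D = 0\<close>. Then \<open>D B = 0\<close>, \<open>D\<^sup>3 = 0\<close>, and an antisymmetric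
  nilpotent operator vanishes.
\<close>

theorem commute_sqrt:
  assumes P: "lin P" "bounded_by C P" "symm P" and com: "commute P (\<lambda>x. B (B x))"
  shows "commute P B"
proof -
  define D where "D x = P (B x) - B (P x)" for x
  have D: "lin D"
    unfolding lin_def D_def using B(1) P(1) by (auto simp: lin_add lin_scale algebra_simps)
  have BD: "B (D x) = - D (B x)" if "x \<in> W" for x
    using commuteD[OF com that] that B(1) P(1) by (simp add: D_def lin_diff)
  have anti: "ip (D x) y = - ip x (D y)" if "x \<in> W" "y \<in> W" for x y
    using that B P by (simp add: D_def ip_linear symm_def)
  have Bcon: "bounded_by 1 B"
    unfolding bounded_by_def
  proof
    fix x assume x: "x \<in> W"
    have "(nrm (B x))\<^sup>2 \<le> (nrm x)\<^sup>2"
      using nrm_sq_le_ip[OF x] B(4)[OF x] nrm_sq[OF x] by simp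
    then show "nrm (B x) \<le> 1 * nrm x" using power2_le_imp_le nrm_nonneg[OF x] by fastforce
  qed
  define K where "K = \<bar>C\<bar> + \<bar>C\<bar>"
  have Dbdd: "bounded_by K D"
    unfolding bounded_by_def
  proof
    fix x assume x: "x \<in> W"
    have 1: "nrm (P y) \<le> \<bar>C\<bar> * nrm y" if "y \<in> W" for y
      using bounded_byD[OF P(2) that] mult_right_mono[OF abs_ge_self[of C] nrm_nonneg[OF that]]
      by linarith
    have "nrm (D x) \<le> nrm (P (B x)) + nrm (B (P x))"
      unfolding D_def using x B P by (intro nrm_diff_le) auto
    also have "nrm (P (B x)) \<le> \<bar>C\<bar> * nrm x"
      using 1[of "B x"] contractionD[OF Bcon x] x B(1) mult_left_mono[of "nrm (B x)" "nrm x" "\<bar>C\<bar>"] by auto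
    also have "nrm (B (P x)) \<le> \<bar>C\<bar> * nrm x"
      using 1[OF x] contractionD[OF Bcon, of "P x"] x P(1) by auto
    finally show "nrm (D x) \<le> K * nrm x" by (simp add: K_def algebra_simps)
  qed
  define Q where "Q x = - D (D x)" for x
  have Q: "lin Q"
    unfolding lin_def Q_def using D by (auto simp: lin_add lin_scale)
  have Qbdd: "bounded_by (K * K) Q"
    unfolding bounded_by_def
  proof
    fix x assume x: "x \<in> W"
    have "nrm (Q x) = nrm (D (D x))" using D x by (simp add: Q_def nrm_minus)
    also have "\<dots> \<le> K * nrm (D x)" using D x by (intro bounded_byD[OF Dbdd]) auto
    also have "\<dots> \<le> K * (K * nrm x)"
      using x bounded_byD[OF Dbdd] by (intro mult_left_mono) (auto simp: K_def)
    finally show "nrm (Q x) \<le> K * K * nrm x" by (simp add: mult.assoc)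
  qed
  have Qcom: "commute Q B"
    unfolding commute_def Q_def using BD D B(1) by (simp add: lin_minus)
  have Qpos: "0 \<le> ip (Q x) x" if "x \<in> W" for x
    using anti[of "D x" x] that D ip_nonneg[of "D x"] by (simp add: Q_def ip_linear)
  \<comment> \<open>The form of \<open>B\<close> at \<open>D x\<close> is both nonnegative and nonpositive.\<close>
  have BD0: "B (D x) = 0" if x: "x \<in> W" for x
  proof -
    have "Q (B x) = D (B (D x))"
      using BD[OF x] D B(1) x by (simp add: Q_def lin_minus)
    then have "0 \<le> ip (D (B (D x))) x"
      using product_nonneg[OF Q Qbdd Qcom Qpos x] by simp
    then have "ip (B (D x)) (D x) \<le> 0"
      using anti[of "B (D x)" x] D B(1) x by simp
    then have "(nrm (B (D x)))\<^sup>2 \<le> 0"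
      using nrm_sq_le_ip[OF lin_W[OF D x]] by linarith
    then show ?thesis
      using nrm_eq_0[of "B (D x)"] D B(1) x by auto
  qed
  have DB0: "D (B x) = 0" if "x \<in> W" for x
    using BD[OF that] BD0[OF that] by simp
  have DDD: "D (D (D x)) = 0" if x: "x \<in> W" for x
  proof -
    have W: "D x \<in> W" "P (D x) \<in> W" using D P x by auto
    have "D (D x) = - B (P (D x))"
      using BD0[OF x] lin_zero[OF P(1)] by (simp add: D_def[of "D x"])
    then show ?thesis
      using DB0[OF W(2)] D B(1) W by (simp add: lin_minus)
  qed
  have "D x = 0" if x: "x \<in> W" for x
  proof -
    have W: "D x \<in> W" "D (D x) \<in> W" using D x by auto
    have "ip (D (D x)) (D (D x)) = 0"
      using anti[OF W] DDD[OF x] W by simp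
    then have "D (D x) = 0" using ip_definite W by blast
    then have "ip (D x) (D x) = 0" using anti[OF x W(1)] W x by simp
    then show ?thesis using ip_definite W by blast
  qed
  then show ?thesis by (simp add: commute_def D_def)
qed

end

end

context selfadjoint_operator begin

section \<open>The semigroup of a nonnegative selfadjoint operator\<close>

definition S :: "real \<Rightarrow> 'h \<Rightarrow> 'h" where
  "S t u = (THE w. w \<in> W \<and> conv (\<lambda>n. R n t u) w)"

lemma R_W [simp]: "u \<in> W \<Longrightarrow> R n t u \<in> W"
  using R_lin by auto

lemma S_eqI: assumes "u \<in> W" "w \<in> W" "conv (\<lambda>n. R n t u) w" shows "S t u = w"
  unfolding S_def using assms by (intro the_equality) (auto intro: conv_unique)

lemma S_conv: assumes "0 \<le> t" "u \<in> W" shows "S t u \<in> W" "conv (\<lambda>n. R n t u) (S t u)"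
  using R_converges[OF assms] S_eqI[OF assms(2)] by metis+

lemma S_lin: assumes t: "0 \<le> t" shows "lin (S t)"
  unfolding lin_def
proof (intro conjI ballI allI)
  fix x y c assume x: "x \<in> W" and y: "y \<in> W"
  show "S t (x + y) = S t x + S t y"
    using conv_add[OF S_conv(2)[OF t x] S_conv(2)[OF t y]] S_conv(1)[OF t] x y
    by (intro S_eqI) (auto simp: lin_add[OF R_lin])
next
  fix x c assume x: "x \<in> W"
  show "S t (c *\<^sub>R x) = c *\<^sub>R S t x"
    using conv_scale[OF S_conv(2)[OF t x]] S_conv(1)[OF t] x
    by (intro S_eqI) (auto simp: lin_scale[OF R_lin])
qed (use S_conv(1)[OF t] in auto)

lemma S_W [simp]: "0 \<le> t \<Longrightarrow> u \<in> W \<Longrightarrow> S t u \<in> W"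
  using S_conv by blast

lemma S_contraction: assumes t: "0 \<le> t" shows "bounded_by 1 (S t)"
  unfolding bounded_by_def
proof
  fix x assume x: "x \<in> W"
  have "nrm (S t x) \<le> nrm x"
    using conv_nrm[OF S_conv(2)[OF t x]] S_conv(1)[OF t x] contractionD[OF R_contraction x] x
    by (intro LIMSEQ_le_const2[of "\<lambda>n. nrm (R n t x)"]) auto
  then show "nrm (S t x) \<le> 1 * nrm x" by simp
qed

lemma S_symm: assumes t: "0 \<le> t" shows "symm (S t)"
  unfolding symm_def
proof (intro ballI)
  fix x y assume x: "x \<in> W" and y: "y \<in> W"
  have 1: "(\<lambda>n. ip (R n t x) y) \<longlonglongrightarrow> ip (S t x) y"
    using conv_ip[OF S_conv(2)[OF t x]] x y S_W[OF t] by auto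
  have "(\<lambda>n. ip (R n t y) x) \<longlonglongrightarrow> ip (S t y) x"
    using conv_ip[OF S_conv(2)[OF t y]] x y S_W[OF t] by auto
  moreover have "ip (R n t y) x = ip (R n t x) y" for n
    using R_symm[of n t] x y ip_commute[of "R n t y" x] by (simp add: symm_def)
  ultimately have "ip (S t x) y = ip (S t y) x"
    using LIMSEQ_unique[OF 1] by simp
  then show "ip (S t x) y = ip x (S t y)"
    using ip_commute x y S_W[OF t] by simp
qed

lemma commute_S:
  assumes "lin B" "bounded_by C B" "\<And>h. 0 < h \<Longrightarrow> commute B (J h)" "0 \<le> t"
  shows "commute B (S t)"
  unfolding commute_def
proof
  fix x assume x: "x \<in> W"
  have "conv (\<lambda>n. B (R n t x)) (B (S t x))"
    using assms x by (intro conv_lin[OF assms(1,2)] S_conv) auto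
  moreover have "B (R n t x) = R n t (B x)" for n
    using commuteD[OF R_commute[OF assms(3)] x] by simp
  ultimately show "B (S t x) = S t (B x)"
    using assms x by (intro S_eqI[symmetric]) auto
qed

lemma nrm_diff_S:
  assumes t: "0 \<le> t" and u: "L u f" shows "nrm (S t u - u) \<le> t * nrm f"
proof -
  note W = L_in[OF u]
  have "conv (\<lambda>n. R n t u - u) (S t u - u)"
    using W t by (intro conv_diff S_conv) (auto simp: conv_def)
  then have "(\<lambda>n. nrm (R n t u - u)) \<longlonglongrightarrow> nrm (S t u - u)"
    using W t by (intro conv_nrm) auto
  then show ?thesis
    using nrm_diff_R[OF t u] nrm_diff_commute[of u] W by (intro LIMSEQ_le_const2) auto
qed

lemma S_zero: "u \<in> W \<Longrightarrow> S 0 u = u"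
  by (rule S_eqI) (auto simp: conv_def)

text \<open>
  Rounding makes the step counts for \<open>s\<close> and \<open>t\<close> add up to the one for \<open>s + t\<close> only up to one step.
\<close>

lemma R_plus:
  assumes s: "0 \<le> s" and t: "0 \<le> t" and u: "L u f"
  shows "nrm (R n s (R n t u) - R n (s + t) u) \<le> (1/2) ^ n * nrm f"
proof -
  define i where "i = nat \<lfloor>2 ^ n * s\<rfloor>"
  define j where "j = nat \<lfloor>2 ^ n * t\<rfloor>"
  define k where "k = nat \<lfloor>2 ^ n * (s + t)\<rfloor>"
  have "k = i + j \<or> k = Suc (i + j)"
    using floor_sum[of "2 ^ n * s" "2 ^ n * t"] s t by (simp add: i_def j_def k_def algebra_simps)
  then have "nrm ((J ((1/2) ^ n) ^^ (i + j)) u - (J ((1/2) ^ n) ^^ k) u) \<le> (1/2) ^ n * nrm f"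
    using u by (intro funpow_close) auto
  then show ?thesis by (simp add: R_def funpow_add i_def j_def k_def)
qed

lemma S_plus:
  assumes s: "0 \<le> s" and t: "0 \<le> t" and u: "u \<in> W"
  shows "S (s + t) u = S s (S t u)"
proof (rule eq_on_dom[OF S_lin S_contraction _ _ _ u])
  show "lin (\<lambda>x. S s (S t x))" by (rule lin_comp[OF S_lin[OF s] S_lin[OF t]])
  show "bounded_by 1 (\<lambda>x. S s (S t x))"
    unfolding bounded_by_def
  proof
    fix x assume x: "x \<in> W"
    show "nrm (S s (S t x)) \<le> 1 * nrm x"
      using contractionD[OF S_contraction[OF s] S_W[OF t x]] contractionD[OF S_contraction[OF t] x]
      by simp
  qed
  fix v f assume v: "L v f"
  note W = L_in[OF v]
  show "S (s + t) v = S s (S t v)"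
  proof (rule S_eqI[OF W(1)])
    have lim: "(\<lambda>n. (1/2) ^ n * nrm f + nrm (R n t v - S t v) + nrm (R n s (S t v) - S s (S t v)))
        \<longlonglongrightarrow> 0 * nrm f + 0 + 0"
      using S_conv(2)[OF t W(1)] S_conv(2)[OF s S_W[OF t W(1)]] unfolding conv_def
      by (intro tendsto_intros LIMSEQ_power_zero) auto
    show "conv (\<lambda>n. R n (s + t) v) (S s (S t v))"
    proof (rule conv_squeeze)
      show "(\<lambda>n. (1/2) ^ n * nrm f + nrm (R n t v - S t v) + nrm (R n s (S t v) - S s (S t v))) \<longlonglongrightarrow> 0"
        using lim by simp
      fix n
      have "nrm (R n s (R n t v) - R n s (S t v)) \<le> nrm (R n t v - S t v)"
        using contractionD[OF R_contraction, of "R n t v - S t v" n s] W t by (simp add: lin_diff[OF R_lin])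
      then show "nrm (R n (s + t) v - S s (S t v))
          \<le> (1/2) ^ n * nrm f + nrm (R n t v - S t v) + nrm (R n s (S t v) - S s (S t v))"
        using R_plus[OF s t v, of n] W s t nrm_diff_commute[of "R n s (R n t v)" "R n (s + t) v"]
          nrm_diff_triangle[of "R n (s + t) v" "R n s (R n t v)" "S s (S t v)"]
          nrm_diff_triangle[of "R n s (R n t v)" "R n s (S t v)" "S s (S t v)"] by simp
    qed (use W s t in auto)
  qed (use W s t in auto)
qed (use s t in auto)

lemma C0_S: "C0 S"
  unfolding C0_def
proof (intro conjI allI ballI impI)
  fix u assume u: "u \<in> W"
  have "\<exists>d>0. \<forall>t. 0 < t \<and> t < d \<longrightarrow> nrm (S t u - u) < e" if e: "0 < e" for e
  proof -
    obtain v f where v: "L v f" "nrm (u - v) < e / 3"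
      using L_dense[OF u, of "e/3"] e by auto
    note W = L_in[OF v(1)] u
    define d where "d = e / (3 * (nrm f + 1))"
    have d: "0 < d" "d * nrm f \<le> e / 3"
      using e nrm_nonneg[OF W(2)] by (auto simp: d_def field_simps)
    have "nrm (S t u - u) < e" if t: "0 < t" "t < d" for t
    proof -
      have t0: "0 \<le> t" using t by simp
      have "nrm (S t v - v) \<le> t * nrm f" using nrm_diff_S[OF t0 v(1)] .
      also have "\<dots> \<le> d * nrm f" using t W by (intro mult_right_mono) auto
      finally have 1: "nrm (S t v - v) \<le> e / 3" using d(2) by linarith
      have 2: "nrm (S t u - S t v) \<le> nrm (u - v)"
        using contractionD[OF S_contraction[OF t0], of "u - v"] W by (simp add: lin_diff[OF S_lin[OF t0]])
      show ?thesis
        using 1 2 v(2) W t0 nrm_diff_commute[of u v]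
          nrm_diff_triangle[of "S t u" "S t v" u] nrm_diff_triangle[of "S t v" v u] by simp
    qed
    then show ?thesis using d(1) by blast
  qed
  then show "((\<lambda>t. nrm (S t u - u)) \<longlongrightarrow> 0) (at_right 0)"
    using u by (subst at_right_0_iff) auto
next
  fix t :: real assume "0 \<le> t"
  then show "lin (S t)" "\<exists>C. bounded_by C (S t)" using S_lin S_contraction by blast+
qed (simp_all only: S_plus S_zero)

text \<open>
  Each Euler step subtracts \<open>h (J h)\<^sup>j f\<close>, which is close to \<open>h f\<close>. As \<open>f\<close> need not lie in the domain,
  closeness is measured through a nearby element \<open>v\<close> of the domain.
\<close>

lemma funpow_J_taylor:
  assumes h: "0 < h" and u: "L u f" and v: "L v k"
  shows "nrm (u - (J h ^^ n) u - (real n * h) *\<^sub>R f)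
    \<le> (real n * h) * (2 * nrm (f - v) + (real n * h) * nrm k)"
proof (induction n)
  case (Suc n)
  note W = L_in[OF u] L_in[OF v]
  let ?K = "J h ^^ Suc n" and ?c = "2 * nrm (f - v)"
  have lK: "lin ?K" and cK: "bounded_by 1 ?K"
    using J_lin[OF h] J_contraction[OF h] by (auto intro!: lin_funpow contraction_funpow simp del: funpow.simps)
  have lK': "lin (J h ^^ n)" using J_lin[OF h] lin_funpow by blast
  have "nrm (?K f - f) \<le> nrm (?K (f - v)) + nrm (?K v - v) + nrm (f - v)"
  proof -
    have "?K f - f = ?K (f - v) + (?K v - v) - (f - v)"
      using W by (simp add: lin_diff[OF lK] del: funpow.simps)
    then show ?thesis
      using nrm_diff_le[of "?K (f - v) + (?K v - v)" "f - v"]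
        nrm_triangle[of "?K (f - v)" "?K v - v"] W lin_W[OF lK] by (simp del: funpow.simps)
  qed
  also have "\<dots> \<le> nrm (f - v) + (real (Suc n) * h) * nrm k + nrm (f - v)"
    using contractionD[OF cK, of "f - v"] nrm_diff_funpow_J[OF h v, of "Suc n"] W
      nrm_diff_commute[of v "?K v"] lin_W[OF lK] by (simp del: funpow.simps)
  finally have 1: "nrm (?K f - f) \<le> ?c + (real (Suc n) * h) * nrm k" by simp
  have "(J h ^^ n) u - ?K u = h *\<^sub>R ?K f"
    using diff_J[OF h funpow_J_L[OF h u, of n]] by simp
  then have "u - ?K u - (real (Suc n) * h) *\<^sub>R f
      = (u - (J h ^^ n) u - (real n * h) *\<^sub>R f) + h *\<^sub>R (?K f - f)"
    by (simp add: algebra_simps del: funpow.simps)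
  also have "nrm \<dots> \<le> nrm (u - (J h ^^ n) u - (real n * h) *\<^sub>R f) + nrm (h *\<^sub>R (?K f - f))"
    using W lin_W[OF lK] lin_W[OF lK'] by (intro nrm_triangle) (auto simp del: funpow.simps)
  also have "\<dots> \<le> (real n * h) * (?c + (real n * h) * nrm k) + h * (?c + (real (Suc n) * h) * nrm k)"
    using Suc 1 h W lin_W[OF lK] by (intro add_mono) (auto simp: nrm_scale simp del: funpow.simps)
  also have "\<dots> \<le> (real n * h) * (?c + (real (Suc n) * h) * nrm k) + h * (?c + (real (Suc n) * h) * nrm k)"
    using h W by (intro add_right_mono mult_left_mono add_left_mono mult_right_mono) auto
  finally show ?case by (simp add: algebra_simps del: funpow.simps)
qed simp

lemma S_taylor:
  assumes t: "0 \<le> t" and u: "L u f" and v: "L v k"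
  shows "nrm (S t u - u + t *\<^sub>R f) \<le> t * (2 * nrm (f - v) + t * nrm k)"
proof -
  note W = L_in[OF u] L_in[OF v]
  let ?B = "t * (2 * nrm (f - v) + t * nrm k)"
  have "nrm (R n t u - u + t *\<^sub>R f) \<le> ?B + (1/2) ^ n * nrm f" for n
  proof -
    define m where "m = nat \<lfloor>2 ^ n * t\<rfloor>"
    define q where "q = real m * (1/2) ^ n"
    have q: "0 \<le> q" "q \<le> t" "t - q \<le> (1/2) ^ n"
      using floor_bounds[OF t, of n] by (auto simp: q_def m_def)
    have "nrm (u - R n t u - q *\<^sub>R f) \<le> q * (2 * nrm (f - v) + q * nrm k)"
      using funpow_J_taylor[OF _ u v, of "(1/2) ^ n" m] by (simp add: R_def m_def q_def)
    also have "\<dots> \<le> ?B"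
      using q W by (intro mult_mono add_left_mono mult_right_mono) auto
    finally have 1: "nrm (u - R n t u - q *\<^sub>R f) \<le> ?B" .
    have "R n t u - u + t *\<^sub>R f = (t - q) *\<^sub>R f - (u - R n t u - q *\<^sub>R f)"
      by (simp add: algebra_simps)
    also have "nrm \<dots> \<le> nrm ((t - q) *\<^sub>R f) + nrm (u - R n t u - q *\<^sub>R f)"
      using W by (intro nrm_diff_le) auto
    also have "nrm ((t - q) *\<^sub>R f) \<le> (1/2) ^ n * nrm f"
      using q W by (auto simp: nrm_scale intro!: mult_right_mono)
    finally show ?thesis using 1 by simp
  qed
  moreover have "(\<lambda>n. ?B + (1/2) ^ n * nrm f) \<longlonglongrightarrow> ?B + 0 * nrm f"
    by (intro tendsto_intros LIMSEQ_power_zero) auto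
  moreover have "conv (\<lambda>n. R n t u - u + t *\<^sub>R f) (S t u - u + t *\<^sub>R f)"
    using W t by (intro conv_add conv_diff S_conv) (auto simp: conv_def)
  then have "(\<lambda>n. nrm (R n t u - u + t *\<^sub>R f)) \<longlonglongrightarrow> nrm (S t u - u + t *\<^sub>R f)"
    using W t by (intro conv_nrm) auto
  ultimately have "nrm (S t u - u + t *\<^sub>R f) \<le> ?B + 0 * nrm f"
    using LIMSEQ_le by blast
  then show ?thesis by simp
qed

lemma L_imp_gen:
  assumes u: "L u f" shows "gen S u (- f)"
  unfolding gen_iff[OF C0_S]
proof (intro conjI allI impI)
  note W = L_in[OF u]
  fix e :: real assume e: "0 < e"
  obtain v k where v: "L v k" "nrm (f - v) < e / 4"
    using L_dense[OF W(2), of "e/4"] e by auto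
  note W' = L_in[OF v(1)]
  define d where "d = e / (2 * (nrm k + 1))"
  have d: "0 < d" "d * nrm k \<le> e / 2"
    using e nrm_nonneg[OF W'(2)] by (auto simp: d_def field_simps)
  have "nrm ((1/t) *\<^sub>R (S t u - u) - - f) < e" if t: "0 < t" "t < d" for t
  proof -
    have "(1/t) *\<^sub>R (S t u - u) - - f = (1/t) *\<^sub>R (S t u - u + t *\<^sub>R f)"
      using t by (simp add: algebra_simps)
    also have "nrm \<dots> = (1/t) * nrm (S t u - u + t *\<^sub>R f)"
      using t W by (subst nrm_scale) auto
    also have "\<dots> \<le> (1/t) * (t * (2 * nrm (f - v) + t * nrm k))"
      using t S_taylor[OF _ u v(1), of t] by (intro mult_left_mono) auto
    also have "\<dots> = 2 * nrm (f - v) + t * nrm k" using t by simp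
    also have "t * nrm k \<le> d * nrm k" using t W' by (intro mult_right_mono) auto
    finally show ?thesis using d v(2) by simp
  qed
  then show "\<exists>d>0. \<forall>t. 0 < t \<and> t < d \<longrightarrow> nrm ((1/t) *\<^sub>R (S t u - u) - - f) < e"
    using d(1) by blast
qed (use L_in[OF u] in auto)

text \<open>
  The generator of the contraction semigroup is dissipative, and \<open>- L\<close> has no proper dissipative extension since
  \<open>1 + L\<close> is onto.
\<close>

theorem gen_S: "gen S u (- f) \<longleftrightarrow> L u f"
proof
  assume g: "gen S u (- f)"
  have W: "u \<in> W" "f \<in> W" using gen_W[OF g] W_minus[of "- f"] by auto
  obtain w k where w: "L w k" "w + 1 *\<^sub>R k = u + f"
    using L_range[of 1 "u + f"] W by auto
  note W' = L_in[OF w(1)]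
  have eq: "- f - - k = u - w" using w(2) by (simp add: algebra_simps)
  have "gen S (u - w) (u - w)"
    using gen_diff[OF C0_S g L_imp_gen[OF w(1)]] unfolding eq .
  then have "ip (u - w) (u - w) \<le> 0"
    using gen_dissipative[OF C0_S] S_contraction by blast
  then have "ip (u - w) (u - w) = 0" using ip_nonneg[of "u - w"] W W' by (intro antisym) auto
  then have "u - w = 0" using ip_definite[of "u - w"] W W' by blast
  then show "L u f" using w by simp
qed (rule L_imp_gen)

text \<open>
  A semigroup with generator \<open>- L\<close> commutes with the resolvents of \<open>L\<close> and so with \<open>S\<close>. On the domain of \<open>L\<close>
  the operators \<open>T h\<close> and \<open>S h\<close> differ by \<open>o(h)\<close>. Telescoping over \<open>n\<close> steps of length \<open>h = s/n\<close> gives equality,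
  first on an interval at \<open>0\<close> on which \<open>T\<close> is uniformly bounded and then, by taking powers, for all times.
\<close>

theorem C0_unique:
  assumes T: "C0 T" and gen: "\<And>u f. gen T u (- f) \<longleftrightarrow> L u f" and t: "0 \<le> t" and u: "u \<in> W"
  shows "T t u = S t u"
proof -
  have comJ: "commute (T s) (J h)" if s: "0 \<le> s" and h: "0 < h" for s h
  proof (rule commute_J[OF h C0_lin[OF T s]])
    fix v f assume v: "L v f"
    obtain C where C: "bounded_by C (T s)" using C0_bounded[OF T s] by blast
    have "commute (T s) (T r)" if "0 < r" for r
      unfolding commute_def
      using C0_plus[OF T s, of r] C0_plus[OF T _ s, of r] that by (simp add: add.commute)
    then have "gen T (T s v) (T s (- f))"
      using gen_commute[OF T C0_lin[OF T s] C] gen v by blast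
    then show "L (T s v) (T s f)"
      using gen L_in[OF v] by (simp add: lin_minus[OF C0_lin[OF T s]])
  qed
  have com: "commute (T s) (S r)" if "0 \<le> s" "0 \<le> r" for s r
    using C0_bounded[OF T that(1)] commute_S[OF C0_lin[OF T that(1)] _ comJ] that by blast
  obtain \<delta> C where \<delta>: "0 < \<delta>" "0 \<le> C" "\<And>t. 0 \<le> t \<Longrightarrow> t \<le> \<delta> \<Longrightarrow> bounded_by C (T t)"
    using C0_locally_bounded[OF T] by metis
  have local: "T s v = S s v" if s: "0 \<le> s" "s \<le> \<delta>" and v: "v \<in> W" for s v
  proof (rule eq_on_dom[OF C0_lin[OF T s(1)] \<delta>(3)[OF s] S_lin[OF s(1)] S_contraction[OF s(1)] _ v])
    fix u f assume u: "L u f"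
    note W = L_in[OF u]
    note TW = lin_W[OF C0_lin[OF T]]
    show "T s u = S s u"
    proof (rule eq_if_close)
      fix e :: real assume e: "0 < e"
      \<comment> \<open>Chosen so that \<open>n\<close> steps of length \<open>h = s/n\<close>, each contributing at most \<open>C * (h * (2 * c))\<close>, add up to at most \<open>e\<close>.\<close>
      define c where "c = e / (2 * ((s + 1) * (C + 1)))"
      have c: "0 < c" using e s \<delta> by (auto simp: c_def)
      obtain d where d: "0 < d" "\<And>r. 0 < r \<Longrightarrow> r < d \<Longrightarrow> nrm ((1/r) *\<^sub>R (T r u - u) - - f) < c"
        using genD[OF T _ c, of u "- f"] gen u by blast
      obtain d' where d': "0 < d'" "\<And>r. 0 < r \<Longrightarrow> r < d' \<Longrightarrow> nrm ((1/r) *\<^sub>R (S r u - u) - - f) < c"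
        using genD[OF C0_S _ c, of u "- f"] gen_S u by blast
      obtain n where n: "s / min d d' < real n" using reals_Archimedean2 by blast
      have mn: "0 < min d d'" using d(1) d'(1) by simp
      then have n0: "0 < real n" using n s by (meson divide_nonneg_pos le_less_trans)
      define h where "h = s / real n"
      have h: "0 \<le> h" "h < min d d'" "s = real n * h"
      proof -
        show "0 \<le> h" "s = real n * h" using n0 s by (auto simp: h_def)
        have "s < min d d' * real n" using n mn by (simp only: pos_divide_less_eq mult.commute)
        then show "h < min d d'" unfolding h_def using n0 by (simp only: pos_divide_less_eq)
      qed
      have step: "nrm (T h u - S h u) \<le> h * (2 * c)"
      proof (cases "h = 0")
        case False
        then have h': "0 < h" using h by simp
        have "(1/h) *\<^sub>R (T h u - S h u)
            = ((1/h) *\<^sub>R (T h u - u) - - f) - ((1/h) *\<^sub>R (S h u - u) - - f)"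
          by (simp add: algebra_simps)
        also have "nrm \<dots> \<le> nrm ((1/h) *\<^sub>R (T h u - u) - - f) + nrm ((1/h) *\<^sub>R (S h u - u) - - f)"
          using W h TW by (intro nrm_diff_le) auto
        also have "\<dots> \<le> c + c"
          using d(2)[OF h'] d'(2)[OF h'] h(2) by simp
        finally have "(1/h) * nrm (T h u - S h u) \<le> 2 * c"
          using nrm_scale[of "T h u - S h u" "1/h"] h' W TW by simp
        then show ?thesis using h' by (simp add: field_simps)
      qed (use C0_zero[OF T] S_zero W c in simp)
      have "bounded_by C (T h ^^ j)" if "j < n" for j
      proof -
        have "real j * h \<le> s" using that h by (simp add: mult_right_mono)
        then have "bounded_by C (T (real j * h))" using \<delta>(3)[of "real j * h"] h s by simp
        then show ?thesis using C0_funpow[OF T h(1), of _ j] by (simp add: bounded_by_def)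
      qed
      then have "nrm ((T h ^^ n) u - (S h ^^ n) u) \<le> real n * (C * nrm (T h u - S h u))"
        using h W \<delta>(2) com
        by (intro power_diff_bound C0_lin[OF T] S_lin S_contraction) auto
      also have "\<dots> \<le> real n * (C * (h * (2 * c)))"
        using step \<delta>(2) by (intro mult_left_mono) auto
      also have "\<dots> = s * C * (2 * c)" using h(3) by simp
      also have "\<dots> \<le> (s + 1) * (C + 1) * (2 * c)"
        using s \<delta>(2) c by (intro mult_right_mono mult_mono) auto
      also have "\<dots> = e"
      proof -
        have "(s + 1) * (C + 1) \<noteq> 0" using s \<delta>(2) by simp
        then show ?thesis by (simp only: c_def) simp
      qed
      finally show "nrm (T s u - S s u) \<le> e"
        using C0_funpow[OF T h(1) W(1), of n] C0_funpow[OF C0_S h(1) W(1), of n] h(3) by simp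
    qed (use W s TW in auto)
  qed
  obtain n where n: "t / \<delta> < real n" using reals_Archimedean2 by blast
  then have n0: "0 < real n" using t \<delta>(1) by (meson divide_nonneg_pos le_less_trans)
  define h where "h = t / real n"
  have h: "0 \<le> h" "h \<le> \<delta>" "t = real n * h"
    using n n0 \<delta>(1) t by (auto simp: h_def field_simps)
  have "(T h ^^ k) u = (S h ^^ k) u" for k
  proof (induction k)
    case (Suc k)
    have "(S h ^^ k) u \<in> W" using lin_funpow[OF S_lin[OF h(1)]] u by auto
    then show ?case using Suc local[OF h(1,2)] by simp
  qed simp
  then show ?thesis
    using C0_funpow[OF T h(1) u, of n] C0_funpow[OF C0_S h(1) u, of n] h(3) by simp
qed

lemma S_ip_bounds:
  assumes "0 \<le> t" "x \<in> W" shows "0 \<le> ip (S t x) x" "ip (S t x) x \<le> ip x x"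
proof -
  have "S t x = S (t/2) (S (t/2) x)"
    using S_plus[of "t/2" "t/2" x] assms by simp
  then have "ip (S t x) x = ip (S (t/2) x) (S (t/2) x)"
    using S_symm[of "t/2"] assms by (simp add: symm_def)
  then show "0 \<le> ip (S t x) x" using ip_nonneg[of "S (t/2) x"] assms by simp
  have "ip (S t x) x \<le> nrm (S t x) * nrm x"
    using Cauchy_Schwarz[of "S t x" x] assms by simp
  also have "\<dots> \<le> nrm x * nrm x"
    using contractionD[OF S_contraction[OF assms(1)] assms(2)] assms by (intro mult_right_mono) auto
  finally show "ip (S t x) x \<le> ip x x" using nrm_sq[OF assms(2)] by (simp add: power2_eq_square)
qed

text \<open>
  Repeated square roots lead from one time \<open>s\<close> to all dyadic multiples of \<open>s\<close>, strong continuity to all times, and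
  differentiation at \<open>0\<close> to the operator. Conversely, an operator that preserves the graph commutes with the resolvents
  and with the limit of their powers.
\<close>

theorem commute_S_iff:
  assumes P: "lin P" "bounded_by C P" "symm P" and s: "0 < s"
  shows "commute P (S s) \<longleftrightarrow> (\<forall>u f. L u f \<longrightarrow> L (P u) (P f))"
proof
  assume "\<forall>u f. L u f \<longrightarrow> L (P u) (P f)"
  then show "commute P (S s)"
    using s by (intro commute_S[OF P(1,2)] commute_J P(1)) auto
next
  assume com: "commute P (S s)"
  have half: "commute P (S (r/2))" if "commute P (S r)" "0 < r" for r
  proof (rule commute_sqrt[OF S_lin S_symm _ _ P])
    have "S r x = S (r/2) (S (r/2) x)" if "x \<in> W" for x
      using S_plus[of "r/2" "r/2" x] that \<open>0 < r\<close> by simp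
    then show "commute P (\<lambda>x. S (r/2) (S (r/2) x))"
      using that P(1) by (simp add: commute_def)
  qed (use S_ip_bounds[of "r/2"] that in auto)
  have dyadic: "commute P (S (s * (1/2) ^ n))" for n
  proof (induction n)
    case (Suc n)
    then show ?case using half[of "s * (1/2) ^ n"] s by simp
  qed (use com in simp)
  have multiple: "commute P (S (real k * (s * (1/2) ^ n)))" for n k
  proof -
    have "commute P (S (s * (1/2) ^ n) ^^ k)"
      using dyadic s by (intro commute_funpow S_lin) auto
    moreover have "S (real k * (s * (1/2) ^ n)) x = (S (s * (1/2) ^ n) ^^ k) x" if "x \<in> W" for x
      using C0_funpow[OF C0_S _ that] s by simp
    ultimately show ?thesis using P(1) by (simp add: commute_def)
  qed
  have all: "commute P (S t)" if t: "0 < t" for t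
    unfolding commute_def
  proof
    fix x assume x: "x \<in> W"
    \<comment> \<open>The dyadic multiple of \<open>s\<close> just below \<open>t\<close>; the continuity from the right at \<open>0\<close> suffices since \<open>q n \<le> t\<close>.\<close>
    define q where "q n = real (nat \<lfloor>2 ^ n * (t/s)\<rfloor>) * (s * (1/2) ^ n)" for n
    have q: "0 \<le> q n" "q n \<le> t" "t - q n \<le> s * (1/2) ^ n" for n
    proof -
      show "0 \<le> q n" using s by (simp add: q_def)
      have "q n = real (nat \<lfloor>2 ^ n * (t/s)\<rfloor>) * (1/2) ^ n * s" by (simp add: q_def)
      also have "\<dots> \<le> t/s * s"
        using floor_bounds(1)[of "t/s" n] s t by (intro mult_right_mono) auto
      finally show "q n \<le> t" using s by simp
      have "(t/s - (1/2) ^ n) * s \<le> real (nat \<lfloor>2 ^ n * (t/s)\<rfloor>) * (1/2) ^ n * s"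
        using floor_bounds(2)[of "t/s" n] s t by (intro mult_right_mono) auto
      then show "t - q n \<le> s * (1/2) ^ n" using s by (simp add: q_def algebra_simps)
    qed
    have qlim: "conv (\<lambda>n. S (q n) y) (S t y)" if y: "y \<in> W" for y
      unfolding conv_def LIMSEQ_def
    proof (intro allI impI)
      fix e :: real assume e: "0 < e"
      obtain d where d: "0 < d" "\<And>t. 0 \<le> t \<Longrightarrow> t < d \<Longrightarrow> nrm (S t y - y) < e"
        using C0_small[OF C0_S y e] by blast
      have "(\<lambda>n. s * (1/2) ^ n) \<longlonglongrightarrow> s * 0"
        by (intro tendsto_intros LIMSEQ_power_zero) auto
      then obtain N where N: "\<And>n. N \<le> n \<Longrightarrow> s * (1/2) ^ n < d"
        using d(1) s unfolding LIMSEQ_def by (fastforce simp: dist_real_def)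
      have "nrm (S (q n) y - S t y) < e" if "N \<le> n" for n
      proof -
        have r: "0 \<le> t - q n" "t - q n < d" using q[of n] N[OF that] by auto
        have "S t y = S (q n) (S (t - q n) y)"
          using S_plus[OF q(1) r(1) y, of n] by simp
        then have "nrm (S (q n) y - S t y) = nrm (S (q n) (y - S (t - q n) y))"
          using y q(1) r by (simp add: lin_diff[OF S_lin])
        also have "\<dots> \<le> nrm (y - S (t - q n) y)"
          using y q(1) r by (intro contractionD S_contraction) auto
        also have "\<dots> < e"
          using d(2)[OF r] nrm_diff_commute[of y "S (t - q n) y"] y r by simp
        finally show ?thesis .
      qed
      then show "\<exists>N. \<forall>n\<ge>N. dist (nrm (S (q n) y - S t y)) 0 < e"
        using y q(1) t by (auto simp: dist_real_def)
    qed
    have "conv (\<lambda>n. P (S (q n) x)) (P (S t x))"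
      using x q t by (intro conv_lin[OF P(1,2)] qlim) auto
    moreover have "P (S (q n) x) = S (q n) (P x)" for n
      using commuteD[OF multiple x] by (simp add: q_def)
    ultimately have "conv (\<lambda>n. S (q n) (P x)) (P (S t x))" by simp
    then show "P (S t x) = S t (P x)"
      using qlim[of "P x"] P(1) x q t by (intro conv_unique[of "\<lambda>n. S (q n) (P x)"]) auto
  qed
  show "\<forall>u f. L u f \<longrightarrow> L (P u) (P f)"
  proof (intro allI impI)
    fix u f assume u: "L u f"
    have "gen S (P u) (P (- f))"
      using gen_commute[OF C0_S P(1,2) all] gen_S u by blast
    then show "L (P u) (P f)"
      using gen_S L_in[OF u] by (simp add: lin_minus[OF P(1)])
  qed
qed

end

section \<open>The space of square integrable functions\<close>

instantiation "fun" :: (type, real_vector) real_vector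
begin

definition "c *\<^sub>R f = (\<lambda>x. c *\<^sub>R f x)"

instance
  by standard (auto simp: fun_eq_iff scaleR_fun_def scaleR_add_right scaleR_add_left)

end

lemma scaleR_fun_apply [simp]: "(c *\<^sub>R f) x = c *\<^sub>R f x"
  by (simp add: scaleR_fun_def)

lemma diff_fun_apply [simp]: "((f :: 'a \<Rightarrow> 'b :: ab_group_add) - g) x = f x - g x"
  by (simp add: fun_diff_def)

lemma uminus_fun_apply [simp]: "(- (f :: 'a \<Rightarrow> 'b :: ab_group_add)) x = - f x"
  by (simp add: fun_Compl_def)

lemma L2_measurable [measurable_dest]: "u \<in> L2 M \<Longrightarrow> u \<in> borel_measurable M"
  by (simp add: L2_def)

lemma L2_square_integrable: "u \<in> L2 M \<Longrightarrow> integrable M (\<lambda>x. (u x)\<^sup>2)"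
  by (simp add: L2_def)

lemma L2_I_bound:
  assumes "f \<in> borel_measurable M" "integrable M g" "\<And>x. (f x)\<^sup>2 \<le> g x"
  shows "f \<in> L2 M"
proof -
  have "integrable M (\<lambda>x. (f x)\<^sup>2)"
    by (rule Bochner_Integration.integrable_bound[OF assms(2)])
       (use assms in \<open>auto intro!: AE_I2 order_trans[OF assms(3) abs_ge_self]\<close>)
  then show ?thesis using assms(1) by (simp add: L2_def)
qed

lemma L2_subspace: "subspace (L2 M)"
proof (rule subspaceI)
  show "0 \<in> L2 M" by (simp add: L2_def zero_fun_def)
  fix u v :: "'a \<Rightarrow> real" and c :: real
  assume u: "u \<in> L2 M"
  show "c *\<^sub>R u \<in> L2 M"
    using u by (intro L2_I_bound[where g = "\<lambda>x. c\<^sup>2 * (u x)\<^sup>2"])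
      (auto simp: scaleR_fun_def L2_def power_mult_distrib)
  assume v: "v \<in> L2 M"
  have "(u x + v x)\<^sup>2 \<le> 2 * (u x)\<^sup>2 + 2 * (v x)\<^sup>2" for x
    using zero_le_power2[of "u x - v x"] by (simp add: power2_sum power2_diff)
  then show "u + v \<in> L2 M"
    using u v by (intro L2_I_bound[where g = "\<lambda>x. 2 * (u x)\<^sup>2 + 2 * (v x)\<^sup>2"])
      (auto simp: plus_fun_def L2_def)
qed

lemmas L2_add [simp] = subspace_add[OF L2_subspace]
  and L2_diff [simp] = subspace_diff[OF L2_subspace]
  and L2_scale [simp] = subspace_scale[OF L2_subspace]
  and L2_uminus [simp] = subspace_neg[OF L2_subspace]
  and L2_zero [simp] = subspace_0[OF L2_subspace]

lemma L2_product_integrable: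
  assumes "u \<in> L2 M" "v \<in> L2 M" shows "integrable M (\<lambda>x. u x * v x)"
proof (rule Bochner_Integration.integrable_bound)
  show "integrable M (\<lambda>x. (u x)\<^sup>2 + (v x)\<^sup>2)"
    using assms by (intro Bochner_Integration.integrable_add L2_square_integrable)
  show "(\<lambda>x. u x * v x) \<in> borel_measurable M"
    using assms[THEN L2_measurable] by measurable
  have "\<bar>a * b\<bar> \<le> a\<^sup>2 + b\<^sup>2" for a b :: real
    using zero_le_power2[of "\<bar>a\<bar> - \<bar>b\<bar>"] mult_nonneg_nonneg[of "\<bar>a\<bar>" "\<bar>b\<bar>"]
    unfolding power2_diff abs_mult power2_abs by linarith
  then show "AE x in M. norm (u x * v x) \<le> norm ((u x)\<^sup>2 + (v x)\<^sup>2)"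
    by (intro AE_I2) (metis abs_ge_self order_trans real_norm_def)
qed

lemma L2_inner_cong:
  assumes "u \<in> L2 M" "v \<in> L2 M" "u' \<in> L2 M" "v' \<in> L2 M"
    "AE x in M. u x = u' x" "AE x in M. v x = v' x"
  shows "L2_inner M u v = L2_inner M u' v'"
  unfolding L2_inner_def
  by (rule integral_cong_AE) (use assms in \<open>auto simp: L2_def\<close>)

lemma L2_norm_nn_integral:
  assumes "u \<in> L2 M" shows "ennreal ((L2_norm M u)\<^sup>2) = (\<integral>\<^sup>+x. ennreal ((u x)\<^sup>2) \<partial>M)"
proof -
  have "(L2_norm M u)\<^sup>2 = (\<integral>x. (u x)\<^sup>2 \<partial>M)"
    by (simp add: L2_norm_def L2_inner_def power2_eq_square)
  then show ?thesis
    using L2_square_integrable[OF assms] by (simp add: nn_integral_eq_integral)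
qed

lemma L2_norm_nonneg [simp]: "0 \<le> L2_norm M u"
  by (simp add: L2_norm_def L2_inner_def)

text \<open>
  The Riesz-Fischer theorem. The subsequence has increments with squared norms at most \<open>8\<^sup>-\<^sup>j\<close>; then the sum over
  \<open>j\<close> of \<open>4\<^sup>j\<close> times their squares is integrable, so almost everywhere the increments are bounded by a multiple
  of \<open>2\<^sup>-\<^sup>j\<close>. Fatou's lemma estimates the distance to the pointwise limit.
\<close>

theorem L2_complete:
  fixes a :: "nat \<Rightarrow> 'a \<Rightarrow> real"
  assumes a: "\<And>n. a n \<in> L2 M"
    and Cauchy: "\<And>e. 0 < e \<Longrightarrow> \<exists>N. \<forall>m\<ge>N. \<forall>n\<ge>N. L2_norm M (a m - a n) < e"
  shows "\<exists>w\<in>L2 M. (\<lambda>n. L2_norm M (a n - w)) \<longlonglongrightarrow> 0"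
proof -
  note [measurable] = L2_measurable[OF a]
  have "\<exists>N. \<forall>m\<ge>N. \<forall>n\<ge>N. (L2_norm M (a m - a n))\<^sup>2 \<le> (1/8) ^ j" for j
  proof -
    obtain N where N: "\<forall>m\<ge>N. \<forall>n\<ge>N. L2_norm M (a m - a n) < sqrt ((1/8) ^ j)"
      using Cauchy[of "sqrt ((1/8) ^ j)"] by auto
    have "(L2_norm M (a m - a n))\<^sup>2 \<le> (1/8) ^ j" if "N \<le> m" "N \<le> n" for m n
    proof -
      have "(L2_norm M (a m - a n))\<^sup>2 \<le> (sqrt ((1/8) ^ j))\<^sup>2"
        using N that by (intro power_mono) (auto simp: less_imp_le)
      then show ?thesis by simp
    qed
    then show ?thesis by blast
  qed
  then obtain N where N: "\<And>j m n. N j \<le> m \<Longrightarrow> N j \<le> n \<Longrightarrow> (L2_norm M (a m - a n))\<^sup>2 \<le> (1/8) ^ j"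
    by metis
  \<comment> \<open>Partial sums make the indices monotone; they need not be distinct.\<close>
  define r where "r j = (\<Sum>i\<le>j. N i)" for j
  have r: "N i \<le> r j" if "i \<le> j" for i j
    unfolding r_def using that by (intro member_le_sum) auto
  have bound: "(\<integral>\<^sup>+x. ennreal ((a m x - a n x)\<^sup>2) \<partial>M) \<le> ennreal ((1/8) ^ j)"
    if "N j \<le> m" "N j \<le> n" for j m n
    using N[OF that] L2_norm_nn_integral[of "a m - a n" M] a by (simp flip: ennreal_le_iff)
  define d where "d j x = a (r (Suc j)) x - a (r j) x" for j x
  have [measurable]: "d j \<in> borel_measurable M" for j unfolding d_def by measurable
  define G where "G x = (\<Sum>j. ennreal (4 ^ j * (d j x)\<^sup>2))" for x
  have "(\<integral>\<^sup>+x. G x \<partial>M) = (\<Sum>j. \<integral>\<^sup>+x. ennreal (4 ^ j * (d j x)\<^sup>2) \<partial>M)"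
    unfolding G_def by (intro nn_integral_suminf) measurable
  also have "\<dots> \<le> (\<Sum>j. ennreal ((1/2) ^ j))"
  proof (intro suminf_le allI summableI)
    fix j
    have "(\<integral>\<^sup>+x. ennreal (4 ^ j * (d j x)\<^sup>2) \<partial>M) = ennreal (4 ^ j) * (\<integral>\<^sup>+x. ennreal ((d j x)\<^sup>2) \<partial>M)"
      by (subst nn_integral_cmult[symmetric]) (auto simp: ennreal_mult)
    also have "\<dots> \<le> ennreal (4 ^ j) * ennreal ((1/8) ^ j)"
      unfolding d_def using r[of j "Suc j"] r[of j j] by (intro mult_left_mono bound) auto
    also have "\<dots> = ennreal ((1/2) ^ j)"
      by (simp add: flip: ennreal_mult power_mult_distrib)
    finally show "(\<integral>\<^sup>+x. ennreal (4 ^ j * (d j x)\<^sup>2) \<partial>M) \<le> ennreal ((1/2) ^ j)" .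
  qed
  also have "\<dots> = ennreal (\<Sum>j. (1/2) ^ j)"
    by (intro suminf_ennreal2) (auto intro: summable_geometric)
  also have "\<dots> < \<infinity>" by simp
  finally have "AE x in M. G x \<noteq> \<infinity>"
    by (intro nn_integral_PInf_AE) (auto simp: G_def)
  then have conv: "AE x in M. convergent (\<lambda>j. a (r j) x)"
  proof eventually_elim
    case (elim x)
    define g where "g = enn2real (G x)"
    have g: "G x = ennreal g" "0 \<le> g"
      unfolding g_def using elim by (simp_all add: less_top[symmetric])
    have "norm (d j x) \<le> sqrt g * (1/2) ^ j" for j
    proof -
      have "(\<Sum>i\<in>{j}. ennreal (4 ^ i * (d i x)\<^sup>2)) \<le> (\<Sum>i. ennreal (4 ^ i * (d i x)\<^sup>2))"
        by (rule sum_le_suminf[OF summableI]) (rule finite.intros, rule finite.intros, rule zero_le)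
      then have "ennreal (4 ^ j * (d j x)\<^sup>2) \<le> G x"
        unfolding G_def by (simp only: sum.insert sum.empty finite.emptyI empty_iff not_False_eq_True add_0_right simp_thms)
      then have "4 ^ j * (d j x)\<^sup>2 \<le> g" using g by simp
      moreover have "(2 ^ j * d j x)\<^sup>2 = 4 ^ j * (d j x)\<^sup>2"
        by (simp add: power2_eq_square mult_ac flip: power_mult_distrib)
      ultimately have "sqrt ((2 ^ j * d j x)\<^sup>2) \<le> sqrt g"
        by (intro real_sqrt_le_mono) simp
      then have "2 ^ j * \<bar>d j x\<bar> \<le> sqrt g" by (simp add: abs_mult)
      then show ?thesis by (simp add: field_simps)
    qed
    moreover have "summable (\<lambda>j. sqrt g * (1/2) ^ j)"
      by (intro summable_mult summable_geometric) simp
    ultimately have "summable (\<lambda>j. d j x)"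
      by (rule summable_comparison_test'[rotated])
    then have "convergent (\<lambda>n. \<Sum>j<n. d j x)" by (simp add: summable_iff_convergent)
    moreover have "(\<Sum>j<n. d j x) = a (r n) x - a (r 0) x" for n
      unfolding d_def by (rule sum_lessThan_telescope)
    ultimately have "convergent (\<lambda>n. (a (r n) x - a (r 0) x) + a (r 0) x)"
      by (intro convergent_add convergent_const) simp
    then show ?case by simp
  qed
  define w where "w x = lim (\<lambda>j. a (r j) x)" for x
  have [measurable]: "w \<in> borel_measurable M"
    unfolding w_def by measurable
  have close: "(\<integral>\<^sup>+x. ennreal ((a m x - w x)\<^sup>2) \<partial>M) \<le> ennreal ((1/8) ^ j)" if m: "N j \<le> m" for j m
  proof -
    have "AE x in M. ennreal ((a m x - w x)\<^sup>2) = liminf (\<lambda>i. ennreal ((a m x - a (r i) x)\<^sup>2))"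
      using conv
    proof eventually_elim
      case (elim x)
      then have "(\<lambda>i. a (r i) x) \<longlonglongrightarrow> w x" by (simp add: w_def convergent_LIMSEQ_iff)
      then have "(\<lambda>i. ennreal ((a m x - a (r i) x)\<^sup>2)) \<longlonglongrightarrow> ennreal ((a m x - w x)\<^sup>2)"
        by (intro tendsto_intros)
      then show ?case by (rule lim_imp_Liminf[OF sequentially_bot, symmetric])
    qed
    then have "(\<integral>\<^sup>+x. ennreal ((a m x - w x)\<^sup>2) \<partial>M) = (\<integral>\<^sup>+x. liminf (\<lambda>i. ennreal ((a m x - a (r i) x)\<^sup>2)) \<partial>M)"
      by (rule nn_integral_cong_AE)
    also have "\<dots> \<le> liminf (\<lambda>i. \<integral>\<^sup>+x. ennreal ((a m x - a (r i) x)\<^sup>2) \<partial>M)"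
      by (intro nn_integral_liminf) measurable
    also have "\<dots> \<le> liminf (\<lambda>i. ennreal ((1/8) ^ j))"
      by (intro Liminf_mono eventually_sequentiallyI[of j] bound m r)
    finally show ?thesis by (simp add: Liminf_const)
  qed
  have diff: "a m - w \<in> L2 M" if m: "N 0 \<le> m" for m
  proof -
    have "(\<integral>\<^sup>+x. ennreal ((a m x - w x)\<^sup>2) \<partial>M) < \<infinity>"
      using close[OF m] by (simp add: order_le_less_trans)
    then have "integrable M (\<lambda>x. (a m x - w x)\<^sup>2)"
      by (intro integrableI_nonneg) auto
    then show ?thesis by (simp add: L2_def fun_diff_def)
  qed
  have wL2: "w \<in> L2 M"
    using L2_diff[OF a[of "N 0"] diff[of "N 0"]] by simp
  have "(\<lambda>n. L2_norm M (a n - w)) \<longlonglongrightarrow> 0"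
    unfolding LIMSEQ_def
  proof (intro allI impI)
    fix e :: real assume e: "0 < e"
    obtain j where j: "(1/8) ^ j < e\<^sup>2"
      using real_arch_pow_inv[of "e\<^sup>2" "1/8"] e by auto
    have "L2_norm M (a n - w) < e" if "N j \<le> n" for n
    proof -
      have "ennreal ((L2_norm M (a n - w))\<^sup>2) \<le> ennreal ((1/8) ^ j)"
        using close[OF that] L2_norm_nn_integral[of "a n - w" M] a wL2 by simp
      then have "(L2_norm M (a n - w))\<^sup>2 < e\<^sup>2" using j by simp
      then show ?thesis by (rule power2_less_imp_less[OF _ less_imp_le[OF e]])
    qed
    then show "\<exists>N. \<forall>n\<ge>N. dist (L2_norm M (a n - w)) 0 < e"
      by (auto simp: dist_real_def)
  qed
  then show ?thesis using wL2 by blast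
qed

section \<open>Linear choice of representatives\<close>

definition null :: "'a measure \<Rightarrow> ('a \<Rightarrow> real) set" where
  "null M = {u \<in> L2 M. AE x in M. u x = 0}"

lemma null_subspace: "subspace (null M)"
  unfolding null_def
  by (rule subspaceI) auto

text \<open>
  A linear map that sends square integrable functions to representatives of their classes: the complementary
  projection of a linear projection onto the null functions, which exists by extending a basis.
\<close>

definition rep :: "'a measure \<Rightarrow> ('a \<Rightarrow> real) \<Rightarrow> 'a \<Rightarrow> real" where
  "rep M = (SOME c. linear c \<and> (\<forall>u. u - c u \<in> null M) \<and> (\<forall>u\<in>null M. c u = 0))"

lemma rep_spec: "linear (rep M)" "u - rep M u \<in> null M" "u \<in> null M \<Longrightarrow> rep M u = 0"
proof -
  obtain p :: "('a \<Rightarrow> real) \<Rightarrow> 'a \<Rightarrow> real"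
    where p: "range p \<subseteq> null M" "linear p" "\<forall>u\<in>null M. p u = u"
    using linear_exists_left_inverse_on[OF linear_id null_subspace, of M] by auto
  have "linear (\<lambda>u. u - p u) \<and> (\<forall>u. u - (u - p u) \<in> null M) \<and> (\<forall>u\<in>null M. u - p u = 0)"
    using p by (auto intro: linear_compose_sub linear_ident)
  from someI[of "\<lambda>c. linear c \<and> (\<forall>u. u - c u \<in> null M) \<and> (\<forall>u\<in>null M. c u = 0)", OF this]
  show "linear (rep M)" "u - rep M u \<in> null M" "u \<in> null M \<Longrightarrow> rep M u = 0"
    unfolding rep_def by blast+
qed

lemma rep_add: "rep M (u + v) = rep M u + rep M v"
  and rep_diff: "rep M (u - v) = rep M u - rep M v"
  and rep_scale: "rep M (c *\<^sub>R u) = c *\<^sub>R rep M u"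
  and rep_uminus: "rep M (- u) = - rep M u"
  and rep_zero [simp]: "rep M 0 = 0"
  using linear_add linear_diff linear_scale linear_neg linear_0 rep_spec(1) by blast+

lemma rep_AE: "AE x in M. rep M u x = u x"
  using rep_spec(2)[of u M] unfolding null_def by auto

lemma rep_L2 [simp]: assumes "u \<in> L2 M" shows "rep M u \<in> L2 M"
proof -
  have "u - rep M u \<in> L2 M" using rep_spec(2)[of u M] by (simp add: null_def)
  from L2_diff[OF assms this] show ?thesis by simp
qed

lemma rep_eq_iff:
  assumes "u \<in> L2 M" "v \<in> L2 M" shows "rep M u = rep M v \<longleftrightarrow> (AE x in M. u x = v x)"
proof
  assume "rep M u = rep M v"
  then show "AE x in M. u x = v x"
    using rep_AE[of M u] rep_AE[of M v] by auto
next
  assume "AE x in M. u x = v x"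
  then have "u - v \<in> null M" using assms by (simp add: null_def)
  then show "rep M u = rep M v" using rep_spec(3)[of "u - v" M] by (simp add: rep_diff)
qed

lemma rep_rep [simp]: "rep M (rep M u) = rep M u"
  using rep_spec(3)[OF rep_spec(2)[of u M]] by (simp add: rep_diff)

text \<open>
  The Hilbert space \<open>L\<^sup>2\<close>, each class being represented by one function.
\<close>

definition Lspace :: "'a measure \<Rightarrow> ('a \<Rightarrow> real) set" where
  "Lspace M = rep M ` L2 M"

lemma rep_Lspace [simp]: "u \<in> L2 M \<Longrightarrow> rep M u \<in> Lspace M"
  by (simp add: Lspace_def)

lemma Lspace_L2: "u \<in> Lspace M \<Longrightarrow> u \<in> L2 M"
  by (auto simp: Lspace_def)

lemma rep_id [simp]: "u \<in> Lspace M \<Longrightarrow> rep M u = u"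
  by (auto simp: Lspace_def)

lemma Lspace_subspace: "subspace (Lspace M)"
  unfolding Lspace_def by (rule linear_subspace_image[OF rep_spec(1) L2_subspace])

lemma L2_inner_rep [simp]:
  assumes "u \<in> L2 M" "v \<in> L2 M" shows "L2_inner M (rep M u) (rep M v) = L2_inner M u v"
  using assms rep_AE by (intro L2_inner_cong) auto

lemma L2_norm_rep [simp]: "u \<in> L2 M \<Longrightarrow> L2_norm M (rep M u) = L2_norm M u"
  by (simp add: L2_norm_def)

lemma Lspace_hilbert: "hilbert_subspace (Lspace M) (L2_inner M)"
proof
  fix x y z :: "'a \<Rightarrow> real" and c :: real
  assume x: "x \<in> Lspace M"
  show "0 \<le> L2_inner M x x" by (simp add: L2_inner_def)
  show "x = 0" if "L2_inner M x x = 0"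
  proof -
    have "AE t in M. x t * x t = 0"
      using that L2_product_integrable[OF Lspace_L2[OF x] Lspace_L2[OF x]]
      by (subst integral_nonneg_eq_0_iff_AE[symmetric]) (auto simp: L2_inner_def)
    then have "rep M x = rep M 0"
      using Lspace_L2[OF x] by (subst rep_eq_iff) auto
    then show ?thesis using x by simp
  qed
  assume z: "z \<in> Lspace M"
  show "L2_inner M (c *\<^sub>R x) z = c * L2_inner M x z"
    by (simp add: L2_inner_def mult.assoc)
  show "L2_inner M x z = L2_inner M z x"
    by (simp add: L2_inner_def mult.commute)
  assume y: "y \<in> Lspace M"
  show "L2_inner M (x + y) z = L2_inner M x z + L2_inner M y z"
    using x y z by (simp add: L2_inner_def distrib_right L2_product_integrable Lspace_L2)
next
  fix a :: "nat \<Rightarrow> 'a \<Rightarrow> real"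
  assume a: "\<And>n. a n \<in> Lspace M"
    and Cauchy: "\<And>e. 0 < e \<Longrightarrow> \<exists>N. \<forall>m\<ge>N. \<forall>n\<ge>N. sqrt (L2_inner M (a m - a n) (a m - a n)) < e"
  obtain w where w: "w \<in> L2 M" "(\<lambda>n. L2_norm M (a n - w)) \<longlonglongrightarrow> 0"
    using L2_complete[of a M] a Cauchy Lspace_L2 unfolding L2_norm_def by blast
  have "L2_norm M (a n - rep M w) = L2_norm M (a n - w)" for n
    using L2_norm_rep[of "a n - w" M] a[of n] w(1) Lspace_L2[OF a[of n]] by (simp add: rep_diff)
  then show "\<exists>w\<in>Lspace M. (\<lambda>n. sqrt (L2_inner M (a n - w) (a n - w))) \<longlonglongrightarrow> 0"
    using w unfolding L2_norm_def by (intro bexI[of _ "rep M w"]) auto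
qed (rule Lspace_subspace)

section \<open>Semigroups on classes of functions\<close>

text \<open>
  In the concrete space the operator in this rule is a variable that unifies with every function application, so
  that the rule is applied by hand from here on.
\<close>

context hilbert_subspace
begin
declare lin_W [simp del, rule del]
end

interpretation H: hilbert_subspace "Lspace M" "L2_inner M" for M :: "'a measure"
  by (rule Lspace_hilbert)

lemma nrm_eq_L2_norm: "H.nrm M u = L2_norm M u"
  by (simp add: H.nrm_def L2_norm_def)

lemma nrm_rep_diff:
  assumes "u \<in> L2 M" "v \<in> L2 M"
  shows "H.nrm M (rep M u - rep M v) = L2_norm M (\<lambda>x. u x - v x)"
  using L2_norm_rep[OF L2_diff[OF assms]] unfolding nrm_eq_L2_norm rep_diff by (simp add: fun_diff_def)

lemma gen_cong:
  assumes "\<And>t w. 0 \<le> t \<Longrightarrow> w \<in> Lspace M \<Longrightarrow> S t w = S' t w"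
  shows "H.gen M S u f \<longleftrightarrow> H.gen M S' u f"
proof -
  have "((\<lambda>t. H.nrm M ((1/t) *\<^sub>R (S t u - u) - f)) \<longlongrightarrow> 0) (at_right 0)
      \<longleftrightarrow> ((\<lambda>t. H.nrm M ((1/t) *\<^sub>R (S' t u - u) - f)) \<longlongrightarrow> 0) (at_right 0)" if "u \<in> Lspace M"
    by (intro tendsto_cong eventually_at_rightI[of 0 1]) (use assms that in auto)
  then show ?thesis unfolding H.gen_def by blast
qed

context
  fixes M :: "'a measure" and T :: "real \<Rightarrow> ('a \<Rightarrow> real) \<Rightarrow> 'a \<Rightarrow> real"
  assumes T: "C0_semigroup M T"
begin

lemma semigroup_L2: "0 \<le> t \<Longrightarrow> u \<in> L2 M \<Longrightarrow> T t u \<in> L2 M"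
  using T by (simp add: C0_semigroup_def)

lemma semigroup_bounded: "0 \<le> t \<Longrightarrow> \<exists>C. \<forall>u\<in>L2 M. L2_norm M (T t u) \<le> C * L2_norm M u"
  using T by (simp add: C0_semigroup_def)

lemma rep_semigroup_add:
  assumes "0 \<le> t" "u \<in> L2 M" "v \<in> L2 M"
  shows "rep M (T t (u + v)) = rep M (T t u) + rep M (T t v)"
proof -
  have "AE x in M. T t (u + v) x = (T t u + T t v) x"
    using T assms by (simp add: C0_semigroup_def plus_fun_def)
  then show ?thesis
    using assms semigroup_L2 by (subst rep_add[symmetric], subst rep_eq_iff) auto
qed

lemma rep_semigroup_scale:
  assumes "0 \<le> t" "u \<in> L2 M"
  shows "rep M (T t (c *\<^sub>R u)) = c *\<^sub>R rep M (T t u)"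
proof -
  have "AE x in M. T t (c *\<^sub>R u) x = (c *\<^sub>R T t u) x"
    using T assms by (simp add: C0_semigroup_def scaleR_fun_def)
  then show ?thesis
    using assms semigroup_L2 by (subst rep_scale[symmetric], subst rep_eq_iff) auto
qed

text \<open>
  The operators of a semigroup respect equality almost everywhere, because they are additive and norm bounded.
\<close>

lemma rep_semigroup_rep:
  assumes t: "0 \<le> t" and u: "u \<in> L2 M"
  shows "rep M (T t (rep M u)) = rep M (T t u)"
proof -
  obtain C where C: "\<forall>u\<in>L2 M. L2_norm M (T t u) \<le> C * L2_norm M u"
    using semigroup_bounded[OF t] by (rule exE)
  let ?d = "rep M u - u"
  have d: "?d \<in> L2 M" using u by simp
  have "L2_norm M ?d = L2_norm M (rep M ?d)" using d by simp
  also have "\<dots> = 0" by (simp add: rep_diff L2_norm_def L2_inner_def)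
  finally have "L2_norm M (T t ?d) \<le> 0" using C d by fastforce
  then have "H.nrm M (rep M (T t ?d)) = 0"
    using L2_norm_nonneg[of M "T t ?d"] semigroup_L2[OF t d] by (simp add: nrm_eq_L2_norm)
  then have "rep M (T t ?d) = 0"
    using H.nrm_eq_0[of "rep M (T t ?d)" M] semigroup_L2[OF t d] by simp
  then show ?thesis
    using rep_semigroup_add[OF t d u] by simp
qed

lemma rep_semigroup_C0: "H.C0 M (\<lambda>t w. rep M (T t w))"
  unfolding H.C0_def
proof (intro conjI allI ballI impI)
  fix t :: real assume t: "0 \<le> t"
  show "H.lin M (\<lambda>w. rep M (T t w))"
    unfolding H.lin_def
    by (auto intro!: rep_semigroup_add[OF t] rep_semigroup_scale[OF t] rep_Lspace semigroup_L2[OF t] dest: Lspace_L2)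
  obtain C where C: "\<forall>u\<in>L2 M. L2_norm M (T t u) \<le> C * L2_norm M u"
    using semigroup_bounded[OF t] by (rule exE)
  have "L2_norm M (rep M (T t w)) \<le> C * L2_norm M w" if "w \<in> Lspace M" for w
    using C Lspace_L2[OF that] semigroup_L2[OF t Lspace_L2[OF that]] by simp
  then show "\<exists>C. H.bounded_by M C (\<lambda>w. rep M (T t w))"
    unfolding H.bounded_by_def nrm_eq_L2_norm by blast
next
  fix u assume u: "u \<in> Lspace M"
  have "AE x in M. T 0 u x = u x" using T Lspace_L2[OF u] by (simp add: C0_semigroup_def)
  then show "rep M (T 0 u) = u"
    using rep_eq_iff[of "T 0 u" M u] semigroup_L2[of 0 u] Lspace_L2[OF u] u by simp
next
  fix s t :: real and u assume st: "0 \<le> s" "0 \<le> t" and u: "u \<in> Lspace M"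
  have "AE x in M. T (s + t) u x = T s (T t u) x"
    using T st Lspace_L2[OF u] by (simp add: C0_semigroup_def)
  then have "rep M (T (s + t) u) = rep M (T s (T t u))"
    using st Lspace_L2[OF u] semigroup_L2 by (subst rep_eq_iff) auto
  also have "\<dots> = rep M (T s (rep M (T t u)))"
    using rep_semigroup_rep[OF st(1)] semigroup_L2[OF st(2) Lspace_L2[OF u]] by simp
  finally show "rep M (T (s + t) u) = rep M (T s (rep M (T t u)))" .
next
  fix u assume u: "u \<in> Lspace M"
  have eq: "L2_norm M (\<lambda>x. T t u x - u x) = H.nrm M (rep M (T t u) - u)" if "0 < t" for t
    using nrm_rep_diff[of "T t u" M u] semigroup_L2[of t u] that Lspace_L2[OF u] u by simp
  have "((\<lambda>t. L2_norm M (\<lambda>x. T t u x - u x)) \<longlongrightarrow> 0) (at_right 0)"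
    using T Lspace_L2[OF u] by (simp add: C0_semigroup_def)
  then show "((\<lambda>t. H.nrm M (rep M (T t u) - u)) \<longlongrightarrow> 0) (at_right 0)"
    by (rule Lim_transform_eventually) (intro eventually_at_rightI[of 0 1], use eq in auto)
qed

text \<open>
  Semigroups and generators of classes of functions are the ones of the space of representatives.
\<close>

lemma generator_iff:
  assumes u: "u \<in> L2 M" and f: "f \<in> L2 M"
  shows "generator M T u f \<longleftrightarrow> H.gen M (\<lambda>t w. rep M (T t w)) (rep M u) (rep M f)"
proof -
  have eq: "L2_norm M (\<lambda>x. (T t u x - u x) / t - f x)
      = H.nrm M ((1/t) *\<^sub>R (rep M (T t (rep M u)) - rep M u) - rep M f)" if t: "0 < t" for t
  proof -
    let ?q = "(1/t) *\<^sub>R (T t u - u) - f"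
    have "(\<lambda>x. (T t u x - u x) / t - f x) = ?q"
      by (rule ext) simp
    moreover have "?q \<in> L2 M"
      using u f t by (intro L2_diff L2_scale semigroup_L2) auto
    then have "L2_norm M (rep M ?q) = L2_norm M ?q" by (rule L2_norm_rep)
    moreover have "rep M ?q = (1/t) *\<^sub>R (rep M (T t (rep M u)) - rep M u) - rep M f"
      using rep_semigroup_rep[OF _ u, of t] t by (simp only: rep_diff rep_scale less_imp_le)
    ultimately show ?thesis
      by (simp only: nrm_eq_L2_norm)
  qed
  have "((\<lambda>t. L2_norm M (\<lambda>x. (T t u x - u x) / t - f x)) \<longlongrightarrow> 0) (at_right 0)
    \<longleftrightarrow> ((\<lambda>t. H.nrm M ((1/t) *\<^sub>R (rep M (T t (rep M u)) - rep M u) - rep M f)) \<longlongrightarrow> 0) (at_right 0)"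
    by (intro tendsto_cong eventually_at_rightI[of 0 1]) (use eq in auto)
  then show ?thesis
    using u f by (simp add: generator_def H.gen_def)
qed

end

lemma C0_semigroup_from_C0:
  assumes S: "H.C0 M S"
  shows "C0_semigroup M (\<lambda>t u. S t (rep M u))"
proof -
  note lin = H.C0_lin[OF S]
  have SW [simp]: "S t (rep M u) \<in> Lspace M" if "0 \<le> t" "u \<in> L2 M" for t u
    by (rule H.lin_W[OF lin[OF that(1)] rep_Lspace[OF that(2)]])
  note SL [simp] = Lspace_L2[OF SW]
  have "((\<lambda>t. L2_norm M (\<lambda>x. S t (rep M u) x - u x)) \<longlongrightarrow> 0) (at_right 0)" if u: "u \<in> L2 M" for u
  proof -
    have lim: "((\<lambda>t. H.nrm M (S t (rep M u) - rep M u)) \<longlongrightarrow> 0) (at_right 0)"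
      using S u by (simp add: H.C0_def)
    have eq: "H.nrm M (S t (rep M u) - rep M u) = L2_norm M (\<lambda>x. S t (rep M u) x - u x)" if "0 < t" for t
      using nrm_rep_diff[of "S t (rep M u)" M u] u that by simp
    show ?thesis
      by (rule Lim_transform_eventually[OF lim]) (intro eventually_at_rightI[of 0 1], use eq in auto)
  qed
  moreover have "\<exists>C. \<forall>u\<in>L2 M. L2_norm M (S t (rep M u)) \<le> C * L2_norm M u" if t: "0 \<le> t" for t
  proof -
    obtain C where "H.bounded_by M C (S t)" using H.C0_bounded[OF S t] by blast
    from H.bounded_byD[OF this rep_Lspace] show ?thesis by (auto simp: nrm_eq_L2_norm)
  qed
  moreover have "S t (rep M (\<lambda>y. u y + v y)) x = S t (rep M u) x + S t (rep M v) x"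
    if "0 \<le> t" "u \<in> L2 M" "v \<in> L2 M" for t u v x
    using H.lin_add[OF lin[OF that(1)], of "rep M u" "rep M v"] that rep_add[of M u v]
    by (simp add: plus_fun_def)
  moreover have "S t (rep M (\<lambda>y. c * u y)) x = c * S t (rep M u) x"
    if "0 \<le> t" "u \<in> L2 M" for t u c x
    using H.lin_scale[OF lin[OF that(1)], of "rep M u" c] that rep_scale[of M c u]
    by (simp add: scaleR_fun_def)
  moreover have "AE x in M. S 0 (rep M u) x = u x" if "u \<in> L2 M" for u
    using H.C0_zero[OF S, of "rep M u"] that rep_AE[of M u] by simp
  moreover have "S (s + t) (rep M u) = S s (rep M (S t (rep M u)))" if "0 \<le> s" "0 \<le> t" "u \<in> L2 M" for s t u
    using H.C0_plus[OF S that(1,2), of "rep M u"] that by simp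
  ultimately show ?thesis
    unfolding C0_semigroup_def by simp
qed

section \<open>The operator of a closed form\<close>

locale closed_L2_form =
  fixes M :: "'a measure" and E :: "'a qform"
  assumes quadratic: "nonneg_quadratic_form M E"
    and dense: "densely_defined M E"
    and closed: "closed_form M E"
begin

abbreviation D :: "('a \<Rightarrow> real) set" where "D \<equiv> qdom E \<inter> Lspace M"

lemma qdom_L2: "u \<in> qdom E \<Longrightarrow> u \<in> L2 M"
  and qdom_add: "u \<in> qdom E \<Longrightarrow> v \<in> qdom E \<Longrightarrow> u + v \<in> qdom E"
  and qdom_scale: "u \<in> qdom E \<Longrightarrow> c *\<^sub>R u \<in> qdom E"
  and qdom_zero: "0 \<in> qdom E"
  and qval_scale: "u \<in> qdom E \<Longrightarrow> qval E (c *\<^sub>R u) = c\<^sup>2 * qval E u"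
  and qval_nonneg: "u \<in> qdom E \<Longrightarrow> 0 \<le> qval E u"
  and polar_add: "u \<in> qdom E \<Longrightarrow> v \<in> qdom E \<Longrightarrow> w \<in> qdom E \<Longrightarrow>
    polar E (u + v) w = polar E u w + polar E v w"
  and polar_scale: "u \<in> qdom E \<Longrightarrow> w \<in> qdom E \<Longrightarrow> polar E (c *\<^sub>R u) w = c * polar E u w"
  using quadratic
  unfolding nonneg_quadratic_form_def plus_fun_def scaleR_fun_def zero_fun_def real_scaleR_def by blast+

lemma qdom_cong:
  assumes "u \<in> qdom E" "v \<in> L2 M" "AE x in M. u x = v x"
  shows "v \<in> qdom E" "qval E v = qval E u"
  using quadratic assms unfolding nonneg_quadratic_form_def by blast+

lemma qdom_diff: "u \<in> qdom E \<Longrightarrow> v \<in> qdom E \<Longrightarrow> u - v \<in> qdom E"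
  using qdom_add[of u "-1 *\<^sub>R v"] qdom_scale[of v "-1"] by simp

lemma polar_eq: "polar E u v = (qval E (u + v) - qval E (u - v)) / 4"
  by (simp add: polar_def plus_fun_def fun_diff_def)

lemma polar_commute: "u \<in> qdom E \<Longrightarrow> v \<in> qdom E \<Longrightarrow> polar E u v = polar E v u"
  using qval_scale[of "u - v" "-1"] qdom_diff[of u v] by (simp add: polar_eq add.commute)

lemma polar_self: "u \<in> qdom E \<Longrightarrow> polar E u u = qval E u"
  using qval_scale[of u 2] qval_scale[of u 0] by (simp add: polar_eq flip: scaleR_2)

lemma polar_diff:
  assumes "u \<in> qdom E" "v \<in> qdom E" "w \<in> qdom E"
  shows "polar E (u - v) w = polar E u w - polar E v w"
  using polar_add[of u "-1 *\<^sub>R v" w] polar_scale[of v w "-1"] qdom_scale[of v "-1"] assms by simp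

text \<open>
  This is \<open>0 \<le> \<E>[u - v/2]\<close>.
\<close>

lemma polar_le:
  assumes u: "u \<in> qdom E" and v: "v \<in> qdom E"
  shows "polar E u v \<le> polar E u u + qval E v / 4"
proof -
  define z where "z = (1/2) *\<^sub>R v"
  have z: "z \<in> qdom E" "u - z \<in> qdom E" using u v by (auto simp: z_def intro!: qdom_diff qdom_scale)
  have "qval E (u - z) = polar E u (u - z) - polar E z (u - z)"
    using polar_self[OF z(2)] polar_diff[OF u z] by simp
  also have "\<dots> = (polar E u u - polar E z u) - (polar E u z - polar E z z)"
    using polar_commute[OF u z(2)] polar_commute[OF z] polar_diff[OF u z(1) u] polar_diff[OF u z(1) z(1)]
    by simp
  also have "polar E z u = polar E u v / 2"
    using polar_scale[OF v u, of "1/2"] polar_commute[OF u v] by (simp add: z_def)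
  also have "polar E u z = polar E u v / 2"
    using polar_scale[OF v u, of "1/2"] polar_commute[OF u v] polar_commute[OF u z(1)] by (simp add: z_def)
  also have "polar E z z = qval E v / 4"
    using polar_self[OF z(1)] qval_scale[OF v, of "1/2"] by (simp add: z_def power2_eq_square)
  finally show ?thesis using qval_nonneg[OF z(2)] by linarith
qed

lemma polar_cong:
  assumes "u \<in> qdom E" "v \<in> qdom E" "u' \<in> qdom E" "v' \<in> qdom E"
    "AE x in M. u x = u' x" "AE x in M. v x = v' x"
  shows "polar E u v = polar E u' v'"
proof -
  have "qval E (u' + v') = qval E (u + v)" "qval E (u' - v') = qval E (u - v)"
    using assms by (auto intro!: qdom_cong qdom_add qdom_diff qdom_L2)
  then show ?thesis by (simp add: polar_eq)
qed

lemma rep_qdom: "u \<in> qdom E \<Longrightarrow> rep M u \<in> D"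
proof -
  assume u: "u \<in> qdom E"
  have "AE x in M. u x = rep M u x"
    using rep_AE[of M u] by eventually_elim simp
  then show ?thesis
    using qdom_cong(1)[OF u] qdom_L2[OF u] by simp
qed

lemma rep_qdom_iff: assumes "u \<in> L2 M" shows "rep M u \<in> qdom E \<longleftrightarrow> u \<in> qdom E"
proof
  assume "rep M u \<in> qdom E"
  then show "u \<in> qdom E" using qdom_cong(1)[OF _ assms rep_AE] by blast
qed (use rep_qdom in blast)

lemma form_operator_Lspace_iff:
  assumes "u \<in> Lspace M" "f \<in> Lspace M"
  shows "form_operator M E u f \<longleftrightarrow> u \<in> D \<and> (\<forall>v\<in>D. polar E u v = L2_inner M f v)"
proof -
  have "polar E u v = L2_inner M f v"
    if u: "u \<in> qdom E" and v: "v \<in> qdom E" and "\<forall>v\<in>D. polar E u v = L2_inner M f v" for v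
  proof -
    have "polar E u v = polar E u (rep M v)"
      using u v rep_qdom[OF v] rep_AE[of M v] by (intro polar_cong) auto
    also have "\<dots> = L2_inner M f (rep M v)" using that rep_qdom[OF v] by blast
    also have "\<dots> = L2_inner M f v"
      using L2_inner_rep[OF Lspace_L2[OF assms(2)] qdom_L2[OF v]] assms(2) by simp
    finally show ?thesis .
  qed
  then show ?thesis
    using assms Lspace_L2 unfolding form_operator_def by blast
qed

lemma form_operator_rep:
  "form_operator M E u f \<longleftrightarrow> u \<in> L2 M \<and> f \<in> L2 M \<and> form_operator M E (rep M u) (rep M f)"
proof (cases "u \<in> L2 M \<and> f \<in> L2 M")
  case True
  then have L: "u \<in> L2 M" "f \<in> L2 M" by auto
  have "polar E (rep M u) v = polar E u v" "L2_inner M (rep M f) v = L2_inner M f v"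
    if "u \<in> qdom E" "v \<in> qdom E" for v
    using that rep_qdom[OF that(1)] L rep_AE[of M] qdom_L2
    by (auto intro!: polar_cong L2_inner_cong)
  then show ?thesis
    using L rep_qdom_iff[OF L(1)] unfolding form_operator_def by auto
qed (auto simp: form_operator_def qdom_L2)

definition op :: "('a \<Rightarrow> real) \<Rightarrow> ('a \<Rightarrow> real) \<Rightarrow> bool" where
  "op u f \<longleftrightarrow> u \<in> Lspace M \<and> f \<in> Lspace M \<and> form_operator M E u f"

lemma op_iff: "op u f \<longleftrightarrow> u \<in> D \<and> f \<in> Lspace M \<and> (\<forall>v\<in>D. polar E u v = L2_inner M f v)"
  unfolding op_def using form_operator_Lspace_iff by blast

lemma form_operator_iff_op: "form_operator M E u f \<longleftrightarrow> u \<in> L2 M \<and> f \<in> L2 M \<and> op (rep M u) (rep M f)"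
  unfolding op_def by (subst form_operator_rep) auto

lemma D_closed: "u \<in> D \<Longrightarrow> v \<in> D \<Longrightarrow> u + v \<in> D" "u \<in> D \<Longrightarrow> v \<in> D \<Longrightarrow> u - v \<in> D"
    "u \<in> D \<Longrightarrow> c *\<^sub>R u \<in> D"
  using qdom_add qdom_diff qdom_scale by auto

definition shifted :: "real \<Rightarrow> ('a \<Rightarrow> real) \<Rightarrow> ('a \<Rightarrow> real) \<Rightarrow> real" where
  "shifted h u v = L2_inner M u v + h * polar E u v"

lemma shifted_self:
  "u \<in> D \<Longrightarrow> shifted h u u = (L2_norm M u)\<^sup>2 + h * qval E u"
  by (simp add: shifted_def polar_self nrm_eq_L2_norm[symmetric] H.nrm_sq)

text \<open>
  Closedness of the form is completeness of its domain under the inner product \<open>(u, v) + h \<E>(u, v)\<close>.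
\<close>

lemma form_hilbert:
  assumes h: "0 < h" shows "hilbert_subspace D (shifted h)"
proof
  show "subspace D"
    using D_closed qdom_zero by (intro subspaceI) auto
  fix x y z :: "'a \<Rightarrow> real" and c :: real
  assume x: "x \<in> D"
  show nonneg: "0 \<le> shifted h x x"
    using x h qval_nonneg[of x] by (simp add: shifted_self)
  show "x = 0" if "shifted h x x = 0"
  proof -
    have "L2_norm M x = 0"
      using that x h qval_nonneg[of x] by (simp add: shifted_self add_nonneg_eq_0_iff)
    then show ?thesis using H.nrm_eq_0[of x M] x by (simp add: nrm_eq_L2_norm)
  qed
  assume z: "z \<in> D"
  show "shifted h (c *\<^sub>R x) z = c * shifted h x z"
    using x z by (simp add: shifted_def H.ip_scale_left polar_scale algebra_simps)
  show "shifted h x z = shifted h z x"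
    using x z H.ip_commute[of x M z] polar_commute[of x z] by (simp add: shifted_def)
  assume y: "y \<in> D"
  show "shifted h (x + y) z = shifted h x z + shifted h y z"
    using x y z by (simp add: shifted_def H.ip_add_left polar_add algebra_simps)
next
  fix a :: "nat \<Rightarrow> 'a \<Rightarrow> real"
  assume a: "\<And>n. a n \<in> D"
    and Cauchy: "\<And>e. 0 < e \<Longrightarrow> \<exists>N. \<forall>m\<ge>N. \<forall>n\<ge>N. sqrt (shifted h (a m - a n) (a m - a n)) < e"
  have diff: "a m - a n \<in> D" for m n using D_closed(2)[OF a a] .
  have L2_le: "L2_norm M u \<le> sqrt (shifted h u u)" if "u \<in> D" for u
    using that h qval_nonneg[of u] by (intro real_le_rsqrt) (simp add: shifted_self)
  have q_le: "h * qval E u \<le> (sqrt (shifted h u u))\<^sup>2" if "u \<in> D" for u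
    using that h qval_nonneg[of u] by (simp add: shifted_self)
  have "\<exists>N. \<forall>m\<ge>N. \<forall>n\<ge>N. H.nrm M (a m - a n) < e" if "0 < e" for e
    using Cauchy[OF that] L2_le[OF diff] unfolding nrm_eq_L2_norm by (meson le_less_trans)
  then obtain w where w: "w \<in> Lspace M" "H.conv M a w"
    using H.Cauchy_conv[of a M] a by blast
  have "\<exists>N. \<forall>m\<ge>N. \<forall>n\<ge>N. qval E (\<lambda>x. a m x - a n x) < e" if e: "0 < e" for e
  proof -
    obtain N where N: "\<forall>m\<ge>N. \<forall>n\<ge>N. sqrt (shifted h (a m - a n) (a m - a n)) < sqrt (h * e)"
      using Cauchy[of "sqrt (h * e)"] e h by auto
    have "qval E (\<lambda>x. a m x - a n x) < e" if "N \<le> m" "N \<le> n" for m n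
    proof -
      have "shifted h (a m - a n) (a m - a n) < h * e" using N that by auto
      then have "h * qval E (a m - a n) < h * e"
        using shifted_self[OF diff[of m n], of h] zero_le_power2[of "L2_norm M (a m - a n)"]
        by linarith
      then show ?thesis using h by (simp add: fun_diff_def)
    qed
    then show ?thesis by blast
  qed
  moreover have "(\<lambda>n. L2_norm M (\<lambda>x. a n x - w x)) \<longlonglongrightarrow> 0"
    using w(2) by (simp add: H.conv_def nrm_eq_L2_norm fun_diff_def)
  ultimately have wq: "w \<in> qdom E" "(\<lambda>n. qval E (\<lambda>x. a n x - w x)) \<longlonglongrightarrow> 0"
    using closed a Lspace_L2[OF w(1)] unfolding closed_form_def by blast+
  then have wD: "w \<in> D" using w(1) by blast
  have "(\<lambda>n. sqrt ((L2_norm M (a n - w))\<^sup>2 + h * qval E (a n - w))) \<longlonglongrightarrow> sqrt (0\<^sup>2 + h * 0)"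
    using w(2) wq(2) unfolding H.conv_def nrm_eq_L2_norm
    by (intro tendsto_intros) (auto simp: fun_diff_def)
  then have "(\<lambda>n. sqrt (shifted h (a n - w) (a n - w))) \<longlonglongrightarrow> 0"
    using shifted_self[OF D_closed(2)[OF a wD]] by simp
  then show "\<exists>w\<in>D. (\<lambda>n. sqrt (shifted h (a n - w) (a n - w))) \<longlonglongrightarrow> 0"
    using wD by blast
qed

text \<open>
  The equation \<open>(1 + h L) u = g\<close> in weak form says that \<open>u\<close> represents the functional \<open>v \<mapsto> (g, v)\<close> in the
  form domain.
\<close>

lemma op_range:
  assumes h: "0 < h" and g: "g \<in> Lspace M"
  obtains u f where "op u f" "u + h *\<^sub>R f = g"
proof -
  interpret F: hilbert_subspace D "shifted h" by (rule form_hilbert[OF h])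
  obtain u where u: "u \<in> D" "\<And>v. v \<in> D \<Longrightarrow> shifted h u v = L2_inner M g v"
  proof (rule F.Riesz_representation[of "L2_inner M g" "L2_norm M g"])
    fix u assume u: "u \<in> D"
    have "L2_norm M u \<le> F.nrm u"
      unfolding F.nrm_def using u h qval_nonneg[of u] by (intro real_le_rsqrt) (simp add: shifted_self)
    then show "\<bar>L2_inner M g u\<bar> \<le> L2_norm M g * F.nrm u"
      using H.Cauchy_Schwarz[OF g, of u] u
      by (metis IntD2 L2_norm_nonneg mult_left_mono nrm_eq_L2_norm order_trans)
  qed (use g in \<open>auto simp: H.ip_add_right H.ip_scale_right\<close>)
  define f where "f = (1/h) *\<^sub>R (g - u)"
  have f: "f \<in> Lspace M" using u g by (auto simp: f_def)
  have "polar E u v = L2_inner M f v" if "v \<in> D" for v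
    using u(2)[OF that] u(1) that g h by (simp add: shifted_def f_def H.ip_linear field_simps)
  then have "op u f" using u(1) f by (simp add: op_iff)
  then show thesis using that[of u f] h by (simp add: f_def)
qed

text \<open>
  Only density of the domain is not immediate. For \<open>v\<close> in the form domain and \<open>w = (1 + h L)\<^sup>-\<^sup>1 v\<close> one has
  \<open>\<parallel>w - v\<parallel>\<^sup>2 = h (\<E>(w, v) - \<E>(w, w)) \<le> h \<E>[v] / 4\<close>, which is small with \<open>h\<close>.
\<close>

sublocale selfadjoint_operator "Lspace M" "L2_inner M" op
proof
  fix u f v g assume u: "op u f" and v: "op v g"
  have f: "f \<in> Lspace M" and g: "g \<in> Lspace M" using u v by (auto simp: op_iff)
  show "op (u + v) (f + g)"
    using u v D_closed(1)[of u v] unfolding op_iff by (simp add: polar_add H.ip_add_left)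
  show "L2_inner M f v = L2_inner M u g"
    using u v polar_commute[of u v] H.ip_commute[of u M g] f g unfolding op_iff by simp
next
  fix u f and c :: real assume u: "op u f"
  show "u \<in> Lspace M \<and> f \<in> Lspace M" using u by (simp add: op_def)
  show "op (c *\<^sub>R u) (c *\<^sub>R f)"
    using u D_closed(3)[of u c] unfolding op_iff by (simp add: polar_scale H.ip_scale_left)
  show "0 \<le> L2_inner M f u"
    using u polar_self[of u] qval_nonneg[of u] unfolding op_iff by auto
next
  fix h :: real and g assume "0 < h" "g \<in> Lspace M"
  then show "\<exists>u f. op u f \<and> u + h *\<^sub>R f = g" using op_range by blast
next
  fix u and e :: real assume u: "u \<in> Lspace M" and e: "0 < e"
  obtain v' where v': "v' \<in> qdom E" "L2_norm M (\<lambda>x. u x - v' x) < e / 2"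
    using dense Lspace_L2[OF u] e unfolding densely_defined_def by (meson half_gt_zero)
  define v where "v = rep M v'"
  have v: "v \<in> D" using rep_qdom[OF v'(1)] by (simp add: v_def)
  have uv: "H.nrm M (u - v) < e / 2"
    using v'(2) nrm_rep_diff[OF Lspace_L2[OF u] qdom_L2[OF v'(1)]] u by (simp add: v_def)
  define h where "h = e\<^sup>2 / (qval E v + 1)"
  have q: "0 \<le> qval E v" using qval_nonneg v by blast
  have h: "0 < h" "h * qval E v < e\<^sup>2" using e q by (auto simp: h_def field_simps)
  obtain w f where w: "op w f" "w + h *\<^sub>R f = v" using op_range[OF h(1)] v by blast
  have wD: "w \<in> D" "f \<in> Lspace M" using w(1) by (auto simp: op_iff)
  have wv: "w - v = - (h *\<^sub>R f)" using w(2) by (simp add: algebra_simps flip: w(2))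
  have "(H.nrm M (w - v))\<^sup>2 = L2_inner M (w - v) (w - v)"
    using wD v by (intro H.nrm_sq) auto
  also have "\<dots> = L2_inner M (- (h *\<^sub>R f)) (w - v)" using wv by simp
  also have "\<dots> = - (h * L2_inner M f (w - v))"
    using wD v by (simp only: H.ip_minus_left H.ip_scale_left H.W_scale H.W_diff Int_iff)
  also have "L2_inner M f (w - v) = polar E w w - polar E w v"
    using w(1) wD v by (simp add: H.ip_diff_right op_iff)
  also have "- (h * (polar E w w - polar E w v)) \<le> h * (qval E v / 4)"
  proof -
    have "polar E w v - polar E w w \<le> qval E v / 4"
      using polar_le[of w v] wD v by simp
    from mult_left_mono[OF this less_imp_le[OF h(1)]] show ?thesis
      by (simp add: algebra_simps)
  qed
  also have "\<dots> < (e / 2)\<^sup>2" using h(2) by (simp add: power_divide)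
  finally have "H.nrm M (w - v) < e / 2"
    by (rule power2_less_imp_less) (use e in simp)
  then have "H.nrm M (u - w) < e"
    using uv H.nrm_diff_triangle[of u M v w] H.nrm_diff_commute[of v M w] u v wD by simp
  then show "\<exists>w f. op w f \<and> H.nrm M (u - w) < e" using w(1) by blast
qed

end

section \<open>Multiplication by an indicator function\<close>

definition cut :: "'a measure \<Rightarrow> 'a set \<Rightarrow> ('a \<Rightarrow> real) \<Rightarrow> 'a \<Rightarrow> real" where
  "cut M Y u = rep M (\<lambda>x. indicator Y x * u x)"

lemma indicator_mult_L2:
  assumes "Y \<in> sets M" "u \<in> L2 M" shows "(\<lambda>x. indicator Y x * u x) \<in> L2 M"
proof (rule L2_I_bound)
  show "(\<lambda>x. indicator Y x * u x) \<in> borel_measurable M"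
    using assms by (intro borel_measurable_times borel_measurable_indicator L2_measurable)
  show "(indicator Y x * u x)\<^sup>2 \<le> (u x)\<^sup>2" for x
    by (simp add: indicator_def)
qed (rule L2_square_integrable[OF assms(2)])

lemma cut_rep:
  assumes "Y \<in> sets M" "u \<in> L2 M" shows "cut M Y (rep M u) = cut M Y u"
proof -
  have "AE x in M. indicator Y x * rep M u x = indicator Y x * u x"
    using rep_AE[of M u] by eventually_elim simp
  then show ?thesis
    unfolding cut_def using assms by (subst rep_eq_iff) (auto intro: indicator_mult_L2)
qed

lemma cut_lin: assumes "Y \<in> sets M" shows "H.lin M (cut M Y)"
  unfolding H.lin_def
proof (intro conjI ballI allI)
  fix u v :: "'a \<Rightarrow> real" and c :: real
  assume u: "u \<in> Lspace M"
  show "cut M Y u \<in> Lspace M"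
    unfolding cut_def using assms u by (intro rep_Lspace indicator_mult_L2 Lspace_L2)
  have "(\<lambda>x. indicator Y x * (c *\<^sub>R u) x) = c *\<^sub>R (\<lambda>x. indicator Y x * u x)"
    by (rule ext) simp
  then show "cut M Y (c *\<^sub>R u) = c *\<^sub>R cut M Y u"
    unfolding cut_def rep_scale[symmetric] by simp
  have "(\<lambda>x. indicator Y x * (u + v) x) = (\<lambda>x. indicator Y x * u x) + (\<lambda>x. indicator Y x * v x)"
    by (rule ext) (simp add: algebra_simps)
  then show "cut M Y (u + v) = cut M Y u + cut M Y v"
    unfolding cut_def rep_add[symmetric] by simp
qed

lemma L2_inner_cut:
  assumes "Y \<in> sets M" "u \<in> Lspace M" "v \<in> Lspace M"
  shows "L2_inner M (cut M Y u) v = (\<integral>x. indicator Y x * (u x * v x) \<partial>M)"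
proof -
  have "L2_inner M (cut M Y u) v = L2_inner M (\<lambda>x. indicator Y x * u x) v"
    unfolding cut_def
    using L2_inner_rep[OF indicator_mult_L2[OF assms(1) Lspace_L2[OF assms(2)]] Lspace_L2[OF assms(3)]] assms(3)
    by simp
  then show ?thesis by (simp add: L2_inner_def mult.assoc)
qed

lemma cut_symm: assumes "Y \<in> sets M" shows "H.symm M (cut M Y)"
  unfolding H.symm_def
proof (intro ballI)
  fix u v assume uv: "u \<in> Lspace M" "v \<in> Lspace M"
  have "L2_inner M (cut M Y u) v = L2_inner M (cut M Y v) u"
    using uv assms by (simp add: L2_inner_cut mult.commute)
  also have "\<dots> = L2_inner M u (cut M Y v)"
    using H.lin_W[OF cut_lin[OF assms] uv(2)] uv(1) by (rule H.ip_commute)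
  finally show "L2_inner M (cut M Y u) v = L2_inner M u (cut M Y v)" .
qed

lemma cut_contraction: assumes "Y \<in> sets M" shows "H.bounded_by M 1 (cut M Y)"
  unfolding H.bounded_by_def
proof
  fix u assume u: "u \<in> Lspace M"
  note L = Lspace_L2[OF u] indicator_mult_L2[OF assms Lspace_L2[OF u]]
  have "L2_inner M (\<lambda>x. indicator Y x * u x) (\<lambda>x. indicator Y x * u x) \<le> L2_inner M u u"
    unfolding L2_inner_def
    by (intro integral_mono L2_product_integrable L) (auto simp: indicator_def)
  then have "L2_norm M (\<lambda>x. indicator Y x * u x) \<le> L2_norm M u"
    unfolding L2_norm_def by (rule real_sqrt_le_mono)
  then show "H.nrm M (cut M Y u) \<le> 1 * H.nrm M u"
    unfolding nrm_eq_L2_norm cut_def using L2_norm_rep[OF L(2)] by simp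
qed

section \<open>Invariance as reduction of the operator\<close>

context closed_L2_form
begin

text \<open>
  The semigroup constructed from the resolvents satisfies the specification, so the chosen one does.
\<close>

theorem form_semigroup_spec:
  "C0_semigroup M (form_semigroup M E) \<and>
   (\<forall>u f. generator M (form_semigroup M E) u (\<lambda>x. - f x) \<longleftrightarrow> form_operator M E u f)"
proof -
  let ?T = "\<lambda>t u. S t (rep M u)"
  have T: "C0_semigroup M ?T" by (rule C0_semigroup_from_C0[OF C0_S])
  have "generator M ?T u (\<lambda>x. - f x) \<longleftrightarrow> form_operator M E u f" for u f
  proof (cases "u \<in> L2 M \<and> f \<in> L2 M")
    case True
    then have L: "u \<in> L2 M" "f \<in> L2 M" by auto
    have "generator M ?T u (- f) \<longleftrightarrow> H.gen M (\<lambda>t w. rep M (S t (rep M w))) (rep M u) (rep M (- f))"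
      using generator_iff[OF T L(1) L2_uminus[OF L(2)]] .
    also have "\<dots> \<longleftrightarrow> H.gen M S (rep M u) (- rep M f)"
      unfolding rep_uminus by (rule gen_cong) simp
    also have "\<dots> \<longleftrightarrow> form_operator M E u f"
      using gen_S[of "rep M u" "rep M f"] form_operator_iff_op[of u f] L by simp
    finally show ?thesis by (simp add: fun_Compl_def)
  next
    case False
    have "f \<in> L2 M" if "(\<lambda>x. - f x) \<in> L2 M"
      using L2_uminus[OF that] by (simp add: fun_Compl_def)
    then show ?thesis
      using False form_operator_iff_op[of u f] unfolding generator_def by blast
  qed
  with T have "C0_semigroup M ?T \<and> (\<forall>u f. generator M ?T u (\<lambda>x. - f x) \<longleftrightarrow> form_operator M E u f)"
    by blast
  from someI[of "\<lambda>T. C0_semigroup M T \<and> (\<forall>u f. generator M T u (\<lambda>x. - f x) \<longleftrightarrow> form_operator M E u f)", OF this]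
  show ?thesis unfolding form_semigroup_def .
qed

lemma form_semigroup_L2:
  "0 \<le> t \<Longrightarrow> u \<in> L2 M \<Longrightarrow> form_semigroup M E t u \<in> L2 M"
  using semigroup_L2 form_semigroup_spec by blast

lemma rep_form_semigroup:
  assumes t: "0 \<le> t" and u: "u \<in> L2 M"
  shows "rep M (form_semigroup M E t u) = S t (rep M u)"
proof -
  let ?T = "form_semigroup M E"
  have T: "C0_semigroup M ?T" using form_semigroup_spec by blast
  have gen: "H.gen M (\<lambda>t w. rep M (?T t w)) v (- f) \<longleftrightarrow> op v f" for v f
  proof (cases "v \<in> Lspace M \<and> f \<in> Lspace M")
    case True
    then have W: "v \<in> Lspace M" "f \<in> Lspace M" by auto
    note L = W[THEN Lspace_L2]
    have "H.gen M (\<lambda>t w. rep M (?T t w)) v (- f) \<longleftrightarrow> generator M ?T v (- f)"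
      using generator_iff[OF T L(1) L2_uminus[OF L(2)]] W by (simp add: rep_uminus)
    also have "\<dots> \<longleftrightarrow> form_operator M E v f"
      using form_semigroup_spec by (simp add: fun_Compl_def)
    finally show ?thesis unfolding op_def using W by simp
  next
    case False
    have "f \<in> Lspace M" if "- f \<in> Lspace M"
      using H.W_minus[OF that] by simp
    then have "\<not> H.gen M (\<lambda>t w. rep M (?T t w)) v (- f)"
      using False H.gen_W[of M "\<lambda>t w. rep M (?T t w)" v "- f"] by metis
    moreover have "\<not> op v f" using False unfolding op_def by blast
    ultimately show ?thesis by simp
  qed
  have "rep M (?T t u) = rep M (?T t (rep M u))"
    using rep_semigroup_rep[OF T t u] by simp
  also have "\<dots> = S t (rep M u)"
    by (rule C0_unique[OF rep_semigroup_C0[OF T] gen t rep_Lspace[OF u]])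
  finally show ?thesis .
qed

lemma invariant_at_iff:
  assumes Y: "Y \<in> sets M" and s: "0 < s"
  shows "(\<forall>u\<in>L2 M. AE x in M. form_semigroup M E s (\<lambda>y. indicator Y y * u y) x
      = indicator Y x * form_semigroup M E s u x) \<longleftrightarrow> commute (cut M Y) (S s)"
proof -
  have s0: "0 \<le> s" using s by simp
  have eq: "(AE x in M. form_semigroup M E s (\<lambda>y. indicator Y y * u y) x
      = indicator Y x * form_semigroup M E s u x) \<longleftrightarrow> S s (cut M Y (rep M u)) = cut M Y (S s (rep M u))"
    if u: "u \<in> L2 M" for u
  proof -
    note L = indicator_mult_L2[OF Y u] form_semigroup_L2[OF s0 u]
    have "rep M (form_semigroup M E s (\<lambda>y. indicator Y y * u y)) = S s (cut M Y (rep M u))"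
      using rep_form_semigroup[OF s0 L(1)] cut_rep[OF Y u] by (simp add: cut_def)
    moreover have "rep M (\<lambda>x. indicator Y x * form_semigroup M E s u x) = cut M Y (S s (rep M u))"
      using rep_form_semigroup[OF s0 u] cut_rep[OF Y L(2)] by (simp add: cut_def)
    moreover note rep_eq_iff[OF form_semigroup_L2[OF s0 L(1)] indicator_mult_L2[OF Y L(2)]]
    ultimately show ?thesis by simp
  qed
  have "(\<forall>u\<in>L2 M. S s (cut M Y (rep M u)) = cut M Y (S s (rep M u))) \<longleftrightarrow> commute (cut M Y) (S s)"
  proof
    assume "\<forall>u\<in>L2 M. S s (cut M Y (rep M u)) = cut M Y (S s (rep M u))"
    then show "commute (cut M Y) (S s)"
      unfolding commute_def by (metis Lspace_L2 rep_id)
  next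
    assume com: "commute (cut M Y) (S s)"
    show "\<forall>u\<in>L2 M. S s (cut M Y (rep M u)) = cut M Y (S s (rep M u))"
      using commuteD[OF com rep_Lspace] by simp
  qed
  then show ?thesis using eq by simp
qed

text \<open>
  The definition of invariance asks for commutation at some time, and this is equivalent to commutation at every time.
\<close>

theorem form_invariant_iff_op:
  assumes Y: "Y \<in> sets M"
  shows "form_invariant M E Y \<longleftrightarrow> (\<forall>u f. op u f \<longrightarrow> op (cut M Y u) (cut M Y f))"
proof -
  have "form_invariant M E Y \<longleftrightarrow> (\<exists>s>0. commute (cut M Y) (S s))"
    unfolding form_invariant_def by (rule ex_cong1, rule conj_cong[OF refl], rule invariant_at_iff[OF Y])
  also have "\<dots> \<longleftrightarrow> (\<forall>u f. op u f \<longrightarrow> op (cut M Y u) (cut M Y f))"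
    using commute_S_iff[OF cut_lin[OF Y] cut_contraction[OF Y] cut_symm[OF Y]] zero_less_one by blast
  finally show ?thesis .
qed

lemma form_invariant_iff_commute:
  assumes "Y \<in> sets M" "0 < s"
  shows "form_invariant M E Y \<longleftrightarrow> commute (cut M Y) (S s)"
  unfolding form_invariant_iff_op[OF assms(1)]
  using commute_S_iff[OF cut_lin cut_contraction cut_symm, OF assms(1,1,1,2)] by simp

lemma form_invariant_iff_commute_J:
  assumes Y: "Y \<in> sets M" and h: "0 < h"
  shows "form_invariant M E Y \<longleftrightarrow> commute (cut M Y) (J h)"
proof -
  note lin = cut_lin[OF Y]
  have "op (cut M Y u) (cut M Y f)" if com: "commute (cut M Y) (J h)" and u: "op u f" for u f
  proof -
    note W = L_in[OF u]
    let ?g = "u + h *\<^sub>R f"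
    have g: "?g \<in> Lspace M" using W by simp
    have eq: "J h (cut M Y ?g) = cut M Y u"
      using commuteD[OF com g] J_eq[OF h u] by simp
    have "op (cut M Y u) ((1/h) *\<^sub>R (cut M Y ?g - cut M Y u))"
      using L_J[OF h lin_W[OF lin g]] unfolding eq .
    moreover have "cut M Y ?g - cut M Y u = h *\<^sub>R cut M Y f"
      using W by (simp add: lin_add[OF lin] lin_scale[OF lin])
    ultimately show ?thesis using h by simp
  qed
  moreover have "commute (cut M Y) (J h)" if "\<forall>u f. op u f \<longrightarrow> op (cut M Y u) (cut M Y f)"
    using that by (intro commute_J[OF h lin]) blast
  ultimately show ?thesis unfolding form_invariant_iff_op[OF Y] by blast
qed

text \<open>
  Multiplying \<open>(L + \<beta>) w = u\<close> by \<open>1/\<beta>\<close> gives \<open>(1 + h L) (\<beta> w) = u\<close> for \<open>h = 1/\<beta>\<close>.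
\<close>

lemma rep_form_resolvent:
  assumes b: "0 < \<beta>" and u: "u \<in> L2 M"
  shows "form_resolvent M E \<beta> u \<in> L2 M \<and> \<beta> *\<^sub>R rep M (form_resolvent M E \<beta> u) = J (1/\<beta>) (rep M u)"
proof -
  let ?h = "1/\<beta>"
  have h: "0 < ?h" using b by simp
  let ?K = "\<lambda>w. \<exists>g. form_operator M E w g \<and> (AE x in M. g x + \<beta> * w x = u x)"
  obtain w g where w: "op w g" "w + ?h *\<^sub>R g = ?h *\<^sub>R rep M u"
    using op_range[OF h, of "?h *\<^sub>R rep M u"] u H.W_scale rep_Lspace by metis
  have "\<beta> *\<^sub>R (w + ?h *\<^sub>R g) = \<beta> *\<^sub>R (?h *\<^sub>R rep M u)" using w(2) by simp
  then have gw: "g + \<beta> *\<^sub>R w = rep M u" using b by (simp add: scaleR_add_right add.commute)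
  have gw': "g x + \<beta> * w x = rep M u x" for x using fun_cong[OF gw, of x] by simp
  have "AE x in M. g x + \<beta> * w x = u x"
    unfolding gw' by (rule rep_AE)
  then have "?K w"
    using w(1) unfolding op_def by blast
  then have "?K (form_resolvent M E \<beta> u)"
    unfolding form_resolvent_def by (rule someI[of ?K])
  then obtain g where g: "form_operator M E (form_resolvent M E \<beta> u) g"
      "AE x in M. g x + \<beta> * form_resolvent M E \<beta> u x = u x" by blast
  let ?w = "form_resolvent M E \<beta> u"
  have L: "?w \<in> L2 M" "g \<in> L2 M" "op (rep M ?w) (rep M g)"
    using g(1) form_operator_iff_op by blast+
  have "rep M (g + \<beta> *\<^sub>R ?w) = rep M u"
    using g(2) L u by (subst rep_eq_iff) auto
  then have "\<beta> *\<^sub>R rep M ?w + ?h *\<^sub>R (\<beta> *\<^sub>R rep M g) = rep M u"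
    using b by (simp add: rep_add rep_scale add.commute)
  then show ?thesis
    using J_eq[OF h L_scale[OF L(3), of \<beta>]] L(1) by simp
qed

end

section \<open>Bounded forms\<close>

text \<open>
  Bounded symmetric nonnegative operators are the operators of their quadratic forms.
\<close>

lemma
  assumes A: "H.lin M A" "H.symm M A" "H.bounded_by M C A"
    and pos: "\<And>u. u \<in> Lspace M \<Longrightarrow> 0 \<le> L2_inner M (A u) u"
    and dom: "qdom F = L2 M"
    and val: "\<And>u. u \<in> L2 M \<Longrightarrow> qval F u = L2_inner M (A (rep M u)) (rep M u)"
  shows bounded_form_closed: "closed_L2_form M F"
    and bounded_form_op: "closed_L2_form.op M F u f \<longleftrightarrow> u \<in> Lspace M \<and> f = A u"
proof -
  have AW: "A (rep M u) \<in> Lspace M" if "u \<in> L2 M" for u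
    using H.lin_W[OF A(1) rep_Lspace[OF that]] .
  have val_add: "qval F (u + v) = qval F u + 2 * L2_inner M (A (rep M u)) (rep M v) + qval F v"
    and val_diff: "qval F (u - v) = qval F u - 2 * L2_inner M (A (rep M u)) (rep M v) + qval F v"
    if u: "u \<in> L2 M" and v: "v \<in> L2 M" for u v
  proof -
    have "L2_inner M (A (rep M v)) (rep M u) = L2_inner M (A (rep M u)) (rep M v)"
      using A(2) u v H.ip_commute[of "rep M u" M "A (rep M v)"] AW by (simp add: H.symm_def)
    then show "qval F (u + v) = qval F u + 2 * L2_inner M (A (rep M u)) (rep M v) + qval F v"
      "qval F (u - v) = qval F u - 2 * L2_inner M (A (rep M u)) (rep M v) + qval F v"
      using u v AW[OF u] AW[OF v]
      by (simp_all add: val rep_add rep_diff H.lin_add[OF A(1)] H.lin_diff[OF A(1)] H.ip_linear)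
  qed
  have pol: "polar F u v = L2_inner M (A (rep M u)) (rep M v)" if "u \<in> L2 M" "v \<in> L2 M" for u v
    using val_add[OF that] val_diff[OF that] by (simp add: polar_def plus_fun_def fun_diff_def)
  have "nonneg_quadratic_form M F"
    unfolding nonneg_quadratic_form_def dom
  proof (intro conjI ballI allI impI)
    fix u v w :: "'a \<Rightarrow> real" and c :: real
    assume u: "u \<in> L2 M"
    show "0 \<le> qval F u" using u pos by (simp add: val)
    have cu: "(\<lambda>x. c * u x) = c *\<^sub>R u" by (rule ext) simp
    show "(\<lambda>x. c * u x) \<in> L2 M" unfolding cu using u by simp
    show "qval F (\<lambda>x. c * u x) = c\<^sup>2 * qval F u"
      unfolding cu using u AW[OF u]
      by (simp add: val rep_scale H.lin_scale[OF A(1)] H.ip_linear power2_eq_square)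
    {
      assume w: "w \<in> L2 M"
      show "polar F (\<lambda>x. c * u x) w = c * polar F u w"
        unfolding cu using u w AW[OF u] by (simp add: pol rep_scale H.lin_scale[OF A(1)] H.ip_linear)
    }
    assume v: "v \<in> L2 M"
    have uv: "(\<lambda>x. u x + v x) = u + v" by (rule ext) simp
    show "(\<lambda>x. u x + v x) \<in> L2 M" unfolding uv using u v by simp
    { assume "AE x in M. u x = v x"
      then have "rep M u = rep M v" using u v by (simp add: rep_eq_iff)
      then show "qval F v = qval F u" using u v by (simp add: val) }
    assume w: "w \<in> L2 M"
    show "polar F (\<lambda>x. u x + v x) w = polar F u w + polar F v w"
      unfolding uv using u v w AW[OF u] AW[OF v] by (simp add: pol rep_add H.lin_add[OF A(1)] H.ip_linear)
  qed (use L2_zero in \<open>auto simp: zero_fun_def\<close>)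
  moreover have "densely_defined M F"
    unfolding densely_defined_def dom
    by (intro ballI allI impI, rule bexI) (auto simp: L2_norm_def L2_inner_def)
  moreover have "closed_form M F"
    unfolding closed_form_def dom
  proof (intro allI impI conjI)
    fix a :: "nat \<Rightarrow> 'a \<Rightarrow> real" and u
    assume a: "\<forall>n. a n \<in> L2 M" and u: "u \<in> L2 M" and lim: "(\<lambda>n. L2_norm M (\<lambda>x. a n x - u x)) \<longlonglongrightarrow> 0"
    show "(\<lambda>n. qval F (\<lambda>x. a n x - u x)) \<longlonglongrightarrow> 0"
    proof (rule tendsto_sandwich[OF _ _ tendsto_const])
      show "(\<lambda>n. C * (L2_norm M (\<lambda>x. a n x - u x) * L2_norm M (\<lambda>x. a n x - u x))) \<longlonglongrightarrow> 0"
        using tendsto_mult_left[OF tendsto_mult[OF lim lim], of C] by simp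
      have d: "a n - u \<in> L2 M" for n using a u by simp
      have "qval F (a n - u) \<le> C * (L2_norm M (a n - u) * L2_norm M (a n - u))" for n
      proof -
        let ?d = "rep M (a n - u)"
        have W: "?d \<in> Lspace M" "A ?d \<in> Lspace M" using d AW by auto
        have "L2_inner M (A ?d) ?d \<le> H.nrm M (A ?d) * H.nrm M ?d"
          using H.Cauchy_Schwarz[OF W(2,1)] by simp
        also have "\<dots> \<le> C * H.nrm M ?d * H.nrm M ?d"
          using W by (intro mult_right_mono H.bounded_byD[OF A(3)]) auto
        finally show ?thesis using d by (simp add: val nrm_eq_L2_norm)
      qed
      then show "\<forall>\<^sub>F n in sequentially. qval F (\<lambda>x. a n x - u x)
          \<le> C * (L2_norm M (\<lambda>x. a n x - u x) * L2_norm M (\<lambda>x. a n x - u x))"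
        by (simp add: fun_diff_def)
      have "0 \<le> qval F (a n - u)" for n
        unfolding val[OF d] by (rule pos[OF rep_Lspace[OF d]])
      then show "\<forall>\<^sub>F n in sequentially. 0 \<le> qval F (\<lambda>x. a n x - u x)"
        by (simp add: fun_diff_def)
    qed
  qed auto
  ultimately show F: "closed_L2_form M F" by unfold_locales
  interpret F: closed_L2_form M F by (rule F)
  show "closed_L2_form.op M F u f \<longleftrightarrow> u \<in> Lspace M \<and> f = A u"
  proof
    assume op: "F.op u f"
    then have W: "u \<in> Lspace M" "f \<in> Lspace M" unfolding F.op_def by blast+
    have AuW: "A u \<in> Lspace M" using H.lin_W[OF A(1) W(1)] .
    have "L2_inner M (A u) v = L2_inner M f v" if "v \<in> Lspace M" for v
    proof -
      have "polar F u v = L2_inner M f v"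
        using op that Lspace_L2[OF that] unfolding F.op_iff dom by blast
      then show ?thesis
        using pol[OF Lspace_L2[OF W(1)] Lspace_L2[OF that]] W that by simp
    qed
    then have "L2_inner M (A u - f) (A u - f) = 0"
      using W AuW by (simp add: H.ip_diff_left)
    then have "A u - f = 0" using H.ip_definite[of "A u - f" M] W AuW by simp
    then show "u \<in> Lspace M \<and> f = A u" using W by simp
  next
    assume "u \<in> Lspace M \<and> f = A u"
    then have u: "u \<in> Lspace M" and f: "f = A u" by blast+
    have "polar F u v = L2_inner M (A u) v" if "v \<in> Lspace M" for v
      using pol[OF Lspace_L2[OF u] Lspace_L2[OF that]] u that by simp
    then show "F.op u f"
      unfolding F.op_iff dom f using u Lspace_L2[OF u] H.lin_W[OF A(1) u] by blast
  qed
qed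

text \<open>
  Both approximations of a form have an operator \<open>c (1 - B)\<close> with a symmetric contraction \<open>B\<close>. Invariance then means that
  the indicator commutes with \<open>B\<close>.
\<close>

lemma defect_form_invariant:
  assumes B: "H.lin M B" "H.symm M B" "H.bounded_by M 1 B" and c: "0 < c"
    and T: "\<And>u. u \<in> L2 M \<Longrightarrow> T u \<in> L2 M" "\<And>u. u \<in> L2 M \<Longrightarrow> rep M (T u) = B (rep M u)"
    and F: "qdom F = L2 M" "\<And>u. qval F u = c * L2_inner M (\<lambda>x. u x - T u x) u"
    and Y: "Y \<in> sets M"
  shows "form_invariant M F Y \<longleftrightarrow> H.commute M (cut M Y) B"
proof -
  define A where "A x = c *\<^sub>R (x - B x)" for x
  note BW = H.lin_W[OF B(1)] and P = cut_lin[OF Y]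
  note PW = H.lin_W[OF P]
  have A: "H.lin M A"
    unfolding H.lin_def A_def using BW
    by (auto simp: H.lin_add[OF B(1)] H.lin_scale[OF B(1)] algebra_simps)
  have As: "H.symm M A"
    using B(2) BW unfolding H.symm_def A_def by (simp add: H.ip_linear)
  have Ab: "H.bounded_by M (c * 2) A"
    unfolding H.bounded_by_def
  proof
    fix x assume x: "x \<in> Lspace M"
    have "H.nrm M (x - B x) \<le> H.nrm M x + H.nrm M (B x)"
      using x BW by (intro H.nrm_diff_le) auto
    also have "\<dots> \<le> 2 * H.nrm M x" using H.contractionD[OF B(3) x] by simp
    finally have "c * H.nrm M (x - B x) \<le> c * (2 * H.nrm M x)" using c by simp
    then show "H.nrm M (A x) \<le> c * 2 * H.nrm M x"
      using H.nrm_scale[of "x - B x" M c] c x BW by (simp add: A_def)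
  qed
  have pos: "0 \<le> L2_inner M (A x) x" if x: "x \<in> Lspace M" for x
  proof -
    have "L2_inner M (B x) x \<le> H.nrm M (B x) * H.nrm M x"
      using H.Cauchy_Schwarz[OF BW[OF x] x] by simp
    also have "\<dots> \<le> H.nrm M x * H.nrm M x"
      using H.contractionD[OF B(3) x] x by (intro mult_right_mono) auto
    also have "\<dots> = L2_inner M x x" using H.nrm_sq[OF x] by (simp add: power2_eq_square)
    finally show ?thesis using x BW[OF x] c by (simp add: A_def H.ip_linear)
  qed
  have val: "qval F u = L2_inner M (A (rep M u)) (rep M u)" if u: "u \<in> L2 M" for u
  proof -
    have "qval F u = c * L2_inner M (rep M (u - T u)) (rep M u)"
      using F(2)[of u] L2_inner_rep[OF L2_diff[OF u T(1)[OF u]] u] by (simp add: fun_diff_def)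
    also have "\<dots> = L2_inner M (c *\<^sub>R rep M (u - T u)) (rep M u)"
      using u T(1)[OF u] by (simp add: H.ip_scale_left)
    finally show ?thesis using T(2)[OF u] by (simp add: A_def rep_diff)
  qed
  interpret F: closed_L2_form M F by (rule bounded_form_closed[OF A As Ab pos F(1) val])
  have op: "F.op u f \<longleftrightarrow> u \<in> Lspace M \<and> f = A u" for u f
    by (rule bounded_form_op[OF A As Ab pos F(1) val])
  have eq: "cut M Y (A x) = A (cut M Y x) \<longleftrightarrow> cut M Y (B x) = B (cut M Y x)" if x: "x \<in> Lspace M" for x
    unfolding A_def using x BW[OF x] c by (simp add: H.lin_scale[OF P] H.lin_diff[OF P])
  have "form_invariant M F Y \<longleftrightarrow> (\<forall>x\<in>Lspace M. cut M Y (A x) = A (cut M Y x))"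
    unfolding F.form_invariant_iff_op[OF Y] op using PW by blast
  then show ?thesis using eq by (simp add: H.commute_def)
qed

context closed_L2_form
begin

lemma time_approx_invariant_iff:
  assumes t: "0 < t" and Y: "Y \<in> sets M"
  shows "form_invariant M (time_approx M E t) Y \<longleftrightarrow> form_invariant M E Y"
proof -
  have "form_invariant M (time_approx M E t) Y \<longleftrightarrow> commute (cut M Y) (S t)"
    using t form_semigroup_L2 rep_form_semigroup
    by (intro defect_form_invariant[where T = "form_semigroup M E t" and c = "1/t"]
        S_lin S_symm S_contraction Y) (auto simp: time_approx_def)
  then show ?thesis using form_invariant_iff_commute[OF Y t] by simp
qed

lemma deny_yosida_approx_invariant_iff:
  assumes b: "0 < \<beta>" and Y: "Y \<in> sets M"
  shows "form_invariant M (deny_yosida_approx M E \<beta>) Y \<longleftrightarrow> form_invariant M E Y"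
proof -
  have h: "0 < 1/\<beta>" using b by simp
  have "form_invariant M (deny_yosida_approx M E \<beta>) Y \<longleftrightarrow> commute (cut M Y) (J (1/\<beta>))"
  proof (rule defect_form_invariant[where T = "\<lambda>u. \<beta> *\<^sub>R form_resolvent M E \<beta> u" and c = \<beta>])
    show "rep M (\<beta> *\<^sub>R form_resolvent M E \<beta> u) = J (1/\<beta>) (rep M u)" if "u \<in> L2 M" for u
      using rep_form_resolvent[OF b that] by (simp add: rep_scale)
  qed (use rep_form_resolvent[OF b] b Y h J_lin J_symm J_contraction in \<open>auto simp: deny_yosida_approx_def\<close>)
  then show ?thesis using form_invariant_iff_commute_J[OF Y h] by simp
qed

end

theorem theorem3p1:
  fixes M :: "'a::t2_space measure" and E :: "'a qform" and Y :: "'a set"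
  assumes "sigma_finite_measure M"
    and "radon_measure M"
    and "measure_support M = UNIV"
    and "dirichlet_form M E"
    and "Y \<in> sets M"
  shows "((\<forall>t > 0. form_invariant M (time_approx M E t) Y)
            \<longleftrightarrow> (\<forall>\<beta> > 0. form_invariant M (deny_yosida_approx M E \<beta>) Y)) \<and>
         ((\<forall>\<beta> > 0. form_invariant M (deny_yosida_approx M E \<beta>) Y)
            \<longleftrightarrow> form_invariant M E Y)"
proof -
  interpret closed_L2_form M E
    using assms(4) by unfold_locales (auto simp: dirichlet_form_def)
  have time: "(\<forall>t>0. form_invariant M (time_approx M E t) Y) \<longleftrightarrow> form_invariant M E Y"
    using time_approx_invariant_iff[OF _ assms(5)] by (meson zero_less_one)
  have yosida: "(\<forall>\<beta>>0. form_invariant M (deny_yosida_approx M E \<beta>) Y) \<longleftrightarrow> form_invariant M E Y"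
    using deny_yosida_approx_invariant_iff[OF _ assms(5)] by (meson zero_less_one)
  show ?thesis
    unfolding time yosida by simp
qed

end
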